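(* Let $n,m\ge1$ and let $\widetilde B\subset\mathbb{R}^{2n+2m}$ be a symplectic image of a Euclidean ball. Let $V$ denote the assertion that $\mathrm{sys}_N(L)\le1$ for every $N\ge1$ and every convex domain $L\subset\mathbb{R}^{2N}$. (1) If there exist convex bodies $X\subset\mathbb{R}^{2n}$ and $Y\subset\mathbb{R}^{2m}$ containing the origin and some $1\le p\le\infty$, $p\ne2$, such that $\widetilde B=X\times_pY$, then $V$ is false. (2) If $\widetilde B=X\times_2Y$ for convex bodies $X\subset\mathbb{R}^{2n}$ and $Y\subset\mathbb{R}^{2m}$ containing the origin such that $\mathrm{sys}_n(X)\ne1$ or $\mathrm{sys}_m(Y)\ne1$, then $V$ is false.
   Context: A convex body (convex domain) in $\mathbb{R}^d$ is a compact convex set with non-empty interior. The space $\mathbb{R}^{2n}$ carries the standard symplectic form $\omega_n=dq\wedge dp$, and $\mathbb{R}^{2n}\times\mathbb{R}^{2m}\cong\mathbb{R}^{2(n+m)}$ carries the product form; $J$ is the standard linear complex structure. A symplectic image of a Euclidean ball is the image of a Euclidean ball in $\mathbb{R}^{2n+2m}$ under a symplectomorphism. $p$-product: for $1\le p<\infty$, $X\times_p Y=\bigcup_{0\le t\le1}\big((1-t)^{1/p}X\times t^{1/p}Y\big)$, and $X\times_\infty Y=X\times Y$. Capacity: for a convex body $K\subset\mathbb{R}^{2n}$ with smooth boundary, $c_{\rm EHZ}(K)$ is the minimal symplectic action $A(\gamma)=\int_\gamma\lambda$ ($d\lambda=\omega_n$) among closed characteristics $\gamma$ on $\partial K$, i.e.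 closed integral curves of the line field $\ker\omega_n|_{\partial K}$ (oriented along $J n_K$, with $n_K$ the outer unit normal). For a general convex body, $c_{\rm EHZ}$ is the extension of this by continuity in the Hausdorff metric; equivalently it is the minimal action among generalized closed characteristics, i.e. non-constant absolutely continuous closed curves $\gamma\subset\partial K$ with $\dot\gamma(t)\in J N_K(\gamma(t))$ for almost every $t$, where $N_K(x)$ is the outer normal cone of $K$ at $x$. On convex bodies $c_{\rm EHZ}$ coincides with normalized symplectic capacities such as the first Ekeland–Hofer and the Hofer–Zehnder capacity. Systolic ratio: $\mathrm{sys}_n(K)=\dfrac{c_{\rm EHZ}(K)}{(n!\,\mathrm{Vol}(K))^{1/n}}$, where $\mathrm{Vol}$ is Lebesgue measure. The assertion $V$ is the weak version of Viterbo's volume-capacity conjecture. *)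

theory Defs
  imports
    "HOL-Analysis.Analysis"
    "HOL-Analysis.Finite_Function_Topology"
    "HOL-Library.Extended_Real"
begin

text \<open>
  The assertion \<open>V\<close> ranges over all dimensions, so the dimension cannot be a type.  All spaces
  \<open>\<real>\<^sup>d\<close> are therefore coordinate subspaces \<^term>\<open>Rn d\<close> of the normed space of finitely supported
  real sequences.  The library norm on that type is the sum of the absolute values of the
  coordinates.  On each \<open>Rn d\<close> it is equivalent to the Euclidean norm, and it is used only where
  equivalent norms give the same notion (topology, derivatives, absolute continuity).  Euclidean
  geometry always refers to \<open>eucl_inner\<close>.

  Coordinates of \<open>\<real>\<^sup>2\<^sup>n\<close> are ordered as \<open>(q\<^sub>1, p\<^sub>1, \<dots>, q\<^sub>n, p\<^sub>n)\<close>, counted from 0.  With this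
  order the concatenation \<open>\<real>\<^sup>2\<^sup>n \<times> \<real>\<^sup>2\<^sup>m \<cong> \<real>\<^sup>2\<^sup>(\<^sup>n\<^sup>+\<^sup>m\<^sup>)\<close> carries the product form to the standard form.
\<close>

type_synonym rseq = "nat \<Rightarrow>\<^sub>0 real"

abbreviation coord :: "rseq \<Rightarrow> nat \<Rightarrow> real"
  where "coord \<equiv> Poly_Mapping.lookup"

definition Rn :: "nat \<Rightarrow> rseq set"
  where "Rn d = {x. \<forall>i\<ge>d. coord x i = 0}"

definition vec_of :: "nat \<Rightarrow> (nat \<Rightarrow> real) \<Rightarrow> rseq"
  where "vec_of d f = (\<Sum>i<d. Poly_Mapping.single i (f i))"

lemma coord_vec_of: "coord (vec_of d f) i = (if i < d then f i else 0)"
  by (auto simp: vec_of_def lookup_sum lookup_single when_def)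

definition eucl_inner :: "nat \<Rightarrow> rseq \<Rightarrow> rseq \<Rightarrow> real"
  where "eucl_inner d x y = (\<Sum>i<d. coord x i * coord y i)"

definition eucl_ball :: "nat \<Rightarrow> rseq \<Rightarrow> real \<Rightarrow> rseq set"
  where "eucl_ball d a r = {x \<in> Rn d. sqrt (eucl_inner d (x - a) (x - a)) \<le> r}"

definition convex_body :: "nat \<Rightarrow> rseq set \<Rightarrow> bool"
  where "convex_body d K \<longleftrightarrow>
    K \<subseteq> Rn d \<and> compact K \<and> convex K \<and> top_of_set (Rn d) interior_of K \<noteq> {}"

definition Vol :: "nat \<Rightarrow> rseq set \<Rightarrow> real"
  where "Vol d K =
    measure (\<Pi>\<^sub>M i\<in>{..<d}. lborel) ((\<lambda>x. restrict (coord x) {..<d}) ` K)"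


subsection \<open>Linear symplectic structure and symplectomorphisms\<close>

text \<open>\<open>\<omega> = dq \<and> dp\<close>, and \<open>J\<close> sends \<open>\<partial>/\<partial>q\<close> to \<open>\<partial>/\<partial>p\<close> and \<open>\<partial>/\<partial>p\<close> to \<open>-\<partial>/\<partial>q\<close>, so that
  \<open>\<omega>(u, J u)\<close> is the squared Euclidean norm of \<open>u\<close>.\<close>

definition omega :: "nat \<Rightarrow> rseq \<Rightarrow> rseq \<Rightarrow> real"
  where "omega n u v =
    (\<Sum>i<n. coord u (2*i) * coord v (2*i + 1) - coord u (2*i + 1) * coord v (2*i))"

definition J_std :: "nat \<Rightarrow> rseq \<Rightarrow> rseq"
  where "J_std n x =
    vec_of (2*n) (\<lambda>k. if even k then - coord x (k + 1) else coord x (k - 1))"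

definition dir_deriv :: "(rseq \<Rightarrow> rseq) \<Rightarrow> rseq \<Rightarrow> rseq \<Rightarrow> rseq"
  where "dir_deriv f x v = vector_derivative (\<lambda>t::real. f (x + t *\<^sub>R v)) (at 0)"

text \<open>\<open>Ck d k f\<close>: all partial derivatives of order at most \<open>k\<close> of \<open>f\<close> restricted to \<open>\<real>\<^sup>d\<close> exist
  and are continuous.\<close>

primrec Ck :: "nat \<Rightarrow> nat \<Rightarrow> (rseq \<Rightarrow> rseq) \<Rightarrow> bool" where
  "Ck d 0 f \<longleftrightarrow> continuous_on (Rn d) f"
| "Ck d (Suc k) f \<longleftrightarrow> continuous_on (Rn d) f \<and>
     (\<forall>i<d. (\<forall>x\<in>Rn d. (\<lambda>t::real. f (x + t *\<^sub>R Poly_Mapping.single i 1)) differentiable at 0) \<and>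
            Ck d k (\<lambda>x. dir_deriv f x (Poly_Mapping.single i 1)))"

definition smooth :: "nat \<Rightarrow> (rseq \<Rightarrow> rseq) \<Rightarrow> bool"
  where "smooth d f \<longleftrightarrow> (\<forall>k. Ck d k f)"

definition symplectomorphism :: "nat \<Rightarrow> (rseq \<Rightarrow> rseq) \<Rightarrow> bool"
  where "symplectomorphism N \<phi> \<longleftrightarrow>
    bij_betw \<phi> (Rn (2*N)) (Rn (2*N)) \<and>
    smooth (2*N) \<phi> \<and> smooth (2*N) (inv_into (Rn (2*N)) \<phi>) \<and>
    (\<forall>x\<in>Rn (2*N). \<forall>u\<in>Rn (2*N). \<forall>v\<in>Rn (2*N).
       omega N (dir_deriv \<phi> x u) (dir_deriv \<phi> x v) = omega N u v)"

definition symplectic_ball :: "nat \<Rightarrow> rseq set \<Rightarrow> bool"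
  where "symplectic_ball N B \<longleftrightarrow>
    (\<exists>\<phi> a r. symplectomorphism N \<phi> \<and> a \<in> Rn (2*N) \<and> r > 0 \<and> B = \<phi> ` eucl_ball (2*N) a r)"


subsection \<open>The Ekeland--Hofer--Zehnder capacity\<close>

definition normal_cone :: "nat \<Rightarrow> rseq set \<Rightarrow> rseq \<Rightarrow> rseq set"
  where "normal_cone d K x = {\<nu> \<in> Rn d. \<forall>y\<in>K. eucl_inner d \<nu> (y - x) \<le> 0}"

definition abs_continuous_on :: "real \<Rightarrow> real \<Rightarrow> (real \<Rightarrow> 'a::real_normed_vector) \<Rightarrow> bool"
  where "abs_continuous_on a b \<gamma> \<longleftrightarrow>
    (\<forall>\<epsilon>>0. \<exists>\<delta>>0. \<forall>(k::nat) s t.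
       (\<forall>i<k. a \<le> s i \<and> s i \<le> t i \<and> t i \<le> b) \<longrightarrow>
       disjoint_family_on (\<lambda>i. {s i<..<t i}) {..<k} \<longrightarrow>
       (\<Sum>i<k. t i - s i) < \<delta> \<longrightarrow>
       (\<Sum>i<k. norm (\<gamma> (t i) - \<gamma> (s i))) < \<epsilon>)"

definition gen_closed_characteristic :: "nat \<Rightarrow> rseq set \<Rightarrow> (real \<Rightarrow> rseq) \<Rightarrow> bool"
  where "gen_closed_characteristic n K \<gamma> \<longleftrightarrow>
    abs_continuous_on 0 1 \<gamma> \<and> \<gamma> 0 = \<gamma> 1 \<and> \<not> \<gamma> constant_on {0..1} \<and>
    \<gamma> ` {0..1} \<subseteq> top_of_set (Rn (2*n)) frontier_of K \<and>
    (AE t in lebesgue_on {0..1}.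
       \<exists>\<nu> \<in> normal_cone (2*n) K (\<gamma> t). (\<gamma> has_vector_derivative J_std n \<nu>) (at t within {0..1}))"

text \<open>\<open>\<integral>\<^sub>\<gamma> \<lambda>\<close> for the primitive \<open>\<lambda> = (q dp - p dq) / 2\<close>, i.e. \<open>\<lambda>\<^sub>x(v) = \<omega>(x, v) / 2\<close>; on closed
  curves the value does not depend on the primitive.\<close>

definition action :: "nat \<Rightarrow> (real \<Rightarrow> rseq) \<Rightarrow> real"
  where "action n \<gamma> =
    integral {0..1} (\<lambda>t. omega n (\<gamma> t) (vector_derivative \<gamma> (at t within {0..1})) / 2)"

text \<open>The infimum is attained on every convex body with \<open>n \<ge> 1\<close>, so this is the minimal action.\<close>

definition c_EHZ :: "nat \<Rightarrow> rseq set \<Rightarrow> real"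
  where "c_EHZ n K = Inf (action n ` {\<gamma>. gen_closed_characteristic n K \<gamma>})"

definition sys :: "nat \<Rightarrow> rseq set \<Rightarrow> real"
  where "sys n K = c_EHZ n K / root n (fact n * Vol (2*n) K)"

definition weak_Viterbo :: bool
  where "weak_Viterbo \<longleftrightarrow> (\<forall>N\<ge>1. \<forall>L. convex_body (2*N) L \<longrightarrow> sys N L \<le> 1)"


subsection \<open>Products\<close>

definition concat_vec :: "nat \<Rightarrow> nat \<Rightarrow> rseq \<Rightarrow> rseq \<Rightarrow> rseq"
  where "concat_vec d e x y =
    vec_of (d + e) (\<lambda>i. if i < d then coord x i else coord y (i - d))"

definition vprod :: "nat \<Rightarrow> nat \<Rightarrow> rseq set \<Rightarrow> rseq set \<Rightarrow> rseq set"
  where "vprod d e X Y = (\<lambda>(x, y). concat_vec d e x y) ` (X \<times> Y)"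

text \<open>Only meaningful for \<open>1 \<le> p\<close>; recall \<open>0 powr a = 0\<close>.\<close>

definition p_product :: "nat \<Rightarrow> nat \<Rightarrow> ereal \<Rightarrow> rseq set \<Rightarrow> rseq set \<Rightarrow> rseq set"
  where "p_product d e p X Y =
    (if p = \<infinity> then vprod d e X Y
     else \<Union>t\<in>{0..1}. vprod d e
            ((*\<^sub>R) ((1 - t) powr (1 / real_of_ereal p)) ` X)
            ((*\<^sub>R) (t powr (1 / real_of_ereal p)) ` Y))"

end

theory Submission
  imports Defs "HOL-Probability.Distributions"
begin

text \<open>
  Let \<open>B\<close> be the image of a ball of radius \<open>r\<close> under a symplectomorphism \<open>\<phi>\<close>, and suppose
  \<open>B = X \<times>\<^sub>p Y\<close>.  The characteristics on the boundary of \<open>B\<close> are the images of the Hopf circles of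
  the sphere, so every closed one has as its action a positive multiple of \<open>\<pi> r\<^sup>2\<close>
  (\<open>action_circle_image\<close>).  The factors inherit this bound.  A generalised closed characteristic of
  \<open>X\<close>, placed in \<open>X \<times> 0\<close>, runs along normals of \<open>B\<close>; as the boundary of \<open>B\<close> is smooth, these are
  non-negative multiples of one gradient (\<open>normal_is_multiple_of_grad\<close>), so the curve follows a Hopf
  circle and its action is at least \<open>\<pi> r\<^sup>2\<close> (\<open>action_ge_of_normal_curve\<close>,
  \<open>factor_characteristic_action_ge\<close>).  The same holds for \<open>Y\<close>, and \<open>c_EHZ X\<close> and \<open>c_EHZ Y\<close> are at
  least \<open>\<pi> r\<^sup>2\<close> as soon as the factors carry closed characteristics at all.

  On the side of volumes, \<open>n!\<close> times the volume of a convex body in \<open>\<real>\<^sup>2\<^sup>n\<close> is the integral of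
  \<open>exp (- g\<^sup>2)\<close> for its gauge \<open>g\<close>.  The squared gauge of \<open>X \<times>\<^sub>2 Y\<close> is the sum of the squared gauges,
  so these integrals multiply (\<open>volume_two_product\<close>).  If \<open>p \<ge> 2\<close>, then \<open>X \<times>\<^sub>2 Y \<subseteq> X \<times>\<^sub>p Y = B\<close>.
  Under the conjecture this gives
  \<open>(\<pi> r\<^sup>2)\<^sup>n\<^sup>+\<^sup>m \<le> c(X)\<^sup>n c(Y)\<^sup>m \<le> n! Vol X \<cdot> m! Vol Y = (n+m)! Vol (X \<times>\<^sub>2 Y) \<le> (n+m)! Vol B\<close>,
  and the last term is at most \<open>(\<pi> r\<^sup>2)\<^sup>n\<^sup>+\<^sup>m\<close> because \<open>\<phi>\<close> does not increase volume.  So all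
  inequalities are equalities.  For \<open>p > 2\<close> this is impossible, as \<open>X \<times>\<^sub>2 Y\<close> then has smaller volume
  than \<open>B\<close> (\<open>strict_volume_gap\<close>), and for \<open>p = 2\<close> it says that \<open>X\<close> and \<open>Y\<close> have systolic ratio one
  (\<open>symplectic_ball_p_product_rigid\<close>).

  The other exponents, and a factor with zero on its boundary, are excluded by the smoothness of the
  boundary of \<open>B\<close>.  At a point of \<open>X \<times> 0\<close> where the first coordinate is maximal the gradient is
  known explicitly; this makes zero an interior point of \<open>Y\<close> (\<open>complementary_factor_absorbing\<close>),
  contradicts the edges of an \<open>X \<times>\<^sub>p Y\<close> with \<open>p < 2\<close>, which are sharper than a boundary of class
  \<open>C\<^sup>2\<close> can be (\<open>no_small_exponent\<close>), and contradicts the corners of a Cartesian product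
  (\<open>no_infinite_exponent\<close>).  For \<open>2 \<le> p < \<infinity>\<close> the factors do carry closed characteristics: the Hopf
  orbit of \<open>B\<close> through a boundary point of \<open>X \<times> 0\<close> never leaves \<open>X \<times> 0\<close>
  (\<open>factor_has_characteristic\<close>).

  That \<open>\<phi>\<close> does not increase the volume of the ball (\<open>measure_body_le\<close>) is reduced to linear maps by
  averaging over small cubes.  A symplectic linear map is composed of transvections, and a transvection \<open>T\<close> is
  conjugate to \<open>T \<circ> T\<close> by a linear automorphism, so the factor by which it scales volumes is one
  (\<open>transvection_preserves_leb\<close>); that such a factor exists is the uniqueness of Haar measure
  (\<open>haar_unique\<close>).\<close>

section \<open>Coordinate geometry of \<open>\<real>\<^sup>d\<close>\<close>

abbreviation unit_vec :: "nat \<Rightarrow> rseq"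
  where "unit_vec i \<equiv> Poly_Mapping.single i 1"

lemma coord_add [simp]: "coord (x + y) i = coord x i + coord y i"
  by (simp add: lookup_add)

lemma coord_minus [simp]: "coord (x - y) i = coord x i - coord y i"
  by (simp add: lookup_minus)

lemma coord_uminus [simp]: "coord (- x) i = - coord x i"
  by (simp)

lemma coord_scaleR [simp]: "coord (r *\<^sub>R x) i = r * coord x i"
proof -
  have "finite {i. coord x i \<noteq> 0}" by simp
  then have "finite {i. r * coord x i \<noteq> 0}"
    by (rule rev_finite_subset) auto
  then show ?thesis
    by (simp add: scaleR_poly_mapping_def)
qed

lemma coord_sum [simp]: "coord (\<Sum>i\<in>A. f i) k = (\<Sum>i\<in>A. coord (f i) k)"
  by (simp add: lookup_sum)

lemma coord_unit_vec [simp]: "coord (unit_vec i) k = (if k = i then 1 else 0)"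
  by (simp add: lookup_single when_def)

lemma norm_eq_sum_coord:
  assumes "x \<in> Rn d"
  shows "norm x = (\<Sum>i<d. \<bar>coord x i\<bar>)"
proof -
  have sub: "Poly_Mapping.keys x \<subseteq> {..<d}"
    using assms by (auto simp: Rn_def in_keys_iff intro: ccontr[of "_ < d"] dest: leI)
  have "norm x = (\<Sum>i\<in>Poly_Mapping.keys x. \<bar>coord x i\<bar>)"
    by (simp add: norm_poly_mapping_def dist_poly_mapping_def)
  also have "\<dots> = (\<Sum>i<d. \<bar>coord x i\<bar>)"
    using sub by (intro sum.mono_neutral_left) (auto simp: in_keys_iff)
  finally show ?thesis .
qed

lemma in_some_Rn: "\<exists>d. x \<in> Rn d"
proof -
  have "finite {i. coord x i \<noteq> 0}" by simp
  then obtain d where "\<forall>i\<in>{i. coord x i \<noteq> 0}. i < d"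
    using finite_nat_set_iff_bounded by blast
  then show ?thesis by (auto simp: Rn_def intro!: exI[of _ d] dest: leD)
qed

lemma abs_coord_le_norm: "\<bar>coord x i\<bar> \<le> norm x"
proof -
  obtain d where d: "x \<in> Rn d" using in_some_Rn by blast
  show ?thesis
  proof (cases "i < d")
    case True
    have "\<bar>coord x i\<bar> \<le> (\<Sum>i<d. \<bar>coord x i\<bar>)"
      using True by (intro member_le_sum) auto
    then show ?thesis using norm_eq_sum_coord[OF d] by simp
  next
    case False
    then show ?thesis using d by (auto simp: Rn_def)
  qed
qed

lemma bounded_linear_coord: "bounded_linear (\<lambda>x. coord x i)"
  by (rule bounded_linear_intro[where K = 1]) (auto simp: abs_coord_le_norm)

lemmas coord_continuous [continuous_intros] = bounded_linear.continuous_on[OF bounded_linear_coord]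
lemmas coord_has_vector_derivative [derivative_intros] =
  bounded_linear.has_vector_derivative[OF bounded_linear_coord]

lemma Rn_add [simp, intro]: "x \<in> Rn d \<Longrightarrow> y \<in> Rn d \<Longrightarrow> x + y \<in> Rn d"
  and Rn_diff [simp, intro]: "x \<in> Rn d \<Longrightarrow> y \<in> Rn d \<Longrightarrow> x - y \<in> Rn d"
  and Rn_uminus [simp, intro]: "x \<in> Rn d \<Longrightarrow> - x \<in> Rn d"
  and Rn_scaleR [simp, intro]: "x \<in> Rn d \<Longrightarrow> r *\<^sub>R x \<in> Rn d"
  and Rn_0 [simp, intro]: "0 \<in> Rn d"
  by (auto simp: Rn_def)

lemma Rn_sum [simp, intro]: "(\<And>i. i \<in> A \<Longrightarrow> f i \<in> Rn d) \<Longrightarrow> (\<Sum>i\<in>A. f i) \<in> Rn d"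
  by (auto simp: Rn_def)

lemma Rn_unit_vec [simp, intro]: "i < d \<Longrightarrow> unit_vec i \<in> Rn d"
  by (auto simp: Rn_def)

lemma Rn_vec_of [simp, intro]: "vec_of d f \<in> Rn d"
  by (auto simp: Rn_def coord_vec_of)

lemma coord_eq_0_Rn: "x \<in> Rn d \<Longrightarrow> d \<le> i \<Longrightarrow> coord x i = 0"
  by (auto simp: Rn_def)

lemma subspace_Rn: "subspace (Rn d)"
  by (auto simp: subspace_def)

lemma convex_Rn [simp]: "convex (Rn d)"
  by (simp add: subspace_Rn subspace_imp_convex)

lemma closed_Rn [simp]: "closed (Rn d)"
proof -
  have "Rn d = (\<Inter>i\<in>{d..}. {x. coord x i = 0})"
    by (auto simp: Rn_def)
  then show ?thesis
    by (auto intro!: closed_INT closed_Collect_eq coord_continuous continuous_on_id)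
qed

lemma Rn_eqI:
  assumes "x \<in> Rn d" "y \<in> Rn d" "\<And>i. i < d \<Longrightarrow> coord x i = coord y i"
  shows "x = y"
proof (rule poly_mapping_eqI)
  fix i show "coord x i = coord y i"
    using assms by (cases "i < d") (auto simp: Rn_def)
qed

lemma Rn_expansion:
  assumes "x \<in> Rn d"
  shows "x = (\<Sum>i<d. coord x i *\<^sub>R unit_vec i)"
proof (rule Rn_eqI[OF assms])
  fix i assume "i < d"
  have "(\<Sum>j<d. coord x j * (if i = j then 1 else 0)) = (\<Sum>j<d. if i = j then coord x j else 0)"
    by (rule sum.cong) auto
  then show "coord x i = coord (\<Sum>i<d. coord x i *\<^sub>R unit_vec i) i"
    using \<open>i < d\<close> by simp
qed auto

lemma norm_unit_vec [simp]: "norm (unit_vec i) = 1"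
  by (subst norm_eq_sum_coord[of _ "Suc i"]) (auto simp: if_distrib[of abs] cong: if_cong)

lemma eucl_inner_add_left: "eucl_inner d (x + y) z = eucl_inner d x z + eucl_inner d y z"
  and eucl_inner_add_right: "eucl_inner d z (x + y) = eucl_inner d z x + eucl_inner d z y"
  and eucl_inner_diff_left: "eucl_inner d (x - y) z = eucl_inner d x z - eucl_inner d y z"
  and eucl_inner_diff_right: "eucl_inner d z (x - y) = eucl_inner d z x - eucl_inner d z y"
  and eucl_inner_scale_left: "eucl_inner d (c *\<^sub>R x) z = c * eucl_inner d x z"
  and eucl_inner_scale_right: "eucl_inner d z (c *\<^sub>R x) = c * eucl_inner d z x"
  and eucl_inner_uminus_left: "eucl_inner d (- x) z = - eucl_inner d x z"
  and eucl_inner_uminus_right: "eucl_inner d z (- x) = - eucl_inner d z x"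
  by (simp_all add: eucl_inner_def algebra_simps sum.distrib sum_subtractf sum_negf sum_distrib_left)

lemmas eucl_inner_bilinear = eucl_inner_add_left eucl_inner_add_right eucl_inner_diff_left
  eucl_inner_diff_right eucl_inner_scale_left eucl_inner_scale_right
  eucl_inner_uminus_left eucl_inner_uminus_right

lemma eucl_inner_0 [simp]: "eucl_inner d 0 x = 0" "eucl_inner d x 0 = 0"
  by (simp_all add: eucl_inner_def)

lemma eucl_inner_commute: "eucl_inner d x y = eucl_inner d y x"
  by (simp add: eucl_inner_def mult.commute)

lemma eucl_inner_sum_left: "eucl_inner d (\<Sum>i\<in>A. f i) z = (\<Sum>i\<in>A. eucl_inner d (f i) z)"
  by (simp add: eucl_inner_def sum_distrib_right sum.swap[of _ A])

lemma eucl_inner_sum_right: "eucl_inner d z (\<Sum>i\<in>A. f i) = (\<Sum>i\<in>A. eucl_inner d z (f i))"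
  by (simp add: eucl_inner_commute[of d z] eucl_inner_sum_left)

lemma eucl_inner_unit_vec:
  "i < d \<Longrightarrow> eucl_inner d x (unit_vec i) = coord x i"
  "i < d \<Longrightarrow> eucl_inner d (unit_vec i) x = coord x i"
  by (simp_all add: eucl_inner_def if_distrib if_distribR cong: if_cong)

lemma eucl_inner_nonneg [simp]: "0 \<le> eucl_inner d x x"
  by (auto simp: eucl_inner_def intro!: sum_nonneg)

lemma eucl_inner_eq_0_iff: "x \<in> Rn d \<Longrightarrow> eucl_inner d x x = 0 \<longleftrightarrow> x = 0"
  by (auto simp: eucl_inner_def sum_nonneg_eq_0_iff intro!: Rn_eqI)

lemma eucl_inner_pos: "x \<in> Rn d \<Longrightarrow> x \<noteq> 0 \<Longrightarrow> 0 < eucl_inner d x x"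
  using eucl_inner_eq_0_iff[of x d] eucl_inner_nonneg[of d x] by linarith

lemma eucl_inner_continuous [continuous_intros]:
  "continuous_on S f \<Longrightarrow> continuous_on S g \<Longrightarrow> continuous_on S (\<lambda>x. eucl_inner d (f x) (g x))"
  unfolding eucl_inner_def by (intro continuous_intros)

lemma sum_upto_double: "(\<Sum>i<2*(n::nat). f i) = (\<Sum>i<n. f (2*i) + f (2*i+1) :: real)"
  by (induction n) auto

lemma coord_J_even: "i < n \<Longrightarrow> coord (J_std n x) (2*i) = - coord x (2*i+1)"
  and coord_J_odd: "i < n \<Longrightarrow> coord (J_std n x) (2*i+1) = coord x (2*i)"
  by (auto simp: J_std_def coord_vec_of)

lemma J_Rn [simp, intro]: "J_std n x \<in> Rn (2*n)"
  by (simp add: J_std_def)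

lemma omega_J_right: "omega n u (J_std n v) = eucl_inner (2*n) u v"
  by (simp add: omega_def eucl_inner_def sum_upto_double coord_J_even coord_J_odd[simplified])

lemma omega_add_left: "omega n (x + y) z = omega n x z + omega n y z"
  and omega_add_right: "omega n z (x + y) = omega n z x + omega n z y"
  and omega_diff_left: "omega n (x - y) z = omega n x z - omega n y z"
  and omega_diff_right: "omega n z (x - y) = omega n z x - omega n z y"
  and omega_scale_left: "omega n (c *\<^sub>R x) z = c * omega n x z"
  and omega_scale_right: "omega n z (c *\<^sub>R x) = c * omega n z x"
  and omega_uminus_left: "omega n (- x) z = - omega n x z"
  and omega_uminus_right: "omega n z (- x) = - omega n z x"
  by (simp_all add: omega_def algebra_simps sum.distrib sum_subtractf sum_negf sum_distrib_left)

lemmas omega_bilinear = omega_add_left omega_add_right omega_diff_left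
  omega_diff_right omega_scale_left omega_scale_right omega_uminus_left omega_uminus_right

lemma omega_skew: "omega n x y = - omega n y x"
  unfolding omega_def sum_negf[symmetric] by (rule sum.cong) auto

lemma omega_J_left: "omega n (J_std n u) v = - eucl_inner (2*n) u v"
  using omega_skew[of n v "J_std n u"] by (simp add: omega_J_right eucl_inner_commute)

lemma omega_self [simp]: "omega n x x = 0"
  using omega_skew[of n x x] by simp

lemma omega_0 [simp]: "omega n 0 x = 0" "omega n x 0 = 0"
  by (simp_all add: omega_def)

lemma omega_continuous [continuous_intros]:
  "continuous_on S f \<Longrightarrow> continuous_on S g \<Longrightarrow> continuous_on S (\<lambda>x. omega n (f x) (g x))"
  unfolding omega_def by (intro continuous_intros)

lemma J_add: "J_std n (x + y) = J_std n x + J_std n y"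
  and J_scale: "J_std n (c *\<^sub>R x) = c *\<^sub>R J_std n x"
  and J_0 [simp]: "J_std n 0 = 0"
  by (rule poly_mapping_eqI; simp add: J_std_def coord_vec_of)+

lemma J_J: "x \<in> Rn (2*n) \<Longrightarrow> J_std n (J_std n x) = - x"
proof (rule Rn_eqI)
  fix i assume "i < 2*n" "x \<in> Rn (2*n)"
  then show "coord (J_std n (J_std n x)) i = coord (- x) i"
    by (cases "even i") (auto simp: J_std_def coord_vec_of elim!: oddE evenE)
qed auto

lemma omega_nondegenerate:
  assumes "u \<in> Rn (2*n)" "\<And>v. v \<in> Rn (2*n) \<Longrightarrow> omega n u v = 0"
  shows "u = 0"
proof -
  have "eucl_inner (2*n) u u = 0"
    using assms(2)[of "J_std n u"] by (simp add: omega_J_right)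
  then show ?thesis using assms(1) eucl_inner_eq_0_iff by blast
qed

lemma eucl_inner_J [simp]: "eucl_inner (2*n) (J_std n x) (J_std n y) = eucl_inner (2*n) x y"
  by (simp add: eucl_inner_def sum_upto_double coord_J_even coord_J_odd[simplified])
     (simp add: add.commute)

lemma eucl_inner_J_self [simp]:
  "eucl_inner (2*n) x (J_std n x) = 0" "eucl_inner (2*n) (J_std n x) x = 0"
  using omega_J_left[of n x "J_std n x"] omega_self[of n "J_std n x"]
  by (simp_all add: eucl_inner_commute)

lemma compact_cube: "compact {x \<in> Rn d. \<forall>i. \<bar>coord x i\<bar> \<le> C}"
proof (induction d)
  case 0
  have "{x \<in> Rn 0. \<forall>i. \<bar>coord x i\<bar> \<le> C} \<subseteq> {0}"
    by (auto simp: Rn_def intro!: poly_mapping_eqI)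
  then show ?case
    using finite_subset by (intro finite_imp_compact) auto
next
  case (Suc d)
  let ?Q = "{x \<in> Rn d. \<forall>i. \<bar>coord x i\<bar> \<le> C}"
  let ?h = "\<lambda>(x, t::real). x + t *\<^sub>R unit_vec d"
  have "{x \<in> Rn (Suc d). \<forall>i. \<bar>coord x i\<bar> \<le> C} = ?h ` (?Q \<times> {-C..C})" (is "?L = ?R")
  proof (intro equalityI subsetI)
    fix x assume x: "x \<in> ?L"
    let ?y = "x - coord x d *\<^sub>R unit_vec d"
    have "0 \<le> C" using x abs_ge_zero[of "coord x 0"] order_trans by blast
    then have "?y \<in> ?Q" using x by (auto simp: Rn_def le_Suc_eq)
    moreover have "coord x d \<in> {-C..C}" using x by (auto simp: abs_le_iff minus_le_iff)
    ultimately show "x \<in> ?R" by (intro image_eqI[of _ _ "(?y, coord x d)"]) auto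
  next
    fix x assume "x \<in> ?R"
    then obtain y t where "x = y + t *\<^sub>R unit_vec d" "y \<in> ?Q" "t \<in> {-C..C}" by auto
    then show "x \<in> ?L" by (auto simp: Rn_def)
  qed
  moreover have "compact (?h ` (?Q \<times> {-C..C}))"
    by (intro compact_continuous_image compact_Times Suc compact_Icc)
       (auto simp: case_prod_beta intro!: continuous_intros)
  ultimately show ?case by simp
qed

lemma compact_Rn:
  assumes "closed S" "S \<subseteq> Rn d" "bounded S"
  shows "compact S"
proof -
  obtain C where C: "\<And>x. x \<in> S \<Longrightarrow> norm x \<le> C"
    using \<open>bounded S\<close> by (auto simp: bounded_iff)
  have "S \<subseteq> {x \<in> Rn d. \<forall>i. \<bar>coord x i\<bar> \<le> C}"
    using assms C abs_coord_le_norm order_trans by blast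
  then have eq: "S = {x \<in> Rn d. \<forall>i. \<bar>coord x i\<bar> \<le> C} \<inter> S" by blast
  show ?thesis by (subst eq) (rule compact_Int_closed[OF compact_cube \<open>closed S\<close>])
qed

section \<open>Absolutely continuous curves\<close>

text \<open>The intervals may be indexed by any finite set; the pieces of a tagged division are indexed by
  themselves.\<close>

lemma abs_continuous_onD_finite:
  assumes "abs_continuous_on a b f" "0 < \<epsilon>"
  obtains \<delta> where "\<delta> > 0"
    "\<And>I (u::'i \<Rightarrow> real) v. \<lbrakk>finite I; \<And>i. i \<in> I \<Longrightarrow> a \<le> u i \<and> u i \<le> v i \<and> v i \<le> b;
        disjoint_family_on (\<lambda>i. {u i<..<v i}) I; (\<Sum>i\<in>I. v i - u i) < \<delta>\<rbrakk>
      \<Longrightarrow> (\<Sum>i\<in>I. norm (f (v i) - f (u i))) < \<epsilon>"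
proof -
  from assms(1)[unfolded abs_continuous_on_def, THEN spec, THEN mp, OF assms(2)]
  obtain \<delta> where \<delta>0: "\<delta> > 0 \<and> (\<forall>(k::nat) s t. (\<forall>i<k. a \<le> s i \<and> s i \<le> t i \<and> t i \<le> b) \<longrightarrow>
      disjoint_family_on (\<lambda>i. {s i<..<t i}) {..<k} \<longrightarrow> (\<Sum>i<k. t i - s i) < \<delta> \<longrightarrow>
      (\<Sum>i<k. norm (f (t i) - f (s i))) < \<epsilon>)"
    by (rule exE)
  note \<delta> = \<delta>0[THEN conjunct2, rule_format]
  have "\<delta> > 0" using \<delta>0 by simp
  show ?thesis
  proof
    show "\<delta> > 0" by fact
    fix I :: "'i set" and u v :: "'i \<Rightarrow> real"
    assume I: "finite I" "\<And>i. i \<in> I \<Longrightarrow> a \<le> u i \<and> u i \<le> v i \<and> v i \<le> b"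
      "disjoint_family_on (\<lambda>i. {u i<..<v i}) I" "(\<Sum>i\<in>I. v i - u i) < \<delta>"
    obtain h where h: "bij_betw h {..<card I} I"
      using ex_bij_betw_nat_finite[OF I(1)] by (auto simp: atLeast0LessThan)
    have hI: "h i \<in> I" if "i < card I" for i
      using h that by (auto simp: bij_betw_def)
    have re: "(\<Sum>i\<in>I. g i) = (\<Sum>i<card I. g (h i))" for g :: "'i \<Rightarrow> real"
      using sum.reindex_bij_betw[OF h, of g] by simp
    have "disjoint_family_on (\<lambda>i. {u (h i)<..<v (h i)}) {..<card I}"
      using I(3) h unfolding disjoint_family_on_def bij_betw_def inj_on_def
      by (metis lessThan_iff imageI)
    then show "(\<Sum>i\<in>I. norm (f (v i) - f (u i))) < \<epsilon>"
      unfolding re using I(2,4) hI by (intro \<delta>) (auto simp: re)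
  qed
qed

lemma abs_continuous_imp_continuous:
  assumes "abs_continuous_on a b f"
  shows "continuous_on {a..b} f"
proof (rule continuous_onI)
  fix t \<epsilon> :: real assume t: "t \<in> {a..b}" and "0 < \<epsilon>"
  obtain \<delta> where "\<delta> > 0" and \<delta>: "\<And>I (u::unit \<Rightarrow> real) v. \<lbrakk>finite I; \<And>i. i \<in> I \<Longrightarrow> a \<le> u i \<and> u i \<le> v i \<and> v i \<le> b;
        disjoint_family_on (\<lambda>i. {u i<..<v i}) I; (\<Sum>i\<in>I. v i - u i) < \<delta>\<rbrakk>
      \<Longrightarrow> (\<Sum>i\<in>I. norm (f (v i) - f (u i))) < \<epsilon>"
    using abs_continuous_onD_finite[OF assms \<open>0 < \<epsilon>\<close>] by blast
  have *: "norm (f y - f x) < \<epsilon>" if "x \<in> {a..b}" "y \<in> {a..b}" "x \<le> y" "y - x < \<delta>" for x y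
    using \<delta>[of "{()}" "\<lambda>_. x" "\<lambda>_. y"] that by (simp add: disjoint_family_on_def)
  have "dist (f s) (f t) \<le> \<epsilon>" if "s \<in> {a..b}" "dist s t < \<delta>" for s
  proof (cases "s \<le> t")
    case True
    then show ?thesis using *[of s t] that t by (auto simp: dist_norm norm_minus_commute)
  next
    case False
    then show ?thesis using *[of t s] that t by (auto simp: dist_norm)
  qed
  then show "\<exists>d>0. \<forall>x'\<in>{a..b}. dist x' t < d \<longrightarrow> dist (f x') (f t) \<le> \<epsilon>"
    using \<open>\<delta> > 0\<close> by blast
qed

text \<open>The total length of the intervals can be kept below \<open>\<delta>\<^sub>0\<close>, so a Lipschitz comparison between
  nearby parameters already transfers absolute continuity.  For the lift of an angle only such a
  local comparison is available.\<close>

lemma abs_continuous_on_compare: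
  assumes "abs_continuous_on a b f" and "0 < \<delta>\<^sub>0"
    and "\<And>s t. \<lbrakk>a \<le> s; s \<le> t; t \<le> b; t - s < \<delta>\<^sub>0\<rbrakk> \<Longrightarrow> norm (g t - g s) \<le> C * norm (f t - f s)"
  shows "abs_continuous_on a b g"
  unfolding abs_continuous_on_def
proof (intro allI impI)
  fix \<epsilon> :: real assume "\<epsilon> > 0"
  define C' where "C' = \<bar>C\<bar> + 1"
  have "C' > 0" by (simp add: C'_def)
  have "\<epsilon> / C' > 0" using \<open>\<epsilon> > 0\<close> \<open>C' > 0\<close> by simp
  from assms(1)[unfolded abs_continuous_on_def, THEN spec, THEN mp, OF this]
  obtain \<delta> where \<delta>0: "\<delta> > 0 \<and> (\<forall>(k::nat) s t. (\<forall>i<k. a \<le> s i \<and> s i \<le> t i \<and> t i \<le> b) \<longrightarrow>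
      disjoint_family_on (\<lambda>i. {s i<..<t i}) {..<k} \<longrightarrow> (\<Sum>i<k. t i - s i) < \<delta> \<longrightarrow>
      (\<Sum>i<k. norm (f (t i) - f (s i))) < \<epsilon> / C')"
    by (rule exE)
  note \<delta> = \<delta>0[THEN conjunct2, rule_format]
  have "\<delta> > 0" using \<delta>0 by simp
  show "\<exists>\<delta>>0. \<forall>(k::nat) s t. (\<forall>i<k. a \<le> s i \<and> s i \<le> t i \<and> t i \<le> b) \<longrightarrow>
          disjoint_family_on (\<lambda>i. {s i<..<t i}) {..<k} \<longrightarrow>
          (\<Sum>i<k. t i - s i) < \<delta> \<longrightarrow> (\<Sum>i<k. norm (g (t i) - g (s i))) < \<epsilon>"
  proof (intro exI[of _ "min \<delta> \<delta>\<^sub>0"] conjI allI impI)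
    show "0 < min \<delta> \<delta>\<^sub>0" using \<open>\<delta> > 0\<close> assms(2) by simp
    fix k :: nat and s t :: "nat \<Rightarrow> real"
    assume st: "\<forall>i<k. a \<le> s i \<and> s i \<le> t i \<and> t i \<le> b"
      and dj: "disjoint_family_on (\<lambda>i. {s i<..<t i}) {..<k}"
      and small: "(\<Sum>i<k. t i - s i) < min \<delta> \<delta>\<^sub>0"
    have le: "norm (g (t i) - g (s i)) \<le> C' * norm (f (t i) - f (s i))" if "i < k" for i
    proof -
      have "t i - s i \<le> (\<Sum>i<k. t i - s i)"
        using that st by (intro member_le_sum) auto
      then have "norm (g (t i) - g (s i)) \<le> C * norm (f (t i) - f (s i))"
        using that st small by (intro assms(3)) auto
      also have "\<dots> \<le> C' * norm (f (t i) - f (s i))"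
        by (intro mult_right_mono) (auto simp: C'_def)
      finally show ?thesis .
    qed
    have "(\<Sum>i<k. norm (g (t i) - g (s i))) \<le> (\<Sum>i<k. C' * norm (f (t i) - f (s i)))"
      using le by (intro sum_mono) auto
    also have "\<dots> = C' * (\<Sum>i<k. norm (f (t i) - f (s i)))"
      by (simp add: sum_distrib_left)
    also have "\<dots> < C' * (\<epsilon> / C')"
      using \<delta>[OF st[rule_format] dj] small \<open>C' > 0\<close> by (intro mult_strict_left_mono) auto
    finally show "(\<Sum>i<k. norm (g (t i) - g (s i))) < \<epsilon>"
      using \<open>C' > 0\<close> by simp
  qed
qed

lemma abs_continuous_on_id: "abs_continuous_on a b (\<lambda>t::real. t)"
  unfolding abs_continuous_on_def
proof (intro allI impI)
  fix \<epsilon> :: real assume "\<epsilon> > 0"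
  show "\<exists>\<delta>>0. \<forall>(k::nat) s t. (\<forall>i<k. a \<le> s i \<and> s i \<le> t i \<and> t i \<le> b) \<longrightarrow>
          disjoint_family_on (\<lambda>i. {s i<..<t i}) {..<k} \<longrightarrow>
          (\<Sum>i<k. t i - s i) < \<delta> \<longrightarrow> (\<Sum>i<k. norm (t i - s i)) < \<epsilon>"
  proof (intro exI[of _ \<epsilon>] conjI allI impI \<open>\<epsilon> > 0\<close>)
    fix k :: nat and s t :: "nat \<Rightarrow> real"
    assume "\<forall>i<k. a \<le> s i \<and> s i \<le> t i \<and> t i \<le> b" "(\<Sum>i<k. t i - s i) < \<epsilon>"
    then show "(\<Sum>i<k. norm (t i - s i)) < \<epsilon>"
      by (subst sum.cong[OF refl, of _ _ "\<lambda>i. t i - s i"]) auto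
  qed
qed

lemma lipschitz_imp_abs_continuous:
  assumes "\<And>s t. \<lbrakk>a \<le> s; s \<le> t; t \<le> b\<rbrakk> \<Longrightarrow> norm (g t - g s) \<le> C * (t - s)"
  shows "abs_continuous_on a b g"
  by (rule abs_continuous_on_compare[OF abs_continuous_on_id, of 1 _ _ _ C]) (use assms in auto)

text \<open>The fundamental theorem of calculus for absolutely continuous functions, in the gauge
  integral: off the exceptional null set the usual straddle estimate applies, and the intervals
  tagged in the null set lie in an open set of small measure, where absolute continuity makes the
  total increment small.\<close>

theorem abs_continuous_FTC:
  fixes f :: "real \<Rightarrow> 'a::real_normed_vector"
  assumes ac: "abs_continuous_on a b f" and "a \<le> b" and N: "negligible N"
    and der: "\<And>t. t \<in> {a..b} - N \<Longrightarrow> (f has_vector_derivative g t) (at t within {a..b})"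
  shows "(g has_integral f b - f a) {a..b}"
proof -
  define g' where "g' t = (if t \<in> N then 0 else g t)" for t
  have "(g' has_integral f b - f a) (cbox a b)"
    unfolding has_integral
  proof (intro allI impI)
    fix \<epsilon> :: real assume "\<epsilon> > 0"
    define \<eta> where "\<eta> = \<epsilon> / (2 * (b - a + 1))"
    have "\<eta> > 0" using \<open>\<epsilon> > 0\<close> \<open>a \<le> b\<close> by (simp add: \<eta>_def)
    have "\<exists>d>0. \<forall>y\<in>{a..b}. norm (y - t) < d \<longrightarrow> norm (f y - f t - (y - t) *\<^sub>R g t) \<le> \<eta> * norm (y - t)"
      if "t \<in> {a..b} - N" for t
      using der[OF that] \<open>\<eta> > 0\<close>
      unfolding has_vector_derivative_def has_derivative_within_alt by blast
    then obtain d where d: "\<And>t. t \<in> {a..b} - N \<Longrightarrow> 0 < d t"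
      "\<And>t y. \<lbrakk>t \<in> {a..b} - N; y \<in> {a..b}; norm (y - t) < d t\<rbrakk>
          \<Longrightarrow> norm (f y - f t - (y - t) *\<^sub>R g t) \<le> \<eta> * norm (y - t)"
      by metis
    have "\<epsilon> / 2 > 0" using \<open>\<epsilon> > 0\<close> by simp
    from abs_continuous_onD_finite[OF ac this, where ?'i = "real \<times> real set"]
    obtain \<delta> where "\<delta> > 0" and \<delta>: "\<And>I (u::real \<times> real set \<Rightarrow> real) v. \<lbrakk>finite I;
        \<And>i. i \<in> I \<Longrightarrow> a \<le> u i \<and> u i \<le> v i \<and> v i \<le> b;
        disjoint_family_on (\<lambda>i. {u i<..<v i}) I; (\<Sum>i\<in>I. v i - u i) < \<delta>\<rbrakk>
      \<Longrightarrow> (\<Sum>i\<in>I. norm (f (v i) - f (u i))) < \<epsilon> / 2"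
      by blast
    have "N \<in> sets lebesgue" using N by (simp add: negligible_imp_sets)
    then obtain U where U: "open U" "N \<subseteq> U" "U - N \<in> lmeasurable" "emeasure lebesgue (U - N) < ennreal \<delta>"
      using sets_lebesgue_outer_open[OF _ \<open>\<delta> > 0\<close>] by blast
    have nullN: "N \<in> null_sets lebesgue"
      using N negligible_iff_null_sets by blast
    have "emeasure lebesgue U = emeasure lebesgue (U - N)"
      using emeasure_Diff_null_set[OF nullN, of U] U(1) by (simp add: borel_open)
    then have emU: "emeasure lebesgue U < ennreal \<delta>" using U by simp
    define \<gamma> where "\<gamma> t = (if t \<in> N then U else if t \<in> {a..b} then ball t (d t) else UNIV)" for t
    have "gauge \<gamma>"
      using d(1) U by (auto simp: gauge_def \<gamma>_def)
    moreover have "norm ((\<Sum>(x, k)\<in>D. measure lborel k *\<^sub>R g' x) - (f b - f a)) < \<epsilon>"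
      if D: "D tagged_division_of cbox a b" and fine: "\<gamma> fine D" for D
    proof -
      note D' = tagged_division_ofD[OF D]
      define D1 where "D1 = {p \<in> D. fst p \<in> N}"
      have fin: "finite D" "finite D1" using D' by (auto simp: D1_def)
      have k: "\<exists>u v. k = {u..v} \<and> u \<le> v \<and> a \<le> u \<and> v \<le> b \<and> u \<le> x \<and> x \<le> v \<and>
                  Inf k = u \<and> Sup k = v \<and> measure lborel k = v - u \<and> interior k = {u<..<v}"
        if xk: "(x, k) \<in> D" for x k
      proof -
        obtain u v where "k = cbox u v" using D'(4)[OF xk] by blast
        moreover have "x \<in> k" "k \<subseteq> cbox a b" using D' xk by auto
        ultimately show ?thesis
          by (intro exI[of _ u] exI[of _ v]) auto
      qed
      have term1: "norm (measure lborel k *\<^sub>R g' x - (f (Sup k) - f (Inf k))) \<le> \<eta> * measure lborel k"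
        if xk: "(x, k) \<in> D" "x \<notin> N" for x k
      proof -
        obtain u v where uv: "k = {u..v}" "u \<le> v" "a \<le> u" "v \<le> b" "u \<le> x" "x \<le> v"
          "Inf k = u" "Sup k = v" "measure lborel k = v - u" using k[OF xk(1)] by blast
        then have xab: "x \<in> {a..b} - N" using xk by auto
        have "k \<subseteq> ball x (d x)" using fineD[OF fine xk(1)] xk xab by (simp add: \<gamma>_def)
        moreover have "u \<in> k" "v \<in> k" using uv by auto
        ultimately have near: "norm (u - x) < d x" "norm (v - x) < d x"
          by (auto simp: subset_eq dist_norm norm_minus_commute)
        have "norm (f u - f x - (u - x) *\<^sub>R g x) \<le> \<eta> * norm (u - x)"
          using uv near by (intro d(2)[OF xab]) auto
        moreover have "norm (f v - f x - (v - x) *\<^sub>R g x) \<le> \<eta> * norm (v - x)"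
          using uv near by (intro d(2)[OF xab]) auto
        moreover have "norm (u - x) = x - u" "norm (v - x) = v - x" using uv by auto
        ultimately have "norm ((f u - f x - (u - x) *\<^sub>R g x) - (f v - f x - (v - x) *\<^sub>R g x))
            \<le> \<eta> * (x - u) + \<eta> * (v - x)"
          using norm_triangle_ineq4[of "f u - f x - (u - x) *\<^sub>R g x" "f v - f x - (v - x) *\<^sub>R g x"]
          by simp
        also have "(f u - f x - (u - x) *\<^sub>R g x) - (f v - f x - (v - x) *\<^sub>R g x)
           = measure lborel k *\<^sub>R g' x - (f (Sup k) - f (Inf k))"
          using xk uv by (simp add: g'_def algebra_simps)
        also have "\<eta> * (x - u) + \<eta> * (v - x) = \<eta> * measure lborel k"
          using uv by (simp add: algebra_simps)
        finally show ?thesis .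
      qed
      have tele: "(\<Sum>(x, k)\<in>D. f (Sup k) - f (Inf k)) = f b - f a"
        using additive_tagged_division_1[OF \<open>a \<le> b\<close>, of D f] D by (simp add: box_real)
      have "(\<Sum>(x, k)\<in>D. measure lborel k *\<^sub>R g' x) - (f b - f a)
          = (\<Sum>(x, k)\<in>D. measure lborel k *\<^sub>R g' x - (f (Sup k) - f (Inf k)))"
        by (simp add: tele[symmetric] case_prod_unfold sum_subtractf)
      also have "\<dots> = (\<Sum>(x, k)\<in>D - D1. measure lborel k *\<^sub>R g' x - (f (Sup k) - f (Inf k)))
          + (\<Sum>(x, k)\<in>D1. measure lborel k *\<^sub>R g' x - (f (Sup k) - f (Inf k)))"
        using fin by (intro sum.subset_diff) (auto simp: D1_def)
      also have "norm \<dots> < \<epsilon> / 2 + \<epsilon> / 2"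
      proof (rule norm_add_less)
        show "norm (\<Sum>(x, k)\<in>D - D1. measure lborel k *\<^sub>R g' x - (f (Sup k) - f (Inf k))) < \<epsilon> / 2"
        proof -
          have "norm (\<Sum>(x, k)\<in>D - D1. measure lborel k *\<^sub>R g' x - (f (Sup k) - f (Inf k)))
            \<le> (\<Sum>(x, k)\<in>D - D1. \<eta> * measure lborel k)"
            by (rule sum_norm_le) (use term1 in \<open>auto simp: D1_def\<close>)
          also have "\<dots> \<le> (\<Sum>(x, k)\<in>D. \<eta> * measure lborel k)"
            using fin \<open>\<eta> > 0\<close> by (intro sum_mono2) (auto simp: D1_def)
          also have "\<dots> = \<eta> * (\<Sum>(x, k)\<in>D. measure lborel k)"
            by (simp add: sum_distrib_left case_prod_unfold)
          also have "\<dots> = \<eta> * (b - a)"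
            using additive_content_tagged_division[OF D] \<open>a \<le> b\<close> by simp
          also have "\<dots> < \<epsilon> / 2"
            using \<open>\<epsilon> > 0\<close> \<open>a \<le> b\<close> by (simp add: \<eta>_def field_simps)
          finally show ?thesis .
        qed
        have "norm (\<Sum>(x, k)\<in>D1. measure lborel k *\<^sub>R g' x - (f (Sup k) - f (Inf k)))
          \<le> (\<Sum>p\<in>D1. norm (f (Sup (snd p)) - f (Inf (snd p))))"
          by (rule sum_norm_le) (auto simp: D1_def g'_def norm_minus_commute)
        also have "\<dots> < \<epsilon> / 2"
        proof (rule \<delta>[OF fin(2)])
          show "a \<le> Inf (snd p) \<and> Inf (snd p) \<le> Sup (snd p) \<and> Sup (snd p) \<le> b" if "p \<in> D1" for p
            using that k[of "fst p" "snd p"] by (auto simp: D1_def)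
          have int: "interior (snd p) = {Inf (snd p)<..<Sup (snd p)}" if "p \<in> D1" for p
            using that k[of "fst p" "snd p"] by (auto simp: D1_def)
          have disj: "disjoint_family_on (\<lambda>p. interior (snd p)) D1"
          proof (unfold disjoint_family_on_def, intro ballI impI)
            fix p q assume "p \<in> D1" "q \<in> D1" "p \<noteq> q"
            then show "interior (snd p) \<inter> interior (snd q) = {}"
              using D'(5)[of "fst p" "snd p" "fst q" "snd q"] by (auto simp: D1_def prod_eq_iff)
          qed
          then show "disjoint_family_on (\<lambda>p. {Inf (snd p)<..<Sup (snd p)}) D1"
            unfolding disjoint_family_on_def using int by simp
          have "ennreal (\<Sum>p\<in>D1. Sup (snd p) - Inf (snd p)) = (\<Sum>p\<in>D1. emeasure lebesgue (interior (snd p)))"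
          proof (subst sum_ennreal[symmetric])
            fix p assume p: "p \<in> D1"
            then show "0 \<le> Sup (snd p) - Inf (snd p)"
              using k[of "fst p" "snd p"] by (auto simp: D1_def)
          next
            show "(\<Sum>p\<in>D1. ennreal (Sup (snd p) - Inf (snd p))) = (\<Sum>p\<in>D1. emeasure lebesgue (interior (snd p)))"
            proof (rule sum.cong[OF refl])
              fix p assume p: "p \<in> D1"
              show "ennreal (Sup (snd p) - Inf (snd p)) = emeasure lebesgue (interior (snd p))"
                using k[of "fst p" "snd p"] p int[OF p] by (auto simp: D1_def)
            qed
          qed
          also have "\<dots> = emeasure lebesgue (\<Union>p\<in>D1. interior (snd p))"
            using disj fin by (intro sum_emeasure) auto
          also have "\<dots> \<le> emeasure lebesgue U"
          proof (rule emeasure_mono)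
            show "(\<Union>p\<in>D1. interior (snd p)) \<subseteq> U"
            proof (intro UN_least)
              fix p assume p: "p \<in> D1"
              then have "snd p \<subseteq> \<gamma> (fst p)" using fineD[OF fine, of "fst p" "snd p"] by (auto simp: D1_def)
              then show "interior (snd p) \<subseteq> U"
                using p interior_subset[of "snd p"] by (auto simp: D1_def \<gamma>_def)
            qed
          qed (use U in auto)
          finally have "ennreal (\<Sum>p\<in>D1. Sup (snd p) - Inf (snd p)) < ennreal \<delta>"
            using emU by simp
          then show "(\<Sum>p\<in>D1. Sup (snd p) - Inf (snd p)) < \<delta>"
            by (metis ennreal_leI leI leD)
        qed
        finally show "norm (\<Sum>(x, k)\<in>D1. measure lborel k *\<^sub>R g' x - (f (Sup k) - f (Inf k))) < \<epsilon> / 2" .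
      qed
      finally show ?thesis by simp
    qed
    ultimately show "\<exists>\<gamma>. gauge \<gamma> \<and> (\<forall>D. D tagged_division_of cbox a b \<and> \<gamma> fine D \<longrightarrow>
        norm ((\<Sum>(x, k)\<in>D. measure lborel k *\<^sub>R g' x) - (f b - f a)) < \<epsilon>)"
      by (intro exI[of _ \<gamma>]) simp
  qed
  then have "(g has_integral f b - f a) (cbox a b)"
    by (rule has_integral_spike[OF N, rotated]) (auto simp: g'_def)
  then show ?thesis by simp
qed

lemma abs_continuous_subinterval:
  "abs_continuous_on a b f \<Longrightarrow> a \<le> c \<Longrightarrow> d \<le> b \<Longrightarrow> abs_continuous_on c d f"
  unfolding abs_continuous_on_def by (meson order.trans)

lemma abs_continuous_constant:
  fixes f :: "real \<Rightarrow> 'a::real_normed_vector"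
  assumes ac: "abs_continuous_on a b f" and N: "negligible N"
    and der: "\<And>t. t \<in> {a..b} - N \<Longrightarrow> (f has_vector_derivative 0) (at t within {a..b})"
    and t: "t \<in> {a..b}"
  shows "f t = f a"
proof -
  have "((\<lambda>_. 0) has_integral f t - f a) {a..t}"
  proof (rule abs_continuous_FTC[OF abs_continuous_subinterval[OF ac] _ N])
    show "(f has_vector_derivative 0) (at s within {a..t})" if "s \<in> {a..t} - N" for s
      using der[of s] that t by (auto intro: has_vector_derivative_within_subset)
  qed (use t in auto)
  then show ?thesis
    using has_integral_unique[OF _ has_integral_0] by fastforce
qed

lemma abs_continuous_mono:
  fixes f :: "real \<Rightarrow> real"
  assumes ac: "abs_continuous_on a b f" and N: "negligible N"
    and der: "\<And>t. t \<in> {a..b} - N \<Longrightarrow> (f has_vector_derivative g t) (at t within {a..b})"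
    and pos: "\<And>t. t \<in> {a..b} - N \<Longrightarrow> 0 \<le> g t"
    and st: "a \<le> s" "s \<le> t" "t \<le> b"
  shows "f s \<le> f t"
proof -
  have "((\<lambda>x. if x \<in> N then 0 else g x) has_integral f t - f s) {s..t}"
  proof (rule abs_continuous_FTC[OF abs_continuous_subinterval[OF ac] _ N])
    show "(f has_vector_derivative (if x \<in> N then 0 else g x)) (at x within {s..t})"
      if "x \<in> {s..t} - N" for x
      using der[of x] that st by (auto intro: has_vector_derivative_within_subset)
  qed (use st in auto)
  then have "0 \<le> f t - f s"
    by (rule has_integral_nonneg) (use pos st in auto)
  then show ?thesis by simp
qed

section \<open>Differential calculus on \<open>\<real>\<^sup>d\<close>\<close>

abbreviation partial :: "nat \<Rightarrow> (rseq \<Rightarrow> rseq) \<Rightarrow> rseq \<Rightarrow> rseq"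
  where "partial i f x \<equiv> dir_deriv f x (unit_vec i)"

definition differential :: "nat \<Rightarrow> (rseq \<Rightarrow> rseq) \<Rightarrow> rseq \<Rightarrow> rseq \<Rightarrow> rseq"
  where "differential d f x v = (\<Sum>i<d. coord v i *\<^sub>R partial i f x)"

lemma Ck_continuous: "Ck d k f \<Longrightarrow> continuous_on (Rn d) f"
  by (cases k) auto

lemma Ck_partial: "Ck d (Suc k) f \<Longrightarrow> i < d \<Longrightarrow> Ck d k (partial i f)"
  by auto

lemma Ck_mono: "Ck d k f \<Longrightarrow> l \<le> k \<Longrightarrow> Ck d l f"
proof (induction k arbitrary: f l)
  case (Suc k)
  then show ?case by (cases l) auto
qed simp

lemma differential_diff: "differential d f x (u - v) = differential d f x u - differential d f x v"
  and differential_scale: "differential d f x (c *\<^sub>R u) = c *\<^sub>R differential d f x u"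
  and differential_0 [simp]: "differential d f x 0 = 0"
  by (simp_all add: differential_def algebra_simps sum.distrib sum_subtractf scaleR_sum_right sum_negf)

lemma bounded_linear_differential: "bounded_linear (differential d f x)"
  unfolding differential_def
  by (intro bounded_linear_sum bounded_linear_compose[OF bounded_linear_scaleR_left] bounded_linear_coord)

lemma differential_unit_vec: "i < d \<Longrightarrow> differential d f x (unit_vec i) = partial i f x"
  by (simp add: differential_def if_distrib[of "\<lambda>c. c *\<^sub>R _"] cong: if_cong)

lemma partial_has_vector_derivative:
  assumes "Ck d (Suc k) f" "i < d" "y \<in> Rn d"
  shows "((\<lambda>t. f (y + t *\<^sub>R unit_vec i)) has_vector_derivative partial i f (y + t *\<^sub>R unit_vec i)) (at t)"
proof -
  let ?z = "y + t *\<^sub>R unit_vec i"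
  have "?z \<in> Rn d" using assms by auto
  then have "(\<lambda>s. f (?z + s *\<^sub>R unit_vec i)) differentiable at 0"
    using assms by auto
  then have "((\<lambda>s. f (?z + s *\<^sub>R unit_vec i)) has_vector_derivative partial i f ?z) (at 0)"
    by (simp add: vector_derivative_works dir_deriv_def)
  then have "(((\<lambda>s. f (?z + s *\<^sub>R unit_vec i)) \<circ> (\<lambda>s. s - t)) has_vector_derivative 1 *\<^sub>R partial i f ?z) (at t)"
    by (intro vector_diff_chain_at) (auto intro!: derivative_eq_intros simp: has_vector_derivative_def)
  then show ?thesis by (simp add: o_def algebra_simps)
qed

text \<open>Moving from \<open>x\<close> to \<open>x + v\<close> one coordinate at a time, the oscillation of the partial
  derivatives controls the error of the linear approximation.  The bound is explicit so that it
  also yields uniform approximation on compact sets.\<close>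

lemma linear_approximation_bound:
  assumes f: "Ck d (Suc k) f" and x: "x \<in> Rn d" and v: "v \<in> Rn d"
    and osc: "\<And>i y. \<lbrakk>i < d; y \<in> Rn d; norm (y - x) \<le> norm v\<rbrakk> \<Longrightarrow> norm (partial i f y - partial i f x) \<le> \<epsilon>"
  shows "norm (f (x + v) - f x - differential d f x v) \<le> \<epsilon> * norm v"
proof -
  define w where "w k = (\<Sum>i<k. coord v i *\<^sub>R unit_vec i)" for k
  have w_Suc: "w (Suc k) = w k + coord v k *\<^sub>R unit_vec k" for k by (simp add: w_def)
  have wRn: "w k \<in> Rn d" if "k \<le> d" for k
    using that unfolding w_def by (intro Rn_sum Rn_scaleR Rn_unit_vec) auto
  have wd: "w d = v" using Rn_expansion[OF v] by (simp add: w_def)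
  have norm_w: "norm (w k + t *\<^sub>R unit_vec k) \<le> norm v" if "k < d" "\<bar>t\<bar> \<le> \<bar>coord v k\<bar>" for k t
  proof -
    have "norm (w k + t *\<^sub>R unit_vec k) = (\<Sum>i<d. \<bar>coord (w k + t *\<^sub>R unit_vec k) i\<bar>)"
      using that wRn by (intro norm_eq_sum_coord) auto
    also have "\<dots> \<le> (\<Sum>i<d. \<bar>coord v i\<bar>)"
    proof (rule sum_mono)
      fix i assume "i \<in> {..<d}"
      have "coord (w k) i = (\<Sum>j<k. if i = j then coord v j else 0)"
        unfolding w_def by (simp add: if_distrib cong: if_cong)
      then have "coord (w k) i = (if i < k then coord v i else 0)"
        by simp
      then show "\<bar>coord (w k + t *\<^sub>R unit_vec k) i\<bar> \<le> \<bar>coord v i\<bar>"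
        using that by auto
    qed
    also have "\<dots> = norm v" using norm_eq_sum_coord[OF v] by simp
    finally show ?thesis .
  qed
  have step: "norm (f (x + w (Suc k)) - f (x + w k) - coord v k *\<^sub>R partial k f x) \<le> \<epsilon> * \<bar>coord v k\<bar>"
    if "k < d" for k
  proof -
    let ?c = "coord v k"
    let ?S = "{t. \<bar>t\<bar> \<le> \<bar>?c\<bar>}"
    let ?g = "\<lambda>t. f (x + w k + t *\<^sub>R unit_vec k) - t *\<^sub>R partial k f x"
    have S: "?S = {-\<bar>?c\<bar>..\<bar>?c\<bar>}" by auto
    have "norm (?g ?c - ?g 0) \<le> \<epsilon> * norm (?c - 0)"
    proof (rule differentiable_bound[of ?S])
      show "convex ?S" unfolding S by simp
      fix t assume t: "t \<in> ?S"
      have "x + w k \<in> Rn d" using x wRn that by auto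
      from partial_has_vector_derivative[OF f that this, of t]
      have "(?g has_vector_derivative partial k f (x + w k + t *\<^sub>R unit_vec k) - partial k f x) (at t)"
        by (auto intro!: derivative_eq_intros)
      then show "(?g has_derivative (\<lambda>s. s *\<^sub>R (partial k f (x + w k + t *\<^sub>R unit_vec k) - partial k f x))) (at t within ?S)"
        unfolding has_vector_derivative_def by (rule has_derivative_at_withinI)
      have "norm (partial k f (x + w k + t *\<^sub>R unit_vec k) - partial k f x) \<le> \<epsilon>"
        using that t x wRn norm_w[OF that, of t] by (intro osc) (auto simp: algebra_simps)
      then show "onorm (\<lambda>s. s *\<^sub>R (partial k f (x + w k + t *\<^sub>R unit_vec k) - partial k f x)) \<le> \<epsilon>"
        by (intro onorm_le) (simp add: mult.commute[of \<epsilon>] mult_left_mono)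
    qed auto
    then show ?thesis by (simp add: w_Suc add.assoc algebra_simps)
  qed
  have "f (x + v) - f x - differential d f x v
      = (\<Sum>k<d. f (x + w (Suc k)) - f (x + w k) - coord v k *\<^sub>R partial k f x)"
    using sum_lessThan_telescope[of "\<lambda>k. f (x + w k)" d]
    by (simp add: sum_subtractf differential_def wd) (simp add: w_def)
  also have "norm \<dots> \<le> (\<Sum>k<d. \<epsilon> * \<bar>coord v k\<bar>)"
    using step by (intro sum_norm_le) auto
  also have "\<dots> = \<epsilon> * norm v"
    by (simp add: norm_eq_sum_coord[OF v] sum_distrib_left)
  finally show ?thesis .
qed

lemma Ck_has_derivative:
  assumes f: "Ck d (Suc k) f" and x: "x \<in> Rn d"
  shows "(f has_derivative differential d f x) (at x within Rn d)"
  unfolding has_derivative_within_alt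
proof (intro conjI allI impI bounded_linear_differential)
  fix \<epsilon> :: real assume "0 < \<epsilon>"
  have "\<forall>\<^sub>F y in at x within Rn d. \<forall>i\<in>{..<d}. dist (partial i f y) (partial i f x) < \<epsilon>"
  proof (rule eventually_ball_finite)
    show "\<forall>i\<in>{..<d}. \<forall>\<^sub>F y in at x within Rn d. dist (partial i f y) (partial i f x) < \<epsilon>"
    proof
      fix i assume "i \<in> {..<d}"
      then have "continuous_on (Rn d) (partial i f)"
        using Ck_partial[OF f, of i] Ck_continuous by auto
      then show "\<forall>\<^sub>F y in at x within Rn d. dist (partial i f y) (partial i f x) < \<epsilon>"
        using x \<open>0 < \<epsilon>\<close> unfolding continuous_on_def by (auto dest!: bspec tendstoD)
    qed
  qed simp
  then obtain \<delta> where "\<delta> > 0" and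
    \<delta>: "\<And>y i. \<lbrakk>y \<in> Rn d; y \<noteq> x; dist y x < \<delta>; i < d\<rbrakk> \<Longrightarrow> dist (partial i f y) (partial i f x) < \<epsilon>"
    unfolding eventually_at by auto
  have osc: "norm (partial i f y - partial i f x) \<le> \<epsilon>" if "y \<in> Rn d" "norm (y - x) < \<delta>" "i < d" for y i
    using \<delta>[of y i] that \<open>0 < \<epsilon>\<close> by (cases "y = x") (auto simp: dist_norm intro: less_imp_le)
  have "norm (f y - f x - differential d f x (y - x)) \<le> \<epsilon> * norm (y - x)"
    if "y \<in> Rn d" "norm (y - x) < \<delta>" for y
    using linear_approximation_bound[OF f x, of "y - x" \<epsilon>] osc that x by auto
  then show "\<exists>\<delta>>0. \<forall>y\<in>Rn d. norm (y - x) < \<delta> \<longrightarrow>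
      norm (f y - f x - differential d f x (y - x)) \<le> \<epsilon> * norm (y - x)"
    using \<open>\<delta> > 0\<close> by blast
qed

lemma Ck_chain_curve:
  assumes f: "Ck d (Suc k) f" and c: "(c has_vector_derivative c') (at t within S)"
    and S: "\<And>s. s \<in> S \<Longrightarrow> c s \<in> Rn d" and t: "c t \<in> Rn d"
  shows "((\<lambda>s. f (c s)) has_vector_derivative differential d f (c t) c') (at t within S)"
proof -
  have "(f has_derivative differential d f (c t)) (at (c t) within c ` S)"
    using S by (intro has_derivative_subset[OF Ck_has_derivative[OF f t]]) auto
  then show ?thesis
    using vector_derivative_diff_chain_within[OF c] by (simp add: o_def)
qed

lemma dir_deriv_eq_differential:
  assumes f: "Ck d (Suc k) f" and x: "x \<in> Rn d" and v: "v \<in> Rn d"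
  shows "dir_deriv f x v = differential d f x v"
proof -
  have "((\<lambda>t. f (x + t *\<^sub>R v)) has_vector_derivative differential d f (x + 0 *\<^sub>R v) v) (at 0)"
    by (rule Ck_chain_curve[OF f]) (use x v in \<open>auto intro!: derivative_eq_intros simp: has_vector_derivative_def\<close>)
  then show ?thesis by (simp add: dir_deriv_def vector_derivative_at)
qed

lemma continuous_on_differential:
  assumes f: "Ck d (Suc k) f" and g: "continuous_on S g" "\<And>s. s \<in> S \<Longrightarrow> g s \<in> Rn d"
    and v: "continuous_on S v"
  shows "continuous_on S (\<lambda>s. differential d f (g s) (v s))"
  unfolding differential_def
proof (intro continuous_on_sum continuous_on_scaleR coord_continuous v)
  fix i assume "i \<in> {..<d}"
  then have "continuous_on (Rn d) (partial i f)"
    using Ck_continuous[OF Ck_partial[OF f, of i]] by simp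
  then show "continuous_on S (\<lambda>s. partial i f (g s))"
    by (rule continuous_on_compose2[OF _ g(1)]) (use g(2) in auto)
qed

lemma continuous_on_Ck:
  assumes f: "Ck d k f" and g: "continuous_on S g" "\<And>s. s \<in> S \<Longrightarrow> g s \<in> Rn d"
  shows "continuous_on S (\<lambda>s. f (g s))"
  by (rule continuous_on_compose2[OF Ck_continuous[OF f] g(1)]) (use g(2) in auto)

text \<open>Both iterated derivatives have the same integral over every segment in direction \<open>j\<close>:
  differentiate under the integral sign in the formula for \<open>f\<close> as the integral of its
  \<open>j\<close>-th partial derivative.\<close>

lemma mixed_partials_commute:
  assumes f: "Ck d (Suc (Suc k)) f" and x: "x \<in> Rn d" and ij: "i < d" "j < d"
  shows "partial i (partial j f) x = partial j (partial i f) x"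
proof (rule poly_mapping_eqI)
  fix l
  have fi: "Ck d (Suc k) (partial i f)" and fj: "Ck d (Suc k) (partial j f)"
    using Ck_partial[OF f] ij by auto
  define p where "p s t = x + s *\<^sub>R unit_vec i + t *\<^sub>R unit_vec j" for s t
  have pRn [simp]: "p s t \<in> Rn d" for s t using x ij by (auto simp: p_def)
  have p_cont: "continuous_on S (\<lambda>z. p (u z) (v z))" if "continuous_on S u" "continuous_on S v"
    for S :: "'z::topological_space set" and u v unfolding p_def by (intro continuous_intros that)
  have dt: "((\<lambda>t. coord (g (p s t)) l) has_vector_derivative coord (partial j g (p s t)) l) (at t within T)"
    if "Ck d (Suc k') g" for g k' s t T
    using coord_has_vector_derivative[OF partial_has_vector_derivative[OF that ij(2), of "x + s *\<^sub>R unit_vec i" t]] x ij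
    by (auto simp: p_def intro: has_vector_derivative_at_within)
  have ds: "((\<lambda>s. coord (g (p s t)) l) has_vector_derivative coord (partial i g (p s t)) l) (at s within T)"
    if "Ck d (Suc k') g" for g k' s t T
    using coord_has_vector_derivative[OF partial_has_vector_derivative[OF that ij(1), of "x + t *\<^sub>R unit_vec j" s]] x ij
    by (auto simp: p_def add_ac intro: has_vector_derivative_at_within)
  let ?A = "\<lambda>t. coord (partial i (partial j f) (p 0 t)) l"
  let ?B = "\<lambda>t. coord (partial j (partial i f) (p 0 t)) l"
  have contA: "continuous_on S ?A" and contB: "continuous_on S ?B" for S
    by (intro coord_continuous continuous_on_Ck[OF Ck_partial[OF fj ij(1)]]
        continuous_on_Ck[OF Ck_partial[OF fi ij(2)]] p_cont continuous_intros; simp)+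
  have eq: "integral {0..\<tau>} ?A = integral {0..\<tau>} ?B" if "0 \<le> \<tau>" for \<tau>
  proof -
    have int: "integral {0..\<tau>} (\<lambda>t. coord (partial j f (p s t)) l) = coord (f (p s \<tau>)) l - coord (f (p s 0)) l" for s
      by (intro integral_unique fundamental_theorem_of_calculus that dt[OF f])
    have 1: "((\<lambda>s. integral (cbox 0 \<tau>) (\<lambda>t. coord (partial j f (p s t)) l)) has_vector_derivative integral (cbox 0 \<tau>) ?A) (at 0)"
    proof (rule leibniz_rule_vector_derivative[where U = "UNIV :: real set"])
      show "((\<lambda>s. coord (partial j f (p s t)) l) has_vector_derivative coord (partial i (partial j f) (p s t)) l) (at s)" for s t
        by (rule ds[OF fj])
      show "(\<lambda>t. coord (partial j f (p s t)) l) integrable_on cbox 0 \<tau>" for s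
        by (intro integrable_continuous continuous_intros continuous_on_Ck[OF fj] p_cont) auto
      show "continuous_on (UNIV \<times> cbox 0 \<tau>) (\<lambda>(s, t). coord (partial i (partial j f) (p s t)) l)"
        unfolding case_prod_unfold
        by (intro continuous_intros continuous_on_Ck[OF Ck_partial[OF fj ij(1)]] p_cont) auto
    qed auto
    have 2: "((\<lambda>s. integral (cbox 0 \<tau>) (\<lambda>t. coord (partial j f (p s t)) l)) has_vector_derivative
        coord (partial i f (p 0 \<tau>)) l - coord (partial i f (p 0 0)) l) (at 0)"
      using int by (simp add: has_vector_derivative_diff[OF ds[OF f] ds[OF f]])
    have "integral {0..\<tau>} ?B = coord (partial i f (p 0 \<tau>)) l - coord (partial i f (p 0 0)) l"
      by (intro integral_unique fundamental_theorem_of_calculus that dt[OF fi])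
    then show ?thesis
      using vector_derivative_unique_at[OF 1 2] by simp
  qed
  have dA: "((\<lambda>\<tau>. integral {0..\<tau>} ?A) has_vector_derivative ?A 0) (at 0 within {0..1})"
    by (rule integral_has_vector_derivative[OF contA]) simp
  have dB: "((\<lambda>\<tau>. integral {0..\<tau>} ?B) has_vector_derivative ?B 0) (at 0 within {0..1})"
    by (rule integral_has_vector_derivative[OF contB]) simp
  have "((\<lambda>\<tau>. integral {0..\<tau>} ?A) has_vector_derivative ?B 0) (at 0 within {0..1})"
    by (rule has_vector_derivative_transform[OF _ _ dB]) (auto intro: eq)
  then have "?A 0 = ?B 0"
    by (intro vector_derivative_unique_within[OF _ dA]) (auto simp: trivial_limit_within islimpt_Icc)
  then show "coord (partial i (partial j f) x) l = coord (partial j (partial i f) x) l"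
    by (simp add: p_def)
qed

lemma differential_Rn:
  assumes f: "Ck d (Suc k) f" and x: "x \<in> Rn d" and maps: "\<And>y. y \<in> Rn d \<Longrightarrow> f y \<in> Rn e"
  shows "differential d f x v \<in> Rn e"
proof -
  have "partial i f x \<in> Rn e" if "i < d" for i
    unfolding Rn_def
  proof (intro CollectI allI impI)
    fix l assume "e \<le> l"
    have "((\<lambda>t. coord (f (x + t *\<^sub>R unit_vec i)) l) has_vector_derivative
        coord (partial i f (x + 0 *\<^sub>R unit_vec i)) l) (at 0)"
      by (intro coord_has_vector_derivative partial_has_vector_derivative[OF f that x])
    moreover have "coord (f (x + t *\<^sub>R unit_vec i)) l = 0" for t
      using maps[of "x + t *\<^sub>R unit_vec i"] x that \<open>e \<le> l\<close> by (auto intro: coord_eq_0_Rn)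
    ultimately have "((\<lambda>t::real. 0::real) has_vector_derivative coord (partial i f x) l) (at 0)"
      by simp
    then show "coord (partial i f x) l = 0"
      using vector_derivative_unique_at[OF _ has_vector_derivative_const] by blast
  qed
  then show ?thesis unfolding differential_def by (intro Rn_sum Rn_scaleR) auto
qed

lemma differential_bound_on_compact:
  assumes f: "Ck d (Suc k) f" and K: "compact K" "K \<subseteq> Rn d"
  obtains C where "C > 0" "\<And>x v. x \<in> K \<Longrightarrow> norm (differential d f x v) \<le> C * norm v"
proof -
  have "\<exists>M. \<forall>x\<in>K. norm (partial i f x) \<le> M" if "i < d" for i
  proof -
    have "continuous_on K (partial i f)"
      using Ck_continuous[OF Ck_partial[OF f that]] K(2) continuous_on_subset by blast
    then have "bounded (partial i f ` K)"
      using K(1) compact_continuous_image compact_imp_bounded by blast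
    then show ?thesis by (auto simp: bounded_iff)
  qed
  then obtain M where M: "\<And>i x. i < d \<Longrightarrow> x \<in> K \<Longrightarrow> norm (partial i f x) \<le> M i" by metis
  define C where "C = (\<Sum>i<d. \<bar>M i\<bar>) + 1"
  show ?thesis
  proof (rule that[of C])
    show "C > 0" by (simp add: C_def add_nonneg_pos sum_nonneg)
    fix x v assume x: "x \<in> K"
    have "norm (differential d f x v) \<le> (\<Sum>i<d. \<bar>M i\<bar> * norm v)"
      unfolding differential_def
    proof (rule sum_norm_le)
      fix i assume "i \<in> {..<d}"
      then have "\<bar>coord v i\<bar> * norm (partial i f x) \<le> norm v * \<bar>M i\<bar>"
        using M[of i x] x abs_coord_le_norm[of v i] by (intro mult_mono) auto
      then show "norm (coord v i *\<^sub>R partial i f x) \<le> \<bar>M i\<bar> * norm v"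
        by (simp add: mult.commute)
    qed
    also have "\<dots> = (\<Sum>i<d. \<bar>M i\<bar>) * norm v" by (simp add: sum_distrib_right)
    also have "\<dots> \<le> C * norm v" by (intro mult_right_mono) (auto simp: C_def)
    finally show "norm (differential d f x v) \<le> C * norm v" .
  qed
qed

lemma Ck_lipschitz_on_compact:
  assumes f: "Ck d (Suc k) f" and K: "compact K" "convex K" "K \<subseteq> Rn d"
  obtains C where "C > 0" "\<And>x y. x \<in> K \<Longrightarrow> y \<in> K \<Longrightarrow> norm (f x - f y) \<le> C * norm (x - y)"
proof -
  obtain C where C: "C > 0" "\<And>x v. x \<in> K \<Longrightarrow> norm (differential d f x v) \<le> C * norm v"
    using differential_bound_on_compact[OF f K(1,3)] by blast
  have "norm (f x - f y) \<le> C * norm (x - y)" if "x \<in> K" "y \<in> K" for x y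
    using K that
  proof (intro differentiable_bound[of K f "\<lambda>x. differential d f x"])
    fix z assume z: "z \<in> K"
    show "(f has_derivative differential d f z) (at z within K)"
      using Ck_has_derivative[OF f, of z] z K(3) has_derivative_subset by blast
    show "onorm (differential d f z) \<le> C" using C(1) by (intro onorm_bound C(2)[OF z]) auto
  qed auto
  then show ?thesis using that C(1) by blast
qed

section \<open>Hopf circles and the action of their images\<close>

text \<open>The orbit of \<open>w\<close> under the unit complex numbers.\<close>

definition circle :: "nat \<Rightarrow> rseq \<Rightarrow> real \<Rightarrow> rseq"
  where "circle N w s = cos s *\<^sub>R w + sin s *\<^sub>R J_std N w"

lemma circle_Rn [simp, intro]: "w \<in> Rn (2*N) \<Longrightarrow> circle N w s \<in> Rn (2*N)"
  by (auto simp: circle_def)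

lemma circle_0 [simp]: "circle N w 0 = w"
  by (simp add: circle_def)

lemma J_circle: "w \<in> Rn (2*N) \<Longrightarrow> J_std N (circle N w s) = cos s *\<^sub>R J_std N w - sin s *\<^sub>R w"
  by (simp add: circle_def J_add J_scale J_J)

lemma circle_has_vector_derivative:
  assumes "w \<in> Rn (2*N)"
  shows "(circle N w has_vector_derivative J_std N (circle N w s)) (at s within S)"
  unfolding J_circle[OF assms] unfolding circle_def[abs_def]
  by (auto intro!: derivative_eq_intros simp: has_real_derivative_iff_has_vector_derivative)

lemma continuous_on_circle: "continuous_on S (\<lambda>z. circle N w (f z))"
  "continuous_on S (\<lambda>z. J_std N (circle N w (f z)))"
  if "w \<in> Rn (2*N)" "continuous_on S f" for f :: "'z::t2_space \<Rightarrow> real"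
  unfolding J_circle[OF that(1)] unfolding circle_def
  by (intro continuous_intros that)+

lemma circle_norm: "w \<in> Rn (2*N) \<Longrightarrow> eucl_inner (2*N) (circle N w s) (circle N w s) = eucl_inner (2*N) w w"
proof -
  have "cos s * cos s + sin s * sin s = 1"
    using sin_cos_squared_add2[of s] by (simp add: power2_eq_square)
  then have "cos s * (cos s * c) + sin s * (sin s * c) = c" for c
    by (metis distrib_right mult.assoc mult_1)
  then show ?thesis
    unfolding circle_def eucl_inner_bilinear eucl_inner_J eucl_inner_J_self by simp
qed

lemma circle_periodic: "circle N w (s + 2 * pi * of_int k) = circle N w s"
  using sin.plus_of_int[of s k] cos.plus_of_int[of s k]
  by (simp add: circle_def mult_ac)

lemma bilinear_omega: "bounded_bilinear (omega N)"
proof -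
  have 1: "bounded_bilinear (\<lambda>x y. coord x i * coord y j)" for i j
    using bounded_bilinear.comp[OF bounded_bilinear_mult bounded_linear_coord bounded_linear_coord]
    by simp
  show ?thesis
  proof
    show "\<exists>K. \<forall>x y. norm (omega N x y) \<le> norm x * norm y * K"
    proof (intro exI allI)
      fix x y
      have "norm (omega N x y) \<le> (\<Sum>i<N. 2 * (norm x * norm y))"
        unfolding omega_def
      proof (rule sum_norm_le)
        fix i
        have b: "\<bar>coord x k * coord y l\<bar> \<le> norm x * norm y" for k l
          unfolding abs_mult by (intro mult_mono abs_coord_le_norm) auto
        show "norm (coord x (2 * i) * coord y (2 * i + 1) - coord x (2 * i + 1) * coord y (2 * i)) \<le> 2 * (norm x * norm y)"
          using b[of "2*i" "2*i+1"] b[of "2*i+1" "2*i"] by auto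
      qed
      then show "norm (omega N x y) \<le> norm x * norm y * (2 * real N)"
        by (simp add: algebra_simps)
    qed
  qed (simp_all add: omega_bilinear)
qed

lemmas omega_has_vector_derivative = bounded_bilinear.has_vector_derivative[OF bilinear_omega]

text \<open>The area of the image of a Hopf circle: as the radius \<open>\<rho>\<close> grows, the action integral grows
  at the rate \<open>\<rho> |w|\<^sup>2\<close> per unit angle, because up to a derivative in the angular variable the
  derivative of the integrand is the symplectic area form of the image of the disc, and \<open>\<phi>\<close>
  preserves that form.\<close>

lemma action_circle_image:
  assumes \<phi>: "Ck (2*N) 2 \<phi>"
    and symp: "\<And>x u v. \<lbrakk>x \<in> Rn (2*N); u \<in> Rn (2*N); v \<in> Rn (2*N)\<rbrakk> \<Longrightarrow>
      omega N (differential (2*N) \<phi> x u) (differential (2*N) \<phi> x v) = omega N u v"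
    and a: "a \<in> Rn (2*N)" and w: "w \<in> Rn (2*N)" and \<beta>: "\<beta> = \<alpha> + 2 * pi * of_int k" "\<alpha> \<le> \<beta>"
  shows "integral {\<alpha>..\<beta>} (\<lambda>s. omega N (\<phi> (a + circle N w s))
            (differential (2*N) \<phi> (a + circle N w s) (J_std N (circle N w s))) / 2)
      = eucl_inner (2*N) w w * (\<beta> - \<alpha>) / 2"
proof -
  let ?d = "2 * N"
  let ?e = "circle N w" and ?Je = "\<lambda>s. J_std N (circle N w s)"
  let ?D = "differential ?d \<phi>"
  have \<phi>1: "Ck ?d (Suc (Suc 0)) \<phi>" using \<phi> by (simp only: numeral_2_eq_2)
  have \<phi>1': "Ck ?d (Suc 0) \<phi>" by (rule Ck_mono[OF \<phi>1]) simp
  have P1: "Ck ?d (Suc 0) (partial i \<phi>)" if "i < ?d" for i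
    by (rule Ck_partial[OF \<phi>1 that])
  define E where "E \<rho> s = a + \<rho> *\<^sub>R ?e s" for \<rho> s
  have E [simp]: "E \<rho> s \<in> Rn ?d" for \<rho> s using a w by (auto simp: E_def)
  have e [simp]: "?e s \<in> Rn ?d" for s using w by auto
  have E\<rho>: "((\<lambda>\<rho>. E \<rho> s) has_vector_derivative ?e s) (at \<rho> within S)" for \<rho> s S
    unfolding E_def by (auto intro!: derivative_eq_intros)
  have Es: "(E \<rho> has_vector_derivative \<rho> *\<^sub>R ?Je s) (at s within S)" for \<rho> s S
    unfolding E_def[abs_def]
    by (auto intro!: derivative_eq_intros circle_has_vector_derivative[OF w])
  have E_cont: "continuous_on S (\<lambda>z. E (f z) (g z))" if "continuous_on S f" "continuous_on S g"
    for S :: "'z::t2_space set" and f g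
    unfolding E_def by (intro continuous_intros that continuous_on_circle w)
  define D2 where "D2 x u v = (\<Sum>i<?d. coord u i *\<^sub>R differential ?d (partial i \<phi>) x v)" for x u v
  have D2_sym: "D2 x u v = D2 x v u" if "x \<in> Rn ?d" for x u v
  proof -
    have "D2 x u v = (\<Sum>i<?d. \<Sum>j<?d. (coord u i * coord v j) *\<^sub>R partial j (partial i \<phi>) x)"
      by (simp add: D2_def differential_def scaleR_sum_right)
    also have "\<dots> = (\<Sum>i<?d. \<Sum>j<?d. (coord u i * coord v j) *\<^sub>R partial i (partial j \<phi>) x)"
      by (intro sum.cong refl arg_cong2[where f = scaleR] mixed_partials_commute[OF \<phi>1 that]) auto
    also have "\<dots> = (\<Sum>j<?d. \<Sum>i<?d. (coord u i * coord v j) *\<^sub>R partial i (partial j \<phi>) x)"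
      by (rule sum.swap)
    also have "\<dots> = D2 x v u"
      by (simp add: D2_def differential_def scaleR_sum_right mult.commute)
    finally show ?thesis .
  qed
  have D_curve: "((\<lambda>t. ?D (c t) (u t)) has_vector_derivative D2 (c t) (u t) c' + ?D (c t) u') (at t within S)"
    if c: "(c has_vector_derivative c') (at t within S)" "\<And>s. c s \<in> Rn ?d"
      and u: "(u has_vector_derivative u') (at t within S)" for c c' t S u u'
  proof -
    have "((\<lambda>t. \<Sum>i<?d. coord (u t) i *\<^sub>R partial i \<phi> (c t)) has_vector_derivative
        (\<Sum>i<?d. coord (u t) i *\<^sub>R differential ?d (partial i \<phi>) (c t) c' + coord u' i *\<^sub>R partial i \<phi> (c t))) (at t within S)"
      using coord_has_vector_derivative[OF u]
      by (intro has_vector_derivative_sum has_vector_derivative_scaleR Ck_chain_curve[OF P1] c(1) c(2))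
         (auto simp: has_real_derivative_iff_has_vector_derivative)
    then show ?thesis by (simp add: differential_def[of _ \<phi>, abs_def] D2_def sum.distrib)
  qed
  define G where "G \<rho> s = omega N (\<phi> (E \<rho> s)) (\<rho> *\<^sub>R ?D (E \<rho> s) (?Je s))" for \<rho> s
  define W where "W \<rho> s = omega N (\<phi> (E \<rho> s)) (?D (E \<rho> s) (?e s))" for \<rho> s
  define W' where "W' \<rho> s = omega N (\<phi> (E \<rho> s)) (D2 (E \<rho> s) (?e s) (\<rho> *\<^sub>R ?Je s) + ?D (E \<rho> s) (?Je s))
       + omega N (?D (E \<rho> s) (\<rho> *\<^sub>R ?Je s)) (?D (E \<rho> s) (?e s))" for \<rho> s
  let ?r2 = "eucl_inner ?d w w"
  have Ws: "(W \<rho> has_vector_derivative W' \<rho> s) (at s within S)" for \<rho> s S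
    unfolding W_def[abs_def] W'_def
    by (rule omega_has_vector_derivative[OF Ck_chain_curve[OF \<phi>1' Es E E]
          D_curve[OF Es E circle_has_vector_derivative[OF w]]])
  have G\<rho>: "((\<lambda>\<rho>. G \<rho> s) has_vector_derivative W' \<rho> s + 2 * \<rho> * ?r2) (at \<rho> within S)" for \<rho> s S
  proof -
    have area: "omega N (?D (E \<rho> s) (?e s)) (?D (E \<rho> s) (?Je s)) = ?r2"
      by (simp add: symp omega_J_right circle_norm[OF w])
    have 1: "((\<lambda>\<rho>. \<rho> *\<^sub>R ?D (E \<rho> s) (?Je s)) has_vector_derivative
        \<rho> *\<^sub>R (D2 (E \<rho> s) (?Je s) (?e s) + ?D (E \<rho> s) 0) + 1 *\<^sub>R ?D (E \<rho> s) (?Je s)) (at \<rho> within S)"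
      by (intro has_vector_derivative_scaleR D_curve[OF E\<rho> E]) (auto intro!: derivative_eq_intros)
    have 2: "((\<lambda>\<rho>. G \<rho> s) has_vector_derivative
        omega N (\<phi> (E \<rho> s)) (\<rho> *\<^sub>R (D2 (E \<rho> s) (?Je s) (?e s) + ?D (E \<rho> s) 0) + 1 *\<^sub>R ?D (E \<rho> s) (?Je s))
        + omega N (?D (E \<rho> s) (?e s)) (\<rho> *\<^sub>R ?D (E \<rho> s) (?Je s))) (at \<rho> within S)"
      unfolding G_def
      by (rule omega_has_vector_derivative[OF Ck_chain_curve[OF \<phi>1' E\<rho> E E] 1])
    have 3: "D2 (E \<rho> s) (?e s) (\<rho> *\<^sub>R ?Je s) = \<rho> *\<^sub>R D2 (E \<rho> s) (?Je s) (?e s)"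
      using D2_sym[of "E \<rho> s" "?e s" "\<rho> *\<^sub>R ?Je s"] by (simp add: D2_def scaleR_sum_right)
    have 4: "omega N (?D (E \<rho> s) (\<rho> *\<^sub>R ?Je s)) (?D (E \<rho> s) (?e s)) = - (\<rho> * ?r2)"
      unfolding differential_scale omega_scale_left
      by (subst omega_skew) (simp add: area)
    have "omega N (\<phi> (E \<rho> s)) (\<rho> *\<^sub>R (D2 (E \<rho> s) (?Je s) (?e s) + ?D (E \<rho> s) 0) + 1 *\<^sub>R ?D (E \<rho> s) (?Je s))
        + omega N (?D (E \<rho> s) (?e s)) (\<rho> *\<^sub>R ?D (E \<rho> s) (?Je s)) = W' \<rho> s + 2 * \<rho> * ?r2"
      unfolding W'_def 3 4 by (simp add: omega_bilinear area)
    with 2 show ?thesis by (simp only:)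
  qed
  have D_cont: "continuous_on S (\<lambda>z. ?D (E (f z) (g z)) (v z))"
    if "continuous_on S f" "continuous_on S g" "continuous_on S v"
    for S :: "(real \<times> real) set" and f g v
    by (intro continuous_on_differential[OF \<phi>1'] E_cont that E)
  have \<phi>_cont: "continuous_on S (\<lambda>z. \<phi> (E (f z) (g z)))"
    if "continuous_on S f" "continuous_on S g"
    for S :: "(real \<times> real) set" and f g
    by (intro continuous_on_Ck[OF \<phi>] E_cont that E)
  have G'_cont: "continuous_on S (\<lambda>(\<rho>, s). W' \<rho> s + 2 * \<rho> * ?r2)" for S
    unfolding case_prod_unfold W'_def D2_def
    by (intro continuous_intros D_cont \<phi>_cont continuous_on_circle w continuous_on_differential[OF P1] E_cont E) auto
  have G_cont: "continuous_on S (\<lambda>(\<rho>, s). G \<rho> s)" for S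
    unfolding case_prod_unfold G_def
    by (intro continuous_intros D_cont \<phi>_cont continuous_on_circle w)
  have G_cont1: "continuous_on S (G \<rho>)" for S \<rho>
    using continuous_on_compose2[OF G_cont[of UNIV], of S "\<lambda>s. (\<rho>, s)"]
    by (simp add: continuous_on_Pair)
  define A where "A \<rho> = integral {\<alpha>..\<beta>} (G \<rho>)" for \<rho>
  have A': "(A has_vector_derivative 2 * \<rho> * ?r2 * (\<beta> - \<alpha>)) (at \<rho> within {0..1})" if "\<rho> \<in> {0..1}" for \<rho>
  proof -
    have "((\<lambda>\<rho>. integral (cbox \<alpha> \<beta>) (G \<rho>)) has_vector_derivative integral (cbox \<alpha> \<beta>) (\<lambda>s. W' \<rho> s + 2 * \<rho> * ?r2)) (at \<rho> within {0..1})"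
      by (rule leibniz_rule_vector_derivative[where U = "{0..1::real}"])
         (use that in \<open>auto intro!: G\<rho> G'_cont G_cont1 integrable_continuous_real simp del: split_paired_All\<close>)
    moreover have "((\<lambda>s. W' \<rho> s + 2 * \<rho> * ?r2) has_integral (W \<rho> \<beta> - W \<rho> \<alpha>) + (2 * \<rho> * ?r2) * (\<beta> - \<alpha>)) {\<alpha>..\<beta>}"
    proof (rule has_integral_add)
      show "(W' \<rho> has_integral W \<rho> \<beta> - W \<rho> \<alpha>) {\<alpha>..\<beta>}"
        using \<beta>(2) by (intro fundamental_theorem_of_calculus Ws)
      show "((\<lambda>s. 2 * \<rho> * ?r2) has_integral (2 * \<rho> * ?r2) * (\<beta> - \<alpha>)) {\<alpha>..\<beta>}"
        using \<beta>(2) has_integral_const_real[of "2 * \<rho> * ?r2" \<alpha> \<beta>] by (simp add: mult.commute)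
    qed
    moreover have "W \<rho> \<beta> = W \<rho> \<alpha>"
      by (simp add: W_def E_def \<beta>(1) circle_periodic)
    ultimately show ?thesis by (simp add: A_def[abs_def] integral_unique)
  qed
  have I1: "((\<lambda>\<rho>. 2 * \<rho> * ?r2 * (\<beta> - \<alpha>)) has_integral A 1 - A 0) {0..1}"
    by (intro fundamental_theorem_of_calculus A') auto
  have I2: "((\<lambda>\<rho>. 2 * \<rho> * ?r2 * (\<beta> - \<alpha>)) has_integral ?r2 * (\<beta> - \<alpha>) * 1\<^sup>2 - ?r2 * (\<beta> - \<alpha>) * 0\<^sup>2) {0..1}"
  proof (intro fundamental_theorem_of_calculus)
    show "((\<lambda>\<rho>. ?r2 * (\<beta> - \<alpha>) * \<rho>\<^sup>2) has_vector_derivative 2 * \<rho> * ?r2 * (\<beta> - \<alpha>)) (at \<rho> within {0..1})" for \<rho>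
      unfolding has_real_derivative_iff_has_vector_derivative[symmetric]
      by (auto intro!: derivative_eq_intros)
  qed simp
  have "A 0 = 0" by (simp add: A_def G_def[abs_def])
  then have "A 1 = ?r2 * (\<beta> - \<alpha>)"
    using has_integral_unique[OF I1 I2] by simp
  then show ?thesis by (simp add: A_def G_def[abs_def] E_def)
qed

lemma norm_bound_on_Icc:
  fixes f :: "real \<Rightarrow> 'a::real_normed_vector"
  assumes "continuous_on {a..b} f"
  obtains M where "M > 0" "\<And>t. t \<in> {a..b} \<Longrightarrow> norm (f t) \<le> M"
proof -
  have "bounded (f ` {a..b})"
    using assms compact_continuous_image compact_imp_bounded by blast
  then obtain M where "M > 0" "\<forall>x\<in>f ` {a..b}. norm x \<le> M"
    unfolding bounded_pos by blast
  then show ?thesis using that by blast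
qed

section \<open>Images of balls under symplectomorphisms\<close>

locale symplectic_ball_image =
  fixes N :: nat and \<phi> :: "rseq \<Rightarrow> rseq" and a :: rseq and r :: real
  assumes symplectomorphism: "symplectomorphism N \<phi>"
    and centre: "a \<in> Rn (2*N)" and radius: "0 < r"
begin

abbreviation d where "d \<equiv> 2 * N"

abbreviation D\<phi> where "D\<phi> \<equiv> differential d \<phi>"

definition \<psi> where "\<psi> = inv_into (Rn d) \<phi>"

abbreviation D\<psi> where "D\<psi> \<equiv> differential d \<psi>"

definition body where "body = \<phi> ` eucl_ball d a r"

text \<open>The body is the sublevel set of \<open>level\<close>, the squared distance from the centre transported by
  \<open>\<psi>\<close>; \<open>grad\<close> is the Euclidean gradient of \<open>level\<close>.\<close>

definition level where "level z = eucl_inner d (\<psi> z - a) (\<psi> z - a)"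

definition grad where "grad z = vec_of d (\<lambda>i. 2 * eucl_inner d (\<psi> z - a) (partial i \<psi> z))"

lemma bij: "bij_betw \<phi> (Rn d) (Rn d)"
  using symplectomorphism by (simp add: symplectomorphism_def)

lemma \<phi>_Rn [simp, intro]: "x \<in> Rn d \<Longrightarrow> \<phi> x \<in> Rn d"
  using bij by (auto simp: bij_betw_def)

lemma \<psi>_Rn [simp, intro]: "z \<in> Rn d \<Longrightarrow> \<psi> z \<in> Rn d"
  using bij by (auto simp: \<psi>_def bij_betw_def intro: inv_into_into)

lemma \<psi>_\<phi> [simp]: "x \<in> Rn d \<Longrightarrow> \<psi> (\<phi> x) = x"
  using bij by (auto simp: \<psi>_def bij_betw_def)

lemma \<phi>_\<psi> [simp]: "z \<in> Rn d \<Longrightarrow> \<phi> (\<psi> z) = z"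
  using bij by (auto simp: \<psi>_def bij_betw_def f_inv_into_f)

lemma Ck_\<phi>: "Ck d k \<phi>" and Ck_\<psi>: "Ck d k \<psi>"
  using symplectomorphism by (auto simp: symplectomorphism_def smooth_def \<psi>_def simp del: Ck.simps)

lemma D\<phi>_Rn [simp, intro]: "x \<in> Rn d \<Longrightarrow> D\<phi> x v \<in> Rn d"
  and D\<psi>_Rn [simp, intro]: "x \<in> Rn d \<Longrightarrow> D\<psi> x v \<in> Rn d"
  by (auto intro: differential_Rn[OF Ck_\<phi>] differential_Rn[OF Ck_\<psi>])

lemma line_has_vector_derivative: "((\<lambda>t. x + t *\<^sub>R v) has_vector_derivative v) (at t within S)"
  for x v :: rseq
  by (auto intro!: derivative_eq_intros)

lemma differential_inverse:
  assumes f: "Ck d (Suc k) f" "Ck d (Suc l) g" and gf: "\<And>x. x \<in> Rn d \<Longrightarrow> g (f x) = x"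
    and fRn: "\<And>x. x \<in> Rn d \<Longrightarrow> f x \<in> Rn d" and x: "x \<in> Rn d" "v \<in> Rn d"
  shows "differential d g (f x) (differential d f x v) = v"
proof -
  have "((\<lambda>t. f (x + t *\<^sub>R v)) has_vector_derivative differential d f (x + 0 *\<^sub>R v) v) (at 0)"
    by (rule Ck_chain_curve[OF f(1) line_has_vector_derivative]) (use x in auto)
  from Ck_chain_curve[OF f(2) this] have "((\<lambda>t. g (f (x + t *\<^sub>R v))) has_vector_derivative
      differential d g (f x) (differential d f x v)) (at 0)"
    using x fRn by auto
  moreover have "g (f (x + t *\<^sub>R v)) = x + t *\<^sub>R v" for t using x gf by auto
  ultimately show ?thesis
    using vector_derivative_unique_at[OF _ line_has_vector_derivative, of x v _ 0] by simp
qed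

lemma D\<psi>_D\<phi> [simp]: "x \<in> Rn d \<Longrightarrow> v \<in> Rn d \<Longrightarrow> D\<psi> (\<phi> x) (D\<phi> x v) = v"
  and D\<phi>_D\<psi>: "z \<in> Rn d \<Longrightarrow> v \<in> Rn d \<Longrightarrow> D\<phi> (\<psi> z) (D\<psi> z v) = v"
  using differential_inverse[OF Ck_\<phi>[of "Suc 0"] Ck_\<psi>[of "Suc 0"]]
    differential_inverse[OF Ck_\<psi>[of "Suc 0"] Ck_\<phi>[of "Suc 0"]] by auto

lemma omega_D\<phi> [simp]:
  assumes "x \<in> Rn d" "u \<in> Rn d" "v \<in> Rn d"
  shows "omega N (D\<phi> x u) (D\<phi> x v) = omega N u v"
  using symplectomorphism assms dir_deriv_eq_differential[OF Ck_\<phi>[of "Suc 0"]]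
  by (simp add: symplectomorphism_def)

lemma omega_D\<psi> [simp]:
  assumes "z \<in> Rn d" "u \<in> Rn d" "v \<in> Rn d"
  shows "omega N (D\<psi> z u) (D\<psi> z v) = omega N u v"
  using omega_D\<phi>[of "\<psi> z" "D\<psi> z u" "D\<psi> z v"] assms by (simp add: D\<phi>_D\<psi>)

lemma body_iff: "z \<in> body \<longleftrightarrow> z \<in> Rn d \<and> level z \<le> r\<^sup>2"
proof
  assume "z \<in> body"
  then obtain x where x: "z = \<phi> x" "x \<in> Rn d" "sqrt (eucl_inner d (x - a) (x - a)) \<le> r"
    by (auto simp: body_def eucl_ball_def)
  then show "z \<in> Rn d \<and> level z \<le> r\<^sup>2"
    using sqrt_le_D by (auto simp: level_def)
next
  assume z: "z \<in> Rn d \<and> level z \<le> r\<^sup>2"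
  then have "sqrt (eucl_inner d (\<psi> z - a) (\<psi> z - a)) \<le> r"
    using radius real_le_lsqrt[of r] by (simp add: level_def)
  then have "\<psi> z \<in> eucl_ball d a r" using z by (auto simp: eucl_ball_def)
  then show "z \<in> body" using z \<phi>_\<psi> unfolding body_def by (metis imageI)
qed

lemma level_continuous: "continuous_on (Rn d) level"
  unfolding level_def
  by (intro continuous_intros continuous_on_Ck[OF Ck_\<psi>[of 0]]) auto

lemma eucl_inner_grad:
  assumes "z \<in> Rn d"
  shows "eucl_inner d (grad z) v = 2 * eucl_inner d (\<psi> z - a) (D\<psi> z v)"
proof -
  have "eucl_inner d (grad z) v = (\<Sum>i<d. 2 * eucl_inner d (\<psi> z - a) (partial i \<psi> z) * coord v i)"
    unfolding eucl_inner_def[of d "grad z"] by (simp add: grad_def coord_vec_of)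
  also have "\<dots> = 2 * eucl_inner d (\<psi> z - a) (D\<psi> z v)"
    unfolding differential_def eucl_inner_sum_right eucl_inner_scale_right sum_distrib_left
    by (rule sum.cong) simp_all
  finally show ?thesis .
qed

lemma grad_Rn [simp, intro]: "grad z \<in> Rn d"
  by (simp add: grad_def)

lemma level_has_derivative:
  assumes c: "(c has_vector_derivative c') (at t within S)" "\<And>s. s \<in> S \<Longrightarrow> c s \<in> Rn d" "c t \<in> Rn d"
  shows "((\<lambda>s. level (c s)) has_real_derivative eucl_inner d (grad (c t)) c') (at t within S)"
proof -
  have "((\<lambda>s. \<psi> (c s)) has_vector_derivative D\<psi> (c t) c') (at t within S)"
    by (rule Ck_chain_curve[OF Ck_\<psi>[of "Suc 0"] c])
  then have co: "((\<lambda>s. coord (\<psi> (c s)) i) has_real_derivative coord (D\<psi> (c t) c') i) (at t within S)" for i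
    by (simp add: has_real_derivative_iff_has_vector_derivative coord_has_vector_derivative)
  have "((\<lambda>s. \<Sum>i<d. (coord (\<psi> (c s)) i - coord a i) * (coord (\<psi> (c s)) i - coord a i)) has_real_derivative
      (\<Sum>i<d. (coord (\<psi> (c t)) i - coord a i) * coord (D\<psi> (c t) c') i + coord (D\<psi> (c t) c') i * (coord (\<psi> (c t)) i - coord a i))) (at t within S)"
    by (intro DERIV_sum) (auto intro!: derivative_eq_intros co)
  moreover have "(\<Sum>i<d. (coord (\<psi> (c t)) i - coord a i) * coord (D\<psi> (c t) c') i + coord (D\<psi> (c t) c') i * (coord (\<psi> (c t)) i - coord a i))
      = eucl_inner d (grad (c t)) c'"
    unfolding eucl_inner_grad[OF c(3)]
    by (simp add: eucl_inner_def sum_distrib_left)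
  ultimately show ?thesis by (simp add: level_def[abs_def] eucl_inner_def)
qed

text \<open>The derivative of \<open>level\<close> along the image of the radial vector \<open>\<psi> z - a\<close> is \<open>2 * level z\<close>.\<close>

lemma grad_nonzero:
  assumes z: "z \<in> Rn d" "level z = r\<^sup>2"
  shows "grad z \<noteq> 0"
proof
  assume "grad z = 0"
  then have "eucl_inner d (\<psi> z - a) (D\<psi> z (D\<phi> (\<psi> z) (\<psi> z - a))) = 0"
    using eucl_inner_grad[OF z(1), of "D\<phi> (\<psi> z) (\<psi> z - a)"] by simp
  then have "level z = 0"
    using D\<psi>_D\<phi>[of "\<psi> z" "\<psi> z - a"] z centre by (simp add: level_def)
  then show False using z radius by simp
qed

lemma interior_point:
  assumes z: "z \<in> Rn d" "level z < r\<^sup>2"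
  obtains \<epsilon> where "\<epsilon> > 0" "\<And>y. y \<in> Rn d \<Longrightarrow> norm (y - z) < \<epsilon> \<Longrightarrow> y \<in> body"
proof -
  have "\<forall>\<^sub>F y in at z within Rn d. level y < r\<^sup>2"
    using level_continuous z order_tendstoD(2)[of level "level z" "at z within Rn d" "r\<^sup>2"]
    by (auto simp: continuous_on_def)
  then obtain \<epsilon> where "\<epsilon> > 0" "\<And>y. y \<in> Rn d \<Longrightarrow> y \<noteq> z \<Longrightarrow> dist y z < \<epsilon> \<Longrightarrow> level y < r\<^sup>2"
    unfolding eventually_at by auto
  then show ?thesis using z that
    by (metis body_iff dist_norm less_imp_le)
qed

lemma enters_body:
  assumes z: "z \<in> Rn d" "level z \<le> r\<^sup>2" and v: "v \<in> Rn d" "eucl_inner d (grad z) v < 0"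
  obtains s\<^sub>0 :: real where "s\<^sub>0 > 0" "\<And>s. 0 < s \<Longrightarrow> s < s\<^sub>0 \<Longrightarrow> z + s *\<^sub>R v \<in> body"
proof -
  have "((\<lambda>s. level (z + s *\<^sub>R v)) has_real_derivative eucl_inner d (grad (z + 0 *\<^sub>R v)) v) (at 0)"
    by (rule level_has_derivative[OF line_has_vector_derivative]) (use z v in auto)
  then obtain s\<^sub>0 where "s\<^sub>0 > 0" "\<And>s. 0 < s \<Longrightarrow> s < s\<^sub>0 \<Longrightarrow> level (z + s *\<^sub>R v) < level z"
    using DERIV_neg_dec_right[of "\<lambda>s. level (z + s *\<^sub>R v)" _ 0] v by auto
  then show ?thesis using z v by (intro that[of s\<^sub>0]) (fastforce simp: body_iff)+
qed

text \<open>The body has smooth boundary, so its normal cone at a boundary point is a ray: a normal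
  vector is non-positive on every direction that enters the body, in particular on all directions
  of negative derivative of \<open>level\<close>; testing with its component orthogonal to the
  gradient, slightly tilted inwards, shows that this component vanishes.\<close>

lemma normal_is_multiple_of_grad:
  assumes z: "z \<in> Rn d" "level z = r\<^sup>2" and \<nu>: "\<nu> \<in> Rn d"
    and normal: "\<And>y. y \<in> body \<Longrightarrow> eucl_inner d \<nu> (y - z) \<le> 0"
  obtains c where "c \<ge> 0" "\<nu> = c *\<^sub>R grad z"
proof -
  let ?g = "grad z"
  have g: "?g \<in> Rn d" "0 < eucl_inner d ?g ?g"
    using grad_nonzero[OF z] by (auto intro: eucl_inner_pos)
  have test: "eucl_inner d \<nu> v \<le> 0" if v: "v \<in> Rn d" "eucl_inner d ?g v < 0" for v
  proof -
    obtain s\<^sub>0 where s0: "s\<^sub>0 > 0" "\<And>s. 0 < s \<Longrightarrow> s < s\<^sub>0 \<Longrightarrow> z + s *\<^sub>R v \<in> body"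
      by (rule enters_body[of z v]) (use z v in auto)
    then have "eucl_inner d \<nu> ((s\<^sub>0/2) *\<^sub>R v) \<le> 0"
      using normal[of "z + (s\<^sub>0/2) *\<^sub>R v"] by simp
    then show ?thesis using s0 by (simp add: eucl_inner_scale_right mult_le_0_iff)
  qed
  define c where "c = eucl_inner d \<nu> ?g / eucl_inner d ?g ?g"
  define p where "p = \<nu> - c *\<^sub>R ?g"
  have p: "p \<in> Rn d" "eucl_inner d ?g p = 0"
    using \<nu> g by (auto simp: p_def c_def eucl_inner_bilinear eucl_inner_commute)
  have \<nu>p: "eucl_inner d \<nu> p = eucl_inner d p p"
    using p by (simp add: p_def eucl_inner_bilinear eucl_inner_commute)
  have "c \<ge> 0"
    using test[of "- ?g"] g by (auto simp: c_def eucl_inner_bilinear)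
  have "eucl_inner d p p \<le> \<epsilon> * eucl_inner d \<nu> ?g" if "\<epsilon> > 0" for \<epsilon>
    using test[of "p - \<epsilon> *\<^sub>R ?g"] p g that by (auto simp: eucl_inner_bilinear \<nu>p)
  then have lim: "eucl_inner d p p \<le> \<epsilon> * \<bar>eucl_inner d \<nu> ?g\<bar>" if "\<epsilon> > 0" for \<epsilon>
    using that by (meson abs_ge_self mult_left_mono order_trans less_imp_le)
  have "eucl_inner d p p \<le> 0"
  proof (rule field_le_epsilon)
    fix e :: real assume "e > 0"
    let ?M = "\<bar>eucl_inner d \<nu> ?g\<bar>"
    have "eucl_inner d p p \<le> e / (?M + 1) * ?M" using \<open>e > 0\<close> by (intro lim) auto
    also have "\<dots> \<le> 0 + e" using \<open>e > 0\<close> by (simp add: field_simps)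
    finally show "eucl_inner d p p \<le> 0 + e" .
  qed
  then have "p = 0" using p eucl_inner_pos by force
  then show ?thesis using that[OF \<open>c \<ge> 0\<close>] by (simp add: p_def)
qed

text \<open>The field \<open>J (grad z)\<close> is the Hamiltonian field of \<open>level\<close>.  Hamiltonian fields are natural
  under symplectomorphisms, so \<open>\<psi>\<close> carries it to the Hamiltonian field of the squared distance.\<close>

lemma D\<psi>_J_grad:
  assumes z: "z \<in> Rn d"
  shows "D\<psi> z (J_std N (grad z)) = 2 *\<^sub>R J_std N (\<psi> z - a)"
proof -
  let ?u = "D\<psi> z (J_std N (grad z)) - 2 *\<^sub>R J_std N (\<psi> z - a)"
  have "omega N ?u v = 0" if v: "v \<in> Rn d" for v
  proof -
    have v': "v = D\<psi> z (D\<phi> (\<psi> z) v)" using D\<psi>_D\<phi>[of "\<psi> z" v] z v by simp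
    have "omega N (D\<psi> z (J_std N (grad z))) v = omega N (J_std N (grad z)) (D\<phi> (\<psi> z) v)"
      by (subst v') (use z v in auto)
    also have "\<dots> = - (2 * eucl_inner d (\<psi> z - a) v)"
      using v' by (simp add: omega_J_left eucl_inner_grad[OF z])
    finally show ?thesis by (simp add: omega_bilinear omega_J_left)
  qed
  then have "?u = 0" using z by (intro omega_nondegenerate) auto
  then show ?thesis by simp
qed

text \<open>Images of Hopf circles are characteristics of the body, with normal \<open>pi *\<^sub>R grad\<close> in the
  parametrisation of period one.\<close>

lemma hopf_orbit_derivative:
  assumes w: "w \<in> Rn d"
  shows "((\<lambda>t. \<phi> (a + circle N w (2 * pi * t))) has_vector_derivative
      J_std N (pi *\<^sub>R grad (\<phi> (a + circle N w (2 * pi * t))))) (at t within S)"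
proof -
  let ?x = "a + circle N w (2 * pi * t)"
  let ?z = "\<phi> ?x"
  have x: "?x \<in> Rn d" using w centre by auto
  have "((\<lambda>t. circle N w (2 * pi * t)) has_vector_derivative (2 * pi) *\<^sub>R J_std N (circle N w (2 * pi * t))) (at t within S)"
    using vector_diff_chain_within[of "\<lambda>t. 2 * pi * t" "2 * pi" t S "circle N w"]
      circle_has_vector_derivative[OF w]
    by (auto simp: o_def intro!: derivative_eq_intros simp: has_real_derivative_iff_has_vector_derivative[symmetric])
  then have "((\<lambda>t. a + circle N w (2 * pi * t)) has_vector_derivative (2 * pi) *\<^sub>R J_std N (circle N w (2 * pi * t))) (at t within S)"
    by (auto intro!: derivative_eq_intros)
  from Ck_chain_curve[OF Ck_\<phi>[of "Suc 0"] this]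
  have "((\<lambda>t. \<phi> (a + circle N w (2 * pi * t))) has_vector_derivative
      D\<phi> ?x ((2 * pi) *\<^sub>R J_std N (circle N w (2 * pi * t)))) (at t within S)"
    using w centre by auto
  moreover have "D\<phi> ?x ((2 * pi) *\<^sub>R J_std N (circle N w (2 * pi * t))) = D\<phi> ?x (D\<psi> ?z (pi *\<^sub>R J_std N (grad ?z)))"
    unfolding differential_scale using D\<psi>_J_grad[of ?z] x by (simp add: differential_scale)
  moreover have "\<dots> = J_std N (pi *\<^sub>R grad ?z)"
    using D\<phi>_D\<psi>[of ?z "pi *\<^sub>R J_std N (grad ?z)"] x by (simp add: J_scale)
  ultimately show ?thesis by simp
qed

text \<open>A curve on the boundary that runs along normals of the body pulls back to a curve on the
  sphere whose velocity is a non-negative multiple of the Hopf field.  All its complex coordinates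
  turn at the same rate, so it is a reparametrised arc of one Hopf circle; being closed and
  non-constant it winds around it at least once.\<close>

lemma action_ge_of_normal_curve:
  fixes \<gamma> :: "real \<Rightarrow> rseq"
  assumes ac: "abs_continuous_on 0 1 \<gamma>" and closed: "\<gamma> 0 = \<gamma> 1"
    and nonconst: "\<not> \<gamma> constant_on {0..1}"
    and bdry: "\<And>t. t \<in> {0..1} \<Longrightarrow> \<gamma> t \<in> Rn d \<and> level (\<gamma> t) = r\<^sup>2"
    and Z: "negligible Z"
    and normal: "\<And>t. t \<in> {0..1} - Z \<Longrightarrow> \<exists>\<nu>\<in>Rn d. (\<forall>y\<in>body. eucl_inner d \<nu> (y - \<gamma> t) \<le> 0) \<and>
        (\<gamma> has_vector_derivative J_std N \<nu>) (at t within {0..1})"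
  shows "pi * r\<^sup>2 \<le> action N \<gamma>"
proof -
  define \<delta> where "\<delta> t = \<psi> (\<gamma> t) - a" for t
  have \<delta>Rn [simp]: "\<delta> t \<in> Rn d" if "t \<in> {0..1}" for t
    using bdry[OF that] centre by (auto simp: \<delta>_def)
  have \<delta>norm: "eucl_inner d (\<delta> t) (\<delta> t) = r\<^sup>2" if "t \<in> {0..1}" for t
    using bdry[OF that] by (simp add: \<delta>_def level_def)
  have \<gamma>\<delta>: "\<gamma> t = \<phi> (a + \<delta> t)" if "t \<in> {0..1}" for t
    using bdry[OF that] by (simp add: \<delta>_def)

  obtain R where R: "\<And>t. t \<in> {0..1} \<Longrightarrow> norm (\<gamma> t) \<le> R"
    using norm_bound_on_Icc[OF abs_continuous_imp_continuous[OF ac]] by blast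
  let ?K = "{x \<in> Rn d. \<forall>i. \<bar>coord x i\<bar> \<le> R}"
  have "convex ?K"
  proof -
    have "?K = Rn d \<inter> (\<Inter>i. (\<lambda>x. coord x i) -` {-R..R})" by (auto simp: abs_le_iff minus_le_iff)
    moreover have "convex ((\<lambda>x. coord x i) -` {-R..R})" for i
      by (intro convex_linear_vimage bounded_linear.linear[OF bounded_linear_coord]) simp
    ultimately show ?thesis by (simp add: convex_Int convex_INT)
  qed
  then obtain C where C: "C > 0" "\<And>x y. x \<in> ?K \<Longrightarrow> y \<in> ?K \<Longrightarrow> norm (\<psi> x - \<psi> y) \<le> C * norm (x - y)"
    using Ck_lipschitz_on_compact[OF Ck_\<psi>[of "Suc 0"] compact_cube[of d R]] by auto
  have \<gamma>K: "\<gamma> t \<in> ?K" if "t \<in> {0..1}" for t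
    using bdry[OF that] R[OF that] abs_coord_le_norm order_trans by blast
  have \<delta>_ac: "abs_continuous_on 0 1 \<delta>"
    by (rule abs_continuous_on_compare[OF ac, of 1 _ C]) (auto simp: \<delta>_def intro!: C(2) \<gamma>K)

  have "\<exists>\<kappa>. t \<in> {0..1} - Z \<longrightarrow> 0 \<le> \<kappa> \<and> (\<delta> has_vector_derivative \<kappa> *\<^sub>R J_std N (\<delta> t)) (at t within {0..1})" for t
  proof (cases "t \<in> {0..1} - Z")
    case True
    then have z: "\<gamma> t \<in> Rn d" "level (\<gamma> t) = r\<^sup>2" using bdry by auto
    obtain \<nu> where \<nu>: "\<nu> \<in> Rn d" "\<And>y. y \<in> body \<Longrightarrow> eucl_inner d \<nu> (y - \<gamma> t) \<le> 0"
      "(\<gamma> has_vector_derivative J_std N \<nu>) (at t within {0..1})" using normal[OF True] by blast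
    obtain c where c: "c \<ge> 0" "\<nu> = c *\<^sub>R grad (\<gamma> t)"
      using normal_is_multiple_of_grad[OF z \<nu>(1,2)] by blast
    have "((\<lambda>s. \<psi> (\<gamma> s)) has_vector_derivative D\<psi> (\<gamma> t) (J_std N \<nu>)) (at t within {0..1})"
      by (rule Ck_chain_curve[OF Ck_\<psi>[of "Suc 0"] \<nu>(3)]) (use bdry z in auto)
    moreover have "D\<psi> (\<gamma> t) (J_std N \<nu>) = (2 * c) *\<^sub>R J_std N (\<delta> t)"
      using D\<psi>_J_grad[OF z(1)] by (simp add: c(2) J_scale differential_scale \<delta>_def mult.commute)
    ultimately have "(\<delta> has_vector_derivative (2 * c) *\<^sub>R J_std N (\<delta> t)) (at t within {0..1})"
      unfolding \<delta>_def[abs_def] by (auto intro!: derivative_eq_intros)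
    then show ?thesis using c by (intro exI[of _ "2*c"]) simp
  qed blast
  then obtain \<kappa> where \<kappa>: "\<And>t. t \<in> {0..1} - Z \<Longrightarrow> 0 \<le> \<kappa> t"
    "\<And>t. t \<in> {0..1} - Z \<Longrightarrow> (\<delta> has_vector_derivative \<kappa> t *\<^sub>R J_std N (\<delta> t)) (at t within {0..1})"
    by metis

  define z where "z k x = Complex (coord x (2*k)) (coord x (2*k+1))" for k x
  have z_lin: "bounded_linear (z k)" for k
  proof (rule bounded_linear_intro[where K = 2])
    show "norm (z k x) \<le> norm x * 2" for x
      using cmod_le[of "z k x"] abs_coord_le_norm[of x "2*k"] abs_coord_le_norm[of x "2*k+1"]
      by (simp add: z_def)
  qed (auto simp: z_def complex_eq_iff)
  have z_J: "z k (J_std N x) = \<i> * z k x" if "k < N" for k x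
    using coord_J_even[OF that, of x] coord_J_odd[OF that, of x]
    by (simp add: z_def complex_eq_iff)
  have z_diff: "z k (x - y) = z k x - z k y" for k x y by (simp add: z_def complex_eq_iff)
  have z_bound: "norm (z k x) \<le> 2 * norm x" for k x
    using cmod_le[of "z k x"] abs_coord_le_norm[of x "2*k"] abs_coord_le_norm[of x "2*k+1"]
    by (simp add: z_def)
  have z_der: "((\<lambda>s. z k (\<delta> s)) has_vector_derivative \<i> * of_real (\<kappa> t) * z k (\<delta> t)) (at t within {0..1})"
    if "t \<in> {0..1} - Z" "k < N" for k t
    using bounded_linear.has_vector_derivative[OF z_lin \<kappa>(2)[OF that(1)], of k] z_J[OF that(2)]
    by (simp add: linear_scale[OF bounded_linear.linear[OF z_lin]] scaleR_conv_of_real mult_ac)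
  obtain M where "M > 0" and M: "\<And>t. t \<in> {0..1} \<Longrightarrow> norm (\<delta> t) \<le> M"
    using norm_bound_on_Icc[OF abs_continuous_imp_continuous[OF \<delta>_ac]] by blast
  (* All complex coordinates turn at the same rate \<kappa>, which cancels in these products. *)
  have q_const: "cnj (z j (\<delta> t)) * z k (\<delta> t) = cnj (z j (\<delta> 0)) * z k (\<delta> 0)"
    if "t \<in> {0..1}" "j < N" "k < N" for t j k
  proof (rule abs_continuous_constant[OF _ Z _ that(1)])
    show "abs_continuous_on 0 1 (\<lambda>t. cnj (z j (\<delta> t)) * z k (\<delta> t))"
    proof (rule abs_continuous_on_compare[OF \<delta>_ac, of 1 _ "8 * M"])
      fix s t :: real assume st: "0 \<le> s" "s \<le> t" "t \<le> 1"
      have "cnj (z j (\<delta> t)) * z k (\<delta> t) - cnj (z j (\<delta> s)) * z k (\<delta> s)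
          = cnj (z j (\<delta> t)) * z k (\<delta> t - \<delta> s) + cnj (z j (\<delta> t - \<delta> s)) * z k (\<delta> s)"
        by (simp add: z_diff algebra_simps)
      also have "norm \<dots> \<le> norm (z j (\<delta> t)) * norm (z k (\<delta> t - \<delta> s)) + norm (z j (\<delta> t - \<delta> s)) * norm (z k (\<delta> s))"
        by (rule norm_triangle_le) (simp add: norm_mult)
      also have "\<dots> \<le> (2 * M) * (2 * norm (\<delta> t - \<delta> s)) + (2 * norm (\<delta> t - \<delta> s)) * (2 * M)"
        using st \<open>M > 0\<close> by (intro add_mono mult_mono z_bound order_trans[OF z_bound] mult_left_mono M) auto
      finally show "norm (cnj (z j (\<delta> t)) * z k (\<delta> t) - cnj (z j (\<delta> s)) * z k (\<delta> s)) \<le> 8 * M * norm (\<delta> t - \<delta> s)"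
        by (simp add: mult_ac)
    qed simp
    fix t assume t: "t \<in> {0..1} - Z"
    have "((\<lambda>t. cnj (z j (\<delta> t)) * z k (\<delta> t)) has_vector_derivative
        cnj (z j (\<delta> t)) * (\<i> * of_real (\<kappa> t) * z k (\<delta> t)) + cnj (\<i> * of_real (\<kappa> t) * z j (\<delta> t)) * z k (\<delta> t)) (at t within {0..1})"
      by (intro has_vector_derivative_mult bounded_linear.has_vector_derivative[OF bounded_linear_cnj] z_der t that)
    then show "((\<lambda>t. cnj (z j (\<delta> t)) * z k (\<delta> t)) has_vector_derivative 0) (at t within {0..1})"
      by (simp add: algebra_simps)
  qed

  have "\<delta> 0 \<noteq> 0" using \<delta>norm[of 0] radius by auto
  then obtain i where i: "coord (\<delta> 0) i \<noteq> 0" "i < d"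
    using Rn_eqI[OF \<delta>Rn[of 0] Rn_0] by auto
  define j where "j = i div 2"
  have j: "j < N" using i(2) by (auto simp: j_def)
  have zj0: "z j (\<delta> 0) \<noteq> 0"
    using i(1) by (cases "even i") (auto simp: z_def j_def complex_eq_iff elim!: oddE)
  (* The common rotation is read off from a coordinate that does not vanish. *)
  define u where "u t = z j (\<delta> t) / z j (\<delta> 0)" for t
  have u_norm: "norm (u t) = 1" if "t \<in> {0..1}" for t
  proof -
    have "(norm (z j (\<delta> t)))\<^sup>2 = (norm (z j (\<delta> 0)))\<^sup>2"
      using q_const[OF that j j] by (metis complex_norm_square mult.commute of_real_eq_iff)
    then show ?thesis using zj0 by (simp add: u_def norm_divide)
  qed
  have zu: "z k (\<delta> t) = u t * z k (\<delta> 0)" if "t \<in> {0..1}" "k < N" for t k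
  proof -
    have uu: "u t * cnj (u t) = 1"
      using u_norm[OF that(1)] by (metis complex_norm_square mult_1 of_real_1 power_one)
    have "cnj (u t) * cnj (z j (\<delta> 0)) * z k (\<delta> t) = cnj (z j (\<delta> 0)) * z k (\<delta> 0)"
      using q_const[OF that(1) j that(2)] zj0 by (simp add: u_def)
    then have "cnj (u t) * z k (\<delta> t) = z k (\<delta> 0)" using zj0 by (simp add: mult_ac)
    then have "u t * (cnj (u t) * z k (\<delta> t)) = u t * z k (\<delta> 0)" by simp
    then show ?thesis by (simp add: mult.assoc[symmetric] uu)
  qed
  have u_cont: "continuous_on {0..1} u"
    unfolding u_def
    by (intro continuous_intros bounded_linear.continuous_on[OF z_lin] abs_continuous_imp_continuous[OF \<delta>_ac]) (use zj0 in auto)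
  obtain g where g: "continuous_on {0..1} g" "\<And>t. t \<in> {0..1} \<Longrightarrow> u t = exp (g t)"
    using continuous_logarithm_on_contractible[OF u_cont] u_norm convex_imp_contractible[of "{0..1::real}"]
    by (metis convex_real_interval(5) norm_zero zero_neq_one)
  define \<theta> where "\<theta> t = Im (g t)" for t
  have \<theta>_cont: "continuous_on {0..1} \<theta>" unfolding \<theta>_def by (intro continuous_intros g)
  have u\<theta>: "u t = cis (\<theta> t)" if "t \<in> {0..1}" for t
  proof -
    have "Re (g t) = 0" using u_norm[OF that] g(2)[OF that] by (simp add: norm_exp_eq_Re)
    then show ?thesis using g(2)[OF that] by (simp add: \<theta>_def exp_eq_polar)
  qed
  have \<delta>\<theta>: "\<delta> t = circle N (\<delta> 0) (\<theta> t)" if "t \<in> {0..1}" for t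
  proof (rule Rn_eqI[of _ d])
    fix l assume l: "l < d"
    define k where "k = l div 2"
    have k: "k < N" using l by (auto simp: k_def)
    have "z k (circle N (\<delta> 0) (\<theta> t)) = cis (\<theta> t) * z k (\<delta> 0)"
      using z_J[OF k, of "\<delta> 0"] by (simp add: circle_def z_def complex_eq_iff)
    then have "z k (\<delta> t) = z k (circle N (\<delta> 0) (\<theta> t))" using zu[OF that k] u\<theta>[OF that] by simp
    then show "coord (\<delta> t) l = coord (circle N (\<delta> 0) (\<theta> t)) l"
      by (cases "even l") (auto simp: z_def k_def complex_eq_iff elim!: oddE)
  qed (use that in auto)

  (* The lift \<theta> is only known to be continuous.  Locally \<theta> s - \<theta> t is the arcsine of
     Im (u s * cnj (u t)), which gives its absolute continuity and its derivative. *)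
  obtain \<epsilon> where \<epsilon>: "\<epsilon> > 0" "\<And>s t. \<lbrakk>s \<in> {0..1}; t \<in> {0..1}; \<bar>t - s\<bar> < \<epsilon>\<rbrakk> \<Longrightarrow> \<bar>\<theta> t - \<theta> s\<bar> < 1"
    using compact_uniformly_continuous[OF \<theta>_cont compact_Icc] unfolding uniformly_continuous_on_def
    by (metis dist_real_def zero_less_one)
  have sin_lower: "\<bar>x\<bar> \<le> 2 * \<bar>sin x\<bar>" if "\<bar>x\<bar> < 1" for x :: real
  proof -
    have *: "x \<le> 2 * sin x" if "0 < x" "x < 1" for x :: real
    proof -
      obtain \<xi> where \<xi>: "0 < \<xi>" "\<xi> < x" "sin x - sin 0 = (x - 0) * cos \<xi>"
        using MVT2[of 0 x sin cos] \<open>0 < x\<close> by (auto intro: DERIV_sin)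
      have "cos (pi / 3) \<le> cos \<xi>"
        using \<xi> that pi_gt3 by (intro cos_monotone_0_pi_le) auto
      then have "x * (1/2) \<le> x * cos \<xi>" using that by (intro mult_left_mono) (auto simp: cos_60)
      then show ?thesis using \<xi> by simp
    qed
    show ?thesis
      using *[of x] *[of "- x"] that by (cases "x = 0"; cases "0 < x") auto
  qed
  have sin_u: "sin (\<theta> s - \<theta> t) = Im (u s * cnj (u t))" if "s \<in> {0..1}" "t \<in> {0..1}" for s t
    using u\<theta>[OF that(1)] u\<theta>[OF that(2)] by (simp add: sin_diff)
  have \<theta>_ac: "abs_continuous_on 0 1 \<theta>"
  proof (rule abs_continuous_on_compare[OF \<delta>_ac \<epsilon>(1), of _ "4 / norm (z j (\<delta> 0))"])
    fix s t :: real assume st: "0 \<le> s" "s \<le> t" "t \<le> 1" "t - s < \<epsilon>"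
    then have st': "s \<in> {0..1}" "t \<in> {0..1}" by auto
    have "\<bar>\<theta> t - \<theta> s\<bar> \<le> 2 * \<bar>sin (\<theta> t - \<theta> s)\<bar>"
      using \<epsilon>(2)[of s t] st by (intro sin_lower) auto
    also have "sin (\<theta> t - \<theta> s) = Im ((u t - u s) * cnj (u s))"
      using sin_u[OF st'(2,1)] sin_u[OF st'(1,1)] by (simp add: algebra_simps)
    also have "\<bar>\<dots>\<bar> \<le> norm (u t - u s)"
      using abs_Im_le_cmod[of "(u t - u s) * cnj (u s)"] u_norm[OF st'(1)] by (simp add: norm_mult)
    also have "u t - u s = z j (\<delta> t - \<delta> s) / z j (\<delta> 0)" by (simp add: u_def z_diff diff_divide_distrib)
    also have "norm \<dots> \<le> 2 * norm (\<delta> t - \<delta> s) / norm (z j (\<delta> 0))"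
      using z_bound by (simp add: norm_divide divide_right_mono)
    finally show "norm (\<theta> t - \<theta> s) \<le> 4 / norm (z j (\<delta> 0)) * norm (\<delta> t - \<delta> s)" by simp
  qed
  have \<theta>_der: "(\<theta> has_vector_derivative \<kappa> t) (at t within {0..1})" if t: "t \<in> {0..1} - Z" for t
  proof -
    have t': "t \<in> {0..1}" using t by simp
    have "(u has_vector_derivative \<i> * of_real (\<kappa> t) * u t) (at t within {0..1})"
      unfolding u_def[abs_def] using z_der[OF t j] zj0
      by (auto intro!: derivative_eq_intros simp: divide_inverse mult.assoc has_vector_derivative_mult_left)
    then have "((\<lambda>s. Im (u s * cnj (u t))) has_vector_derivative Im (\<i> * of_real (\<kappa> t) * u t * cnj (u t))) (at t within {0..1})"
      by (intro bounded_linear.has_vector_derivative[OF bounded_linear_Im] has_vector_derivative_mult_left)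
    moreover have "Im (\<i> * of_real (\<kappa> t) * u t * cnj (u t)) = \<kappa> t"
      using u_norm[OF t'] by (simp add: mult.assoc complex_norm_square[symmetric])
    ultimately have S: "((\<lambda>s. Im (u s * cnj (u t))) has_real_derivative \<kappa> t) (at t within {0..1})"
      by (simp add: has_real_derivative_iff_has_vector_derivative)
    have "((\<lambda>s. arcsin (Im (u s * cnj (u t)))) has_real_derivative
        inverse (sqrt (1 - (Im (u t * cnj (u t)))\<^sup>2)) * \<kappa> t) (at t within {0..1})"
      by (rule DERIV_chain2[OF DERIV_arcsin S]) simp_all
    then have "((\<lambda>s. \<theta> t + arcsin (Im (u s * cnj (u t)))) has_real_derivative 0 + \<kappa> t) (at t within {0..1})"
      by (intro DERIV_add DERIV_const) simp
    then have "((\<lambda>s. \<theta> t + arcsin (Im (u s * cnj (u t)))) has_real_derivative \<kappa> t) (at t within {0..1})"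
      by simp
    then have "(\<theta> has_real_derivative \<kappa> t) (at t within {0..1})"
    proof (rule has_field_derivative_transform_within[OF _ \<epsilon>(1) t'])
      fix s assume s: "s \<in> {0..1}" "dist s t < \<epsilon>"
      then have "\<bar>\<theta> s - \<theta> t\<bar> < 1" using \<epsilon>(2)[of t s] t' by (auto simp: dist_real_def)
      then have "arcsin (sin (\<theta> s - \<theta> t)) = \<theta> s - \<theta> t" using pi_gt3 by (intro arcsin_sin) auto
      then show "\<theta> t + arcsin (Im (u s * cnj (u t))) = \<theta> s"
        using sin_u[OF s(1) t'] by simp
    qed
    then show ?thesis by (simp add: has_real_derivative_iff_has_vector_derivative)
  qed
  have \<theta>_mono: "\<theta> s \<le> \<theta> t" if "0 \<le> s" "s \<le> t" "t \<le> 1" for s t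
    using abs_continuous_mono[OF \<theta>_ac Z \<theta>_der \<kappa>(1) that] .
  have "u 1 = u 0" using closed by (simp add: u_def \<delta>_def)
  then have "cis (\<theta> 1 - \<theta> 0) = 1" using u\<theta>[of 0] u\<theta>[of 1] by (simp add: cis_divide[symmetric])
  then have "Re (cis (\<theta> 1 - \<theta> 0)) = Re 1" by (rule arg_cong)
  then have "cos (\<theta> 1 - \<theta> 0) = 1" by simp
  then obtain k where k: "\<theta> 1 - \<theta> 0 = of_int k * 2 * pi" unfolding cos_one_2pi_int by blast
  have "\<theta> 0 \<noteq> \<theta> 1"
  proof
    assume eq: "\<theta> 0 = \<theta> 1"
    have same: "\<theta> t = \<theta> 0" if "t \<in> {0..1}" for t
      using \<theta>_mono[of 0 t] \<theta>_mono[of t 1] that eq by auto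
    have "\<gamma> t = \<gamma> 0" if "t \<in> {0..1}" for t
      using \<gamma>\<delta>[OF that] \<gamma>\<delta>[of 0] \<delta>\<theta>[OF that] \<delta>\<theta>[of 0, symmetric] same[OF that] by simp
    then have "\<gamma> constant_on {0..1}" unfolding constant_on_def by blast
    with nonconst show False by blast
  qed
  then have pos: "\<theta> 0 < \<theta> 1" using \<theta>_mono[of 0 1] by simp
  then have "0 < of_int k * (2 * pi)" using k by linarith
  then have "0 < real_of_int k" by (rule zero_less_mult_pos2) simp
  then have "k \<ge> 1" by simp
  have k': "\<theta> 1 = \<theta> 0 + 2 * pi * of_int k" using k by (simp add: algebra_simps)
  have "1 * (2 * pi) \<le> of_int k * (2 * pi)" using \<open>k \<ge> 1\<close> by (intro mult_right_mono) auto
  then have k1: "2 * pi \<le> \<theta> 1 - \<theta> 0" using k by simp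

  (* Since \<gamma> = \<Gamma> o \<theta>, the action of \<gamma> is an integral over the angle. *)
  define \<Gamma> where "\<Gamma> s = \<phi> (a + circle N (\<delta> 0) s)" for s
  define \<Gamma>' where "\<Gamma>' s = D\<phi> (a + circle N (\<delta> 0) s) (J_std N (circle N (\<delta> 0) s))" for s
  have cRn: "a + circle N (\<delta> 0) s \<in> Rn d" for s using centre \<delta>Rn[of 0] by auto
  have \<Gamma>_der: "(\<Gamma> has_vector_derivative \<Gamma>' s) (at s within S)" for s S
    unfolding \<Gamma>_def[abs_def] \<Gamma>'_def
  proof (rule Ck_chain_curve[OF Ck_\<phi>[of "Suc 0"] _ cRn cRn])
    show "((\<lambda>s. a + circle N (\<delta> 0) s) has_vector_derivative J_std N (circle N (\<delta> 0) s)) (at s within S)"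
      using circle_has_vector_derivative[of "\<delta> 0"] by (auto intro!: derivative_eq_intros)
  qed
  define h where "h s = omega N (\<Gamma> s) (\<Gamma>' s) / 2" for s
  have h_cont: "continuous_on S h" for S
    unfolding h_def \<Gamma>_def \<Gamma>'_def
    by (intro continuous_intros continuous_on_Ck[OF Ck_\<phi>[of 0]] cRn continuous_on_circle
        continuous_on_differential[OF Ck_\<phi>[of "Suc 0"]]) auto
  define P where "P x = integral {\<theta> 0..x} h" for x
  have P_der: "(P has_vector_derivative h x) (at x within {\<theta> 0..\<theta> 1})" if "x \<in> {\<theta> 0..\<theta> 1}" for x
    unfolding P_def[abs_def] by (rule integral_has_vector_derivative[OF h_cont that])
  have \<theta>_range: "\<theta> t \<in> {\<theta> 0..\<theta> 1}" if "t \<in> {0..1}" for t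
    using \<theta>_mono[of 0 t] \<theta>_mono[of t 1] that by auto
  obtain L where L: "\<And>x. x \<in> {\<theta> 0..\<theta> 1} \<Longrightarrow> norm (h x) \<le> L"
    using norm_bound_on_Icc[OF h_cont] by blast
  have P_ac: "abs_continuous_on 0 1 (\<lambda>t. P (\<theta> t))"
  proof (rule abs_continuous_on_compare[OF \<theta>_ac, of 1 _ L])
    fix s t :: real assume st: "0 \<le> s" "s \<le> t" "t \<le> 1"
    show "norm (P (\<theta> t) - P (\<theta> s)) \<le> L * norm (\<theta> t - \<theta> s)"
    proof (rule differentiable_bound[of "{\<theta> 0..\<theta> 1}" P "\<lambda>x y. y *\<^sub>R h x"])
      show "(P has_derivative (\<lambda>y. y *\<^sub>R h x)) (at x within {\<theta> 0..\<theta> 1})" if "x \<in> {\<theta> 0..\<theta> 1}" for x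
        using P_der[OF that] by (simp add: has_vector_derivative_def)
      show "onorm (\<lambda>y. y *\<^sub>R h x) \<le> L" if "x \<in> {\<theta> 0..\<theta> 1}" for x
        using L[OF that] by (intro onorm_le) (simp add: abs_mult mult.commute[of L] mult_left_mono)
    qed (use st \<theta>_range in auto)
  qed simp
  define \<gamma>' where "\<gamma>' t = vector_derivative \<gamma> (at t within {0..1})" for t
  have \<gamma>'_eq: "omega N (\<gamma> t) (\<gamma>' t) / 2 = \<kappa> t * h (\<theta> t)" if t: "t \<in> {0..1} - Z" for t
  proof -
    have t': "t \<in> {0..1}" using t by simp
    have "((\<lambda>s. \<Gamma> (\<theta> s)) has_vector_derivative \<kappa> t *\<^sub>R \<Gamma>' (\<theta> t)) (at t within {0..1})"
      using vector_diff_chain_within[OF \<theta>_der[OF t] \<Gamma>_der] by (simp add: o_def)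
    then have "(\<gamma> has_vector_derivative \<kappa> t *\<^sub>R \<Gamma>' (\<theta> t)) (at t within {0..1})"
      by (rule has_vector_derivative_transform[OF t', rotated]) (simp add: \<Gamma>_def \<gamma>\<delta> \<delta>\<theta>[symmetric])
    then have "\<gamma>' t = \<kappa> t *\<^sub>R \<Gamma>' (\<theta> t)"
      unfolding \<gamma>'_def using t' by (intro vector_derivative_within_cbox[of 0 1, simplified]) auto
    moreover have "\<gamma> t = \<Gamma> (\<theta> t)" using t' by (simp add: \<Gamma>_def \<gamma>\<delta> \<delta>\<theta>[symmetric])
    ultimately show ?thesis by (simp add: h_def omega_bilinear)
  qed
  have "((\<lambda>t. omega N (\<gamma> t) (\<gamma>' t) / 2) has_integral P (\<theta> 1) - P (\<theta> 0)) {0..1}"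
  proof (rule abs_continuous_FTC[OF P_ac _ Z])
    fix t assume t: "t \<in> {0..1} - Z"
    have P_t: "(P has_vector_derivative h (\<theta> t)) (at (\<theta> t) within \<theta> ` {0..1})"
      by (rule has_vector_derivative_within_subset[OF P_der[OF \<theta>_range]]) (use t \<theta>_range in auto)
    have "((\<lambda>t. P (\<theta> t)) has_vector_derivative \<kappa> t *\<^sub>R h (\<theta> t)) (at t within {0..1})"
      using vector_diff_chain_within[OF \<theta>_der[OF t] P_t] by (simp add: o_def)
    then show "((\<lambda>t. P (\<theta> t)) has_vector_derivative omega N (\<gamma> t) (\<gamma>' t) / 2) (at t within {0..1})"
      using \<gamma>'_eq[OF t] by simp
  qed simp
  then have "integral {0..1} (\<lambda>t. omega N (\<gamma> t) (\<gamma>' t) / 2) = P (\<theta> 1) - P (\<theta> 0)"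
    by (rule integral_unique)
  moreover have "P (\<theta> 0) = 0" by (simp add: P_def)
  ultimately have "action N \<gamma> = P (\<theta> 1)"
    by (simp only: action_def \<gamma>'_def diff_0_right)
  also have "\<dots> = eucl_inner d (\<delta> 0) (\<delta> 0) * (\<theta> 1 - \<theta> 0) / 2"
    unfolding P_def h_def \<Gamma>_def \<Gamma>'_def
    by (rule action_circle_image[where k = k]) (use centre pos k' Ck_\<phi> in \<open>auto simp del: Ck.simps\<close>)
  also have "\<dots> \<ge> pi * r\<^sup>2"
    using mult_left_mono[OF k1, of "r\<^sup>2"] \<delta>norm[of 0] by (simp add: mult_ac)
  finally show ?thesis .
qed

end

section \<open>Coordinate blocks and gauges\<close>

text \<open>A product puts its factors on consecutive blocks of coordinates: \<open>emb p k\<close> places a vector of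
  \<open>\<real>\<^sup>k\<close> on the block that starts at index \<open>p\<close>, and \<open>proj p k\<close> reads that block off.\<close>

definition emb :: "nat \<Rightarrow> nat \<Rightarrow> rseq \<Rightarrow> rseq"
  where "emb p k x = (\<Sum>i<k. coord x i *\<^sub>R unit_vec (p + i))"

definition proj :: "nat \<Rightarrow> nat \<Rightarrow> rseq \<Rightarrow> rseq"
  where "proj p k z = (\<Sum>i<k. coord z (p + i) *\<^sub>R unit_vec i)"

lemma bounded_linear_emb: "bounded_linear (emb p k)"
  and bounded_linear_proj: "bounded_linear (proj p k)"
  unfolding emb_def proj_def
  by (intro bounded_linear_sum bounded_linear_compose[OF bounded_linear_scaleR_left] bounded_linear_coord)+

lemmas emb_linear = bounded_linear.linear[OF bounded_linear_emb]
lemmas proj_linear = bounded_linear.linear[OF bounded_linear_proj]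
lemmas emb_simps = linear_add[OF emb_linear] linear_diff[OF emb_linear] linear_scale[OF emb_linear]
lemmas proj_simps = linear_add[OF proj_linear] linear_diff[OF proj_linear] linear_scale[OF proj_linear]

lemma emb_0 [simp]: "emb p k 0 = 0" and proj_0 [simp]: "proj p k 0 = 0"
  by (simp_all add: emb_def proj_def)

lemma coord_emb: "coord (emb p k x) i = (if p \<le> i \<and> i < p + k then coord x (i - p) else 0)"
proof -
  have "coord (emb p k x) i = (\<Sum>j<k. if i = p + j then coord x j else 0)"
    by (simp add: emb_def if_distrib cong: if_cong)
  also have "\<dots> = (\<Sum>j<k. if j = i - p then (if p \<le> i then coord x (i - p) else 0) else 0)"
    by (rule sum.cong) auto
  finally show ?thesis by auto
qed

lemma coord_proj: "coord (proj p k z) i = (if i < k then coord z (p + i) else 0)"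
  by (simp add: proj_def if_distrib cong: if_cong)

lemma emb_Rn [intro]: "p + k \<le> d \<Longrightarrow> emb p k x \<in> Rn d"
  by (auto simp: Rn_def coord_emb)

lemma proj_Rn [simp, intro]: "proj p k z \<in> Rn k"
  by (auto simp: Rn_def coord_proj)

lemma proj_emb [simp]: "x \<in> Rn k \<Longrightarrow> proj p k (emb p k x) = x"
  by (rule Rn_eqI[of _ k]) (auto simp: coord_proj coord_emb)

lemma proj_emb_disjoint: "p + k \<le> p' \<or> p' + k' \<le> p \<Longrightarrow> proj p k (emb p' k' x) = 0"
  by (rule Rn_eqI[of _ k]) (auto simp: coord_proj coord_emb)

lemma emb_unit_vec: "i < k \<Longrightarrow> emb p k (unit_vec i) = unit_vec (p + i)"
  by (rule poly_mapping_eqI) (auto simp: coord_emb)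

lemma eucl_inner_emb:
  assumes "p + k \<le> d"
  shows "eucl_inner d (emb p k x) z = eucl_inner k x (proj p k z)"
proof -
  have "eucl_inner d (emb p k x) z = (\<Sum>i<k. coord x i * eucl_inner d (unit_vec (p + i)) z)"
    by (simp add: emb_def eucl_inner_sum_left eucl_inner_scale_left)
  also have "\<dots> = (\<Sum>i<k. coord x i * coord z (p + i))"
    using assms by (intro sum.cong refl) (simp add: eucl_inner_unit_vec)
  finally show ?thesis by (simp add: eucl_inner_def coord_proj)
qed

lemma J_emb:
  assumes "l + k \<le> N"
  shows "J_std N (emb (2*l) (2*k) x) = emb (2*l) (2*k) (J_std k x)"
proof (rule Rn_eqI[of _ "2*N"])
  fix i assume "i < 2*N"
  define j where "j = i div 2"
  have i: "i = 2*j \<or> i = 2*j+1" by (auto simp: j_def)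
  show "coord (J_std N (emb (2*l) (2*k) x)) i = coord (emb (2*l) (2*k) (J_std k x)) i"
  proof (cases "l \<le> j \<and> j < l + k")
    case True
    then obtain m where "j = l + m" "m < k" by (metis le_Suc_ex nat_add_left_cancel_less)
    then show ?thesis using i assms by (auto simp: J_std_def coord_vec_of coord_emb)
  next
    case False
    then have "\<not> (2*l \<le> 2*j \<and> 2*j < 2*l + 2*k)" "\<not> (2*l \<le> 2*j+1 \<and> 2*j+1 < 2*l + 2*k)" by linarith+
    then show ?thesis using i by (auto simp: J_std_def coord_vec_of coord_emb)
  qed
qed (use assms in auto)

lemma proj_J:
  assumes "l + k \<le> N"
  shows "proj (2*l) (2*k) (J_std N z) = J_std k (proj (2*l) (2*k) z)"
proof (rule Rn_eqI[of _ "2*k"])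
  fix i assume i: "i < 2*k"
  show "coord (proj (2*l) (2*k) (J_std N z)) i = coord (J_std k (proj (2*l) (2*k) z)) i"
  proof (cases "even i")
    case True
    then obtain j where "i = 2*j" by blast
    then show ?thesis using assms i
      by (auto simp: J_std_def coord_vec_of coord_proj)
  next
    case False
    then obtain j where j: "i = 2*j+1" using oddE by blast
    then show ?thesis using assms i
      by (auto simp: J_std_def coord_vec_of coord_proj)
  qed
qed auto

lemma omega_emb:
  assumes "l + k \<le> N" "x \<in> Rn (2*k)" "y \<in> Rn (2*k)"
  shows "omega N (emb (2*l) (2*k) x) (emb (2*l) (2*k) y) = omega k x y"
proof -
  have y: "y = J_std k (- J_std k y)"
    using assms(3) J_scale[of k "-1" "J_std k y"] by (simp add: J_J)
  have "omega N (emb (2*l) (2*k) x) (emb (2*l) (2*k) y)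
      = omega N (emb (2*l) (2*k) x) (J_std N (emb (2*l) (2*k) (- J_std k y)))"
    using assms by (subst y) (simp add: J_emb)
  also have "\<dots> = eucl_inner (2*k) x (- J_std k y)"
    using assms by (simp add: omega_J_right eucl_inner_emb)
  also have "\<dots> = omega k x y"
    using y omega_J_right[of k x "- J_std k y"] by simp
  finally show ?thesis .
qed

lemma concat_vec_eq: "concat_vec d e x y = emb 0 d x + emb d e y"
  by (rule poly_mapping_eqI) (auto simp: concat_vec_def coord_vec_of coord_emb)

lemma frontier_Rn_iff:
  assumes "closed X" "X \<subseteq> Rn d"
  shows "x \<in> top_of_set (Rn d) frontier_of X \<longleftrightarrow>
    x \<in> X \<and> \<not> (\<exists>\<epsilon>>0. \<forall>y\<in>Rn d. norm (y - x) < \<epsilon> \<longrightarrow> y \<in> X)"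
proof -
  have "closedin (top_of_set (Rn d)) X"
    using assms by (simp add: closed_subset)
  then have "x \<in> top_of_set (Rn d) frontier_of X \<longleftrightarrow> x \<in> X \<and> x \<notin> top_of_set (Rn d) interior_of X"
    by (simp add: frontier_of_def closure_of_closedin)
  moreover have "x \<in> top_of_set (Rn d) interior_of X \<longleftrightarrow>
      (\<exists>\<epsilon>>0. \<forall>y\<in>Rn d. norm (y - x) < \<epsilon> \<longrightarrow> y \<in> X)" if x: "x \<in> X"
  proof
    assume "x \<in> top_of_set (Rn d) interior_of X"
    then obtain T where "openin (top_of_set (Rn d)) T" "x \<in> T" "T \<subseteq> X"
      by (auto simp: interior_of_def)
    then show "\<exists>\<epsilon>>0. \<forall>y\<in>Rn d. norm (y - x) < \<epsilon> \<longrightarrow> y \<in> X"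
      unfolding openin_euclidean_subtopology_iff by (metis dist_norm subsetD)
  next
    assume "\<exists>\<epsilon>>0. \<forall>y\<in>Rn d. norm (y - x) < \<epsilon> \<longrightarrow> y \<in> X"
    then obtain \<epsilon> where \<epsilon>: "\<epsilon> > 0" "\<And>y. y \<in> Rn d \<Longrightarrow> norm (y - x) < \<epsilon> \<Longrightarrow> y \<in> X" by blast
    have "openin (top_of_set (Rn d)) (Rn d \<inter> ball x \<epsilon>)" by (rule openin_open_Int) simp
    moreover have "Rn d \<inter> ball x \<epsilon> \<subseteq> X" using \<epsilon>(2) by (auto simp: dist_norm norm_minus_commute)
    moreover have "x \<in> Rn d \<inter> ball x \<epsilon>" using x assms \<epsilon>(1) by auto
    ultimately show "x \<in> top_of_set (Rn d) interior_of X" unfolding interior_of_def by blast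
  qed
  ultimately show ?thesis by blast
qed

text \<open>The Minkowski gauge of \<open>Y\<close>.\<close>

definition mink :: "rseq set \<Rightarrow> rseq \<Rightarrow> real"
  where "mink Y y = Inf {s. 0 \<le> s \<and> y \<in> (*\<^sub>R) s ` Y}"

text \<open>That zero is an interior point is expressed by \<open>absorbing\<close>, the form in which the smoothness
  of a product provides it for the factors.\<close>

locale gauge_body =
  fixes d :: nat and Y :: "rseq set"
  assumes sub: "Y \<subseteq> Rn d" and compact: "compact Y" and convex: "convex Y" and zero: "0 \<in> Y"
    and absorbing: "\<And>v. v \<in> Rn d \<Longrightarrow> \<exists>s>0. s *\<^sub>R v \<in> Y"
begin

lemma closed: "closed Y"
  using compact by (rule compact_imp_closed)

lemma bounded: obtains R where "R > 0" "\<And>y. y \<in> Y \<Longrightarrow> norm y \<le> R"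
  using compact_imp_bounded[OF compact] unfolding bounded_pos by blast

lemma scale_mono: "y \<in> (*\<^sub>R) s ` Y \<Longrightarrow> 0 \<le> s \<Longrightarrow> s \<le> s' \<Longrightarrow> y \<in> (*\<^sub>R) s' ` Y"
proof -
  assume y: "y \<in> (*\<^sub>R) s ` Y" and s: "0 \<le> s" "s \<le> s'"
  obtain x where x: "x \<in> Y" "y = s *\<^sub>R x" using y by auto
  show ?thesis
  proof (cases "s' = 0")
    case False
    have "(s / s') *\<^sub>R x + (1 - s / s') *\<^sub>R 0 \<in> Y"
      using s False by (intro convexD[OF convex x(1) zero]) (auto simp: field_simps)
    then have "(s / s') *\<^sub>R x \<in> Y" by simp
    moreover have "y = s' *\<^sub>R ((s / s') *\<^sub>R x)" using x False by simp
    ultimately show ?thesis by blast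
  qed (use s y in auto)
qed

lemma mink_set:
  assumes y: "y \<in> Rn d"
  shows "y \<in> (*\<^sub>R) (mink Y y) ` Y" "0 \<le> mink Y y"
    "\<And>s. 0 \<le> s \<Longrightarrow> y \<in> (*\<^sub>R) s ` Y \<Longrightarrow> mink Y y \<le> s"
proof -
  let ?S = "{s. 0 \<le> s \<and> y \<in> (*\<^sub>R) s ` Y}"
  obtain s where s: "s > 0" "s *\<^sub>R y \<in> Y" using absorbing[OF y] by blast
  have "y = (1/s) *\<^sub>R (s *\<^sub>R y)" using s by simp
  then have "y \<in> (*\<^sub>R) (1/s) ` Y" using s(2) by (rule image_eqI)
  then have ne: "?S \<noteq> {}" using s(1) by (auto intro!: exI[of _ "1/s"])
  have bdd: "bdd_below ?S" by (rule bdd_belowI[of _ 0]) auto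
  show ge: "0 \<le> mink Y y" unfolding mink_def using ne by (intro cInf_greatest) auto
  show "mink Y y \<le> s" if "0 \<le> s" "y \<in> (*\<^sub>R) s ` Y" for s
    unfolding mink_def using that by (intro cInf_lower bdd) auto
  have above: "y \<in> (*\<^sub>R) s ` Y" if lt: "mink Y y < s" for s
  proof -
    obtain s' where "s' \<in> ?S" "s' < s"
      using cInf_lessD[OF ne] lt unfolding mink_def by blast
    then show ?thesis using scale_mono[of y s' s] by auto
  qed
  show "y \<in> (*\<^sub>R) (mink Y y) ` Y"
  proof (cases "mink Y y = 0")
    case True
    obtain R where R: "R > 0" "\<And>y. y \<in> Y \<Longrightarrow> norm y \<le> R" using bounded by blast
    have "norm y \<le> 0 + e" if "e > 0" for e
    proof -
      have "mink Y y < e / R" using True \<open>e > 0\<close> R(1) by simp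
      then obtain x where "x \<in> Y" "y = (e / R) *\<^sub>R x" using above[of "e / R"] by auto
      then show ?thesis using R \<open>e > 0\<close> by (simp add: field_simps)
    qed
    then have "y = 0" using field_le_epsilon[of "norm y" 0] by simp
    then show ?thesis using zero True by auto
  next
    case False
    then have pos: "mink Y y > 0" using ge by simp
    let ?s = "\<lambda>n. mink Y y + 1 / real (Suc n)"
    have "(1 / ?s n) *\<^sub>R y \<in> Y" for n
    proof -
      obtain x where x: "x \<in> Y" "y = ?s n *\<^sub>R x" using above[of "?s n"] by auto
      have "?s n > 0" using pos by (simp add: add_pos_pos)
      then have "(1 / ?s n) *\<^sub>R y = x" by (subst x(2)) simp
      then show ?thesis using x(1) by simp
    qed
    moreover have "(\<lambda>n. (1 / ?s n) *\<^sub>R y) \<longlonglongrightarrow> (1 / (mink Y y + 0)) *\<^sub>R y"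
      by (intro tendsto_intros LIMSEQ_Suc[OF lim_1_over_n]) (use pos in auto)
    ultimately have "(1 / mink Y y) *\<^sub>R y \<in> Y"
      using closed_sequentially[OF closed] by fastforce
    moreover have "y = mink Y y *\<^sub>R ((1 / mink Y y) *\<^sub>R y)" using pos by simp
    ultimately show ?thesis by blast
  qed
qed

lemma mink_le_iff:
  assumes "y \<in> Rn d" "0 \<le> s"
  shows "mink Y y \<le> s \<longleftrightarrow> y \<in> (*\<^sub>R) s ` Y"
  using mink_set[OF assms(1)] scale_mono assms by blast

lemma mink_nonneg [simp]: "y \<in> Rn d \<Longrightarrow> 0 \<le> mink Y y"
  by (rule mink_set)

lemma mink_0 [simp]: "mink Y 0 = 0"
proof (rule antisym)
  show "mink Y 0 \<le> 0" by (subst mink_le_iff) (use zero in auto)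
qed simp

lemma mink_scale_le: "y \<in> Rn d \<Longrightarrow> 0 \<le> c \<Longrightarrow> mink Y (c *\<^sub>R y) \<le> c * mink Y y"
proof -
  assume y: "y \<in> Rn d" and c: "0 \<le> c"
  obtain x where "x \<in> Y" "y = mink Y y *\<^sub>R x" using mink_set(1)[OF y] by auto
  then have "c *\<^sub>R y \<in> (*\<^sub>R) (c * mink Y y) ` Y" by (metis scaleR_scaleR imageI)
  then show ?thesis using y c mink_le_iff[of "c *\<^sub>R y" "c * mink Y y"] by simp
qed

lemma mink_scale: "y \<in> Rn d \<Longrightarrow> 0 \<le> c \<Longrightarrow> mink Y (c *\<^sub>R y) = c * mink Y y"
proof (cases "c = 0")
  case False
  assume y: "y \<in> Rn d" and "0 \<le> c"
  with False have c: "c > 0" by simp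
  have "mink Y ((1/c) *\<^sub>R (c *\<^sub>R y)) \<le> (1/c) * mink Y (c *\<^sub>R y)"
    using y c by (intro mink_scale_le) auto
  then have "c * mink Y y \<le> mink Y (c *\<^sub>R y)" using c by (simp add: field_simps)
  then show ?thesis using mink_scale_le[OF y, of c] c by simp
qed simp

lemma mink_add: "x \<in> Rn d \<Longrightarrow> y \<in> Rn d \<Longrightarrow> mink Y (x + y) \<le> mink Y x + mink Y y"
proof -
  assume x: "x \<in> Rn d" and y: "y \<in> Rn d"
  obtain x' where x': "x' \<in> Y" "x = mink Y x *\<^sub>R x'" using mink_set(1)[OF x] by auto
  obtain y' where y': "y' \<in> Y" "y = mink Y y *\<^sub>R y'" using mink_set(1)[OF y] by auto
  let ?s = "mink Y x + mink Y y"
  show ?thesis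
  proof (cases "?s = 0")
    case True
    then have "mink Y x = 0" "mink Y y = 0" using mink_nonneg[OF x] mink_nonneg[OF y] by linarith+
    then have "x = 0" "y = 0" using x'(2) y'(2) by simp_all
    then show ?thesis by simp
  next
    case False
    then have s: "?s > 0" using mink_nonneg[OF x] mink_nonneg[OF y] by linarith
    have "(mink Y x / ?s) *\<^sub>R x' + (mink Y y / ?s) *\<^sub>R y' \<in> Y"
      using s x y by (intro convexD[OF convex x'(1) y'(1)]) (auto simp: add_divide_distrib[symmetric])
    moreover have "?s *\<^sub>R ((mink Y x / ?s) *\<^sub>R x' + (mink Y y / ?s) *\<^sub>R y') = x + y"
      using s x'(2) y'(2) by (simp add: scaleR_add_right)
    ultimately have "x + y \<in> (*\<^sub>R) ?s ` Y" by (metis imageI)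
    then show ?thesis using x y by (subst mink_le_iff) auto
  qed
qed

lemma mink_lower_bound:
  obtains R where "R > 0" "\<And>y. y \<in> Rn d \<Longrightarrow> norm y \<le> R * mink Y y"
proof -
  obtain R where R: "R > 0" "\<And>y. y \<in> Y \<Longrightarrow> norm y \<le> R" using bounded by blast
  show ?thesis
  proof (rule that[OF R(1)])
    fix y assume y: "y \<in> Rn d"
    obtain x where x: "x \<in> Y" "y = mink Y y *\<^sub>R x" using mink_set(1)[OF y] by auto
    have "norm y = mink Y y * norm x"
      by (subst x(2)) (simp add: y)
    also have "\<dots> \<le> mink Y y * R" using R x y by (intro mult_left_mono) auto
    finally show "norm y \<le> R * mink Y y" by (simp add: mult.commute)
  qed
qed

lemma mink_eq_0_iff: "y \<in> Rn d \<Longrightarrow> mink Y y = 0 \<longleftrightarrow> y = 0"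
  using mink_lower_bound by (metis mink_0 mult_zero_right norm_le_zero_iff)

text \<open>By sublinearity the gauge is controlled by its values at the vectors \<open>\<plusminus> unit_vec i\<close>.\<close>

lemma mink_upper_bound:
  obtains C where "C > 0" "\<And>y. y \<in> Rn d \<Longrightarrow> mink Y y \<le> C * norm y"
proof -
  define C where "C = 1 + (\<Sum>i<d. mink Y (unit_vec i) + mink Y (- unit_vec i))"
  have C: "mink Y (unit_vec i) \<le> C" "mink Y (- unit_vec i) \<le> C" if "i < d" for i
  proof -
    have "mink Y (unit_vec i) + mink Y (- unit_vec i) \<le> (\<Sum>i<d. mink Y (unit_vec i) + mink Y (- unit_vec i))"
      using that by (intro member_le_sum) auto
    moreover have "0 \<le> mink Y (unit_vec i)" "0 \<le> mink Y (- unit_vec i)" using that by auto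
    ultimately show "mink Y (unit_vec i) \<le> C" "mink Y (- unit_vec i) \<le> C" by (auto simp: C_def)
  qed
  have single: "mink Y (t *\<^sub>R unit_vec i) \<le> C * \<bar>t\<bar>" if "i < d" for i t
  proof (cases "0 \<le> t")
    case True
    then show ?thesis using C[OF that] that by (simp add: mink_scale mult.commute[of C] mult_left_mono)
  next
    case False
    then have "mink Y (t *\<^sub>R unit_vec i) = mink Y ((- t) *\<^sub>R (- unit_vec i))" by simp
    also have "\<dots> = - t * mink Y (- unit_vec i)" using False that by (intro mink_scale) auto
    also have "\<dots> \<le> - t * C" using False C[OF that] by (intro mult_left_mono) auto
    finally show ?thesis using False by (simp add: mult.commute)
  qed
  have partial_sums: "mink Y (\<Sum>i<k. coord y i *\<^sub>R unit_vec i) \<le> (\<Sum>i<k. C * \<bar>coord y i\<bar>)" if "k \<le> d" for k y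
    using that
  proof (induction k)
    case (Suc k)
    have "(\<Sum>i<k. coord y i *\<^sub>R unit_vec i) \<in> Rn d"
      using Suc.prems by (intro Rn_sum Rn_scaleR Rn_unit_vec) auto
    then have "mink Y (\<Sum>i<Suc k. coord y i *\<^sub>R unit_vec i)
        \<le> mink Y (\<Sum>i<k. coord y i *\<^sub>R unit_vec i) + mink Y (coord y k *\<^sub>R unit_vec k)"
      using Suc.prems by (simp add: mink_add)
    then show ?case using Suc single[of k "coord y k"] by simp
  qed simp
  show ?thesis
  proof (rule that[of C])
    have "0 \<le> (\<Sum>i<d. mink Y (unit_vec i) + mink Y (- unit_vec i))" by (intro sum_nonneg) auto
    then show "C > 0" by (simp add: C_def)
    fix y assume y: "y \<in> Rn d"
    then show "mink Y y \<le> C * norm y"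
      using partial_sums[of d y] Rn_expansion[OF y] norm_eq_sum_coord[OF y]
      by (simp add: sum_distrib_left)
  qed
qed

lemma mink_lipschitz:
  obtains C where "C > 0" "\<And>x y. x \<in> Rn d \<Longrightarrow> y \<in> Rn d \<Longrightarrow> \<bar>mink Y x - mink Y y\<bar> \<le> C * norm (x - y)"
proof -
  obtain C where C: "C > 0" "\<And>y. y \<in> Rn d \<Longrightarrow> mink Y y \<le> C * norm y" using mink_upper_bound by blast
  have le: "mink Y x - mink Y y \<le> C * norm (x - y)" if "x \<in> Rn d" "y \<in> Rn d" for x y
    using mink_add[of "x - y" y] C(2)[of "x - y"] that by simp
  have "\<bar>mink Y x - mink Y y\<bar> \<le> C * norm (x - y)" if "x \<in> Rn d" "y \<in> Rn d" for x y
    using le[OF that] le[OF that(2,1)] by (auto simp: abs_le_iff norm_minus_commute)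
  then show ?thesis using that C(1) by blast
qed

lemma mink_continuous: "continuous_on (Rn d) (mink Y)"
proof -
  obtain C where C: "C > 0" "\<And>x y. x \<in> Rn d \<Longrightarrow> y \<in> Rn d \<Longrightarrow> \<bar>mink Y x - mink Y y\<bar> \<le> C * norm (x - y)"
    using mink_lipschitz by blast
  have "C-lipschitz_on (Rn d) (mink Y)"
    using C by (intro lipschitz_onI) (auto simp: dist_real_def dist_norm)
  then show ?thesis by (rule lipschitz_on_continuous_on)
qed

end

section \<open>Characteristics on the factors of a smooth product\<close>

text \<open>After subtracting a small linear function every point has larger values on its left, so the
  maximum over an initial interval is attained at the left end.\<close>

lemma nonincreasing_of_left_growth:
  fixes h :: "real \<Rightarrow> real"
  assumes cont: "continuous_on {0..1} h" and \<tau>: "\<tau> \<in> {0..1}"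
    and left: "\<And>t \<epsilon>. \<lbrakk>0 < t; t \<le> 1; 0 < \<epsilon>\<rbrakk> \<Longrightarrow> \<exists>\<delta>>0. \<forall>s\<in>{0..1}. t - \<delta> < s \<longrightarrow> s < t \<longrightarrow> h t - \<epsilon> * (t - s) \<le> h s"
  shows "h \<tau> \<le> h 0"
proof (rule field_le_epsilon)
  fix e :: real assume "e > 0"
  define F where "F t = h t - e * t" for t
  have "continuous_on {0..\<tau>} F"
    unfolding F_def using \<tau> by (intro continuous_intros continuous_on_subset[OF cont]) auto
  then obtain t where t: "t \<in> {0..\<tau>}" "\<And>s. s \<in> {0..\<tau>} \<Longrightarrow> F s \<le> F t"
    using continuous_attains_sup[OF compact_Icc, of 0 \<tau> F] \<tau> by auto
  have "t = 0"
  proof (rule ccontr)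
    assume "t \<noteq> 0"
    then obtain \<delta> where \<delta>: "\<delta> > 0" "\<And>s. \<lbrakk>s \<in> {0..1}; t - \<delta> < s; s < t\<rbrakk> \<Longrightarrow> h t - e / 2 * (t - s) \<le> h s"
      using left[of t "e / 2"] t \<tau> \<open>e > 0\<close> by auto
    define s where "s = max (t / 2) (t - \<delta> / 2)"
    have s: "0 \<le> s" "s < t" "t - \<delta> < s" using t \<open>t \<noteq> 0\<close> \<delta>(1) by (auto simp: s_def)
    then have "h t - e / 2 * (t - s) \<le> h s" using t \<tau> by (intro \<delta>(2)) auto
    then have "F t + e / 2 * (t - s) \<le> F s" by (simp add: F_def field_simps)
    moreover have "0 < e / 2 * (t - s)" using s \<open>e > 0\<close> by simp
    moreover have "F s \<le> F t" using s t by (intro t(2)) auto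
    ultimately show False by linarith
  qed
  then have "F \<tau> \<le> F 0" using t(2)[of \<tau>] \<tau> by simp
  moreover have "e * \<tau> \<le> e" using \<tau> \<open>e > 0\<close> by simp
  ultimately show "h \<tau> \<le> h 0 + e" by (simp add: F_def)
qed

lemma vec_of_eq_sum: "vec_of d f = (\<Sum>i<d. f i *\<^sub>R unit_vec i)"
  by (rule poly_mapping_eqI) (auto simp: coord_vec_of if_distrib cong: if_cong)

lemma continuous_on_vec_of:
  assumes "\<And>i. i < d \<Longrightarrow> continuous_on S (\<lambda>x. f x i)"
  shows "continuous_on S (\<lambda>x. vec_of d (f x))"
  unfolding vec_of_eq_sum by (intro continuous_intros assms) auto

lemma continuous_on_J:
  assumes "continuous_on S f"
  shows "continuous_on S (\<lambda>x. J_std n (f x))"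
  unfolding J_std_def
proof (rule continuous_on_vec_of)
  show "continuous_on S (\<lambda>x. if even i then - coord (f x) (i + 1) else coord (f x) (i - 1))" for i
    by (cases "even i") (auto intro!: continuous_intros assms)
qed

lemma eucl_inner_emb_right:
  assumes "p + k \<le> d"
  shows "eucl_inner d z (emb p k x) = eucl_inner k (proj p k z) x"
  using eucl_inner_emb[OF assms, of x z] by (simp only: eucl_inner_commute)

lemma (in gauge_body) mink_pos: "y \<in> Rn d \<Longrightarrow> y \<noteq> 0 \<Longrightarrow> 0 < mink Y y"
  using mink_eq_0_iff mink_nonneg by (metis less_eq_real_def)

lemma at_within_unit_interval_nontrivial: "t \<in> {0..1} \<Longrightarrow> at t within {0..1::real} \<noteq> bot"
  by (auto simp: trivial_limit_within islimpt_Icc)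

context symplectic_ball_image
begin

lemma grad_continuous: "continuous_on (Rn d) grad"
  unfolding grad_def
proof (rule continuous_on_vec_of)
  fix i assume "i < d"
  then show "continuous_on (Rn d) (\<lambda>z. 2 * eucl_inner d (\<psi> z - a) (partial i \<psi> z))"
    by (intro continuous_intros continuous_on_Ck[OF Ck_\<psi>[of 0]]
        continuous_on_Ck[OF Ck_partial[OF Ck_\<psi>[of "Suc 0"]]]) auto
qed

lemma normal_emb:
  assumes lk: "l + k \<le> N" and proj: "\<And>z. z \<in> body \<Longrightarrow> proj (2*l) (2*k) z \<in> X"
    and \<nu>: "\<And>y. y \<in> X \<Longrightarrow> eucl_inner (2*k) \<nu> (y - proj (2*l) (2*k) z) \<le> 0"
    and y: "y \<in> body"
  shows "eucl_inner d (emb (2*l) (2*k) \<nu>) (y - z) \<le> 0"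
  using \<nu>[OF proj[OF y]] lk by (simp add: eucl_inner_emb proj_simps)

text \<open>A non-zero normal of the factor is a normal of the product at every point over the base point.
  An interior point has no such normal, so the point lies on the boundary, where the normals are
  multiples of the gradient.\<close>

lemma factor_normal:
  assumes lk: "l + k \<le> N" and proj: "\<And>z. z \<in> body \<Longrightarrow> proj (2*l) (2*k) z \<in> X"
    and z: "z \<in> body" and \<nu>: "\<nu> \<in> Rn (2*k)" "\<nu> \<noteq> 0"
    and normal: "\<And>y. y \<in> X \<Longrightarrow> eucl_inner (2*k) \<nu> (y - proj (2*l) (2*k) z) \<le> 0"
  obtains c where "level z = r\<^sup>2" "c > 0" "emb (2*l) (2*k) \<nu> = c *\<^sub>R grad z"
proof -
  let ?\<nu> = "emb (2*l) (2*k) \<nu>"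
  have \<nu>Rn: "?\<nu> \<in> Rn d" using lk by (intro emb_Rn) auto
  have "?\<nu> \<noteq> 0" using \<nu> proj_emb by (metis proj_0)
  then have pos: "eucl_inner d ?\<nu> ?\<nu> > 0" using \<nu>Rn by (rule eucl_inner_pos[rotated])
  have zRn: "z \<in> Rn d" "level z \<le> r\<^sup>2" using z body_iff by auto
  have nz: "eucl_inner d ?\<nu> (y - z) \<le> 0" if "y \<in> body" for y
    using normal_emb[OF lk proj normal that] .
  have lev: "level z = r\<^sup>2"
  proof (rule ccontr)
    assume "level z \<noteq> r\<^sup>2"
    then obtain \<epsilon> where \<epsilon>: "\<epsilon> > 0" "\<And>y. y \<in> Rn d \<Longrightarrow> norm (y - z) < \<epsilon> \<Longrightarrow> y \<in> body"
      using interior_point[of z] zRn by (metis order_le_imp_less_or_eq)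
    define s where "s = \<epsilon> / (2 * (norm ?\<nu> + 1))"
    have s: "s > 0" using \<epsilon>(1) by (simp add: s_def add_nonneg_pos)
    have "s * norm ?\<nu> < \<epsilon>" using \<epsilon>(1) by (simp add: s_def field_simps add_pos_nonneg)
    then have "z + s *\<^sub>R ?\<nu> \<in> body" using s zRn \<nu>Rn by (intro \<epsilon>(2)) auto
    from nz[OF this] show False using s pos by (simp add: eucl_inner_scale_right mult_le_0_iff)
  qed
  obtain c where c: "c \<ge> 0" "?\<nu> = c *\<^sub>R grad z"
    using normal_is_multiple_of_grad[OF zRn(1) lev \<nu>Rn nz] by blast
  have "c \<noteq> 0" using c \<open>?\<nu> \<noteq> 0\<close> by auto
  then show ?thesis using c that[OF lev, of c] by simp
qed

text \<open>Where the first coordinate is maximal on a factor, the first basis vector is a normal of that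
  factor.  Over such a point the product therefore has a normal known explicitly, and smoothness
  turns it into the direction of the gradient.\<close>

lemma factor_extreme_point:
  assumes lk: "l + k \<le> N" and k: "k \<ge> 1" and X: "compact X" "X \<subseteq> Rn (2*k)" "X \<noteq> {}"
    and proj: "\<And>z. z \<in> body \<Longrightarrow> proj (2*l) (2*k) z \<in> X"
  obtains x where "x \<in> X" "\<And>y. y \<in> X \<Longrightarrow> coord y 0 \<le> coord x 0"
    "\<And>z. z \<in> body \<Longrightarrow> proj (2*l) (2*k) z = x \<Longrightarrow> level z = r\<^sup>2 \<and> (\<exists>g>0. grad z = g *\<^sub>R unit_vec (2*l))"
proof -
  have "continuous_on X (\<lambda>x. coord x 0)" by (intro continuous_intros)
  then obtain x where x: "x \<in> X" "\<And>y. y \<in> X \<Longrightarrow> coord y 0 \<le> coord x 0"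
    using continuous_attains_sup[OF X(1,3)] by blast
  define u :: rseq where "u = unit_vec 0"
  have u: "u \<in> Rn (2*k)" "coord u 0 = 1" "\<And>y. eucl_inner (2*k) u y = coord y 0"
    using k Rn_unit_vec[of 0 "2*k"] by (auto simp: u_def eucl_inner_unit_vec simp del: single_one)
  then have u_nz: "u \<noteq> 0" by (metis lookup_zero zero_neq_one)
  have E: "emb (2*l) (2*k) u = unit_vec (2*l)"
    using emb_unit_vec[of 0 "2*k" "2*l"] k by (simp only: u_def add_0_right)
  show ?thesis
  proof (rule that[OF x])
    fix z assume z: "z \<in> body" "proj (2*l) (2*k) z = x"
    obtain c where c: "level z = r\<^sup>2" "c > 0" "emb (2*l) (2*k) u = c *\<^sub>R grad z"
      by (rule factor_normal[OF lk proj z(1) u(1) u_nz]) (use x(2) z(2) u(3) in auto)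
    have "grad z = (1/c) *\<^sub>R unit_vec (2*l)" using c by (simp add: E)
    then show "level z = r\<^sup>2 \<and> (\<exists>g>0. grad z = g *\<^sub>R unit_vec (2*l))" using c by (intro conjI exI[of _ "1/c"]) auto
  qed
qed

text \<open>A generalised closed characteristic of a factor, placed in the product, runs along normals of
  the product: the normals of the factor are normals of the product wherever the point projects to
  the base point.\<close>

lemma factor_characteristic_action_ge:
  assumes lk: "l + k \<le> N" and X: "X \<subseteq> Rn (2*k)" "closed X"
    and proj: "\<And>z. z \<in> body \<Longrightarrow> proj (2*l) (2*k) z \<in> X"
    and emb: "\<And>x. x \<in> X \<Longrightarrow> emb (2*l) (2*k) x \<in> body"
    and \<gamma>: "gen_closed_characteristic k X \<gamma>"
  shows "pi * r\<^sup>2 \<le> action k \<gamma>"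
proof -
  let ?e = "emb (2*l) (2*k)"
  have ac: "abs_continuous_on 0 1 \<gamma>" and closed: "\<gamma> 0 = \<gamma> 1" and nc: "\<not> \<gamma> constant_on {0..1}"
    and fr: "\<And>t. t \<in> {0..1} \<Longrightarrow> \<gamma> t \<in> top_of_set (Rn (2*k)) frontier_of X"
    and ae: "AE t in lebesgue_on {0..1}. \<exists>\<nu>\<in>normal_cone (2*k) X (\<gamma> t).
        (\<gamma> has_vector_derivative J_std k \<nu>) (at t within {0..1})"
    using \<gamma> unfolding gen_closed_characteristic_def by auto
  have \<gamma>X: "\<gamma> t \<in> X" and not_int: "\<not> (\<exists>\<epsilon>>0. \<forall>y\<in>Rn (2*k). norm (y - \<gamma> t) < \<epsilon> \<longrightarrow> y \<in> X)"
    if "t \<in> {0..1}" for t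
    using fr[OF that] frontier_Rn_iff[OF X(2,1)] by auto
  have \<gamma>Rn: "\<gamma> t \<in> Rn (2*k)" if "t \<in> {0..1}" for t using \<gamma>X[OF that] X by auto
  have "AE t in lebesgue. t \<in> {0..1} \<longrightarrow> (\<exists>\<nu>\<in>normal_cone (2*k) X (\<gamma> t).
        (\<gamma> has_vector_derivative J_std k \<nu>) (at t within {0..1}))"
    using ae by (simp add: AE_restrict_space_iff)
  then obtain Z where Z: "Z \<in> null_sets lebesgue" and
    Z_sub: "{t. \<not> (t \<in> {0..1} \<longrightarrow> (\<exists>\<nu>\<in>normal_cone (2*k) X (\<gamma> t).
        (\<gamma> has_vector_derivative J_std k \<nu>) (at t within {0..1})))} \<subseteq> Z"
    unfolding eventually_ae_filter by auto
  have der: "\<And>t. t \<in> {0..1} - Z \<Longrightarrow> \<exists>\<nu>\<in>normal_cone (2*k) X (\<gamma> t).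
        (\<gamma> has_vector_derivative J_std k \<nu>) (at t within {0..1})"
    using Z_sub by blast
  have negl: "negligible Z" using Z negligible_iff_null_sets by blast
  obtain K where K: "\<And>x. norm (?e x) \<le> norm x * K"
    using bounded_linear.bounded[OF bounded_linear_emb] by blast
  define \<Gamma> where "\<Gamma> t = ?e (\<gamma> t)" for t
  have "pi * r\<^sup>2 \<le> action N \<Gamma>"
  proof (rule action_ge_of_normal_curve[OF _ _ _ _ negl])
    show "abs_continuous_on 0 1 \<Gamma>"
      by (rule abs_continuous_on_compare[OF ac, of 1 _ K])
         (use K in \<open>auto simp: \<Gamma>_def emb_simps[symmetric] mult.commute\<close>)
    show "\<Gamma> 0 = \<Gamma> 1" using closed by (simp add: \<Gamma>_def)
    show "\<not> \<Gamma> constant_on {0..1}"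
    proof
      assume "\<Gamma> constant_on {0..1}"
      then obtain c where "\<And>t. t \<in> {0..1} \<Longrightarrow> \<Gamma> t = c" unfolding constant_on_def by blast
      then have "\<gamma> t = proj (2*l) (2*k) c" if "t \<in> {0..1}" for t
        using proj_emb[OF \<gamma>Rn[OF that]] that unfolding \<Gamma>_def by metis
      then have "\<gamma> constant_on {0..1}" unfolding constant_on_def by blast
      then show False using nc by blast
    qed
    show "\<Gamma> t \<in> Rn d \<and> level (\<Gamma> t) = r\<^sup>2" if t: "t \<in> {0..1}" for t
    proof (rule ccontr)
      assume not: "\<not> (\<Gamma> t \<in> Rn d \<and> level (\<Gamma> t) = r\<^sup>2)"
      have "\<Gamma> t \<in> body" using emb[OF \<gamma>X[OF t]] by (simp add: \<Gamma>_def)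
      then have "\<Gamma> t \<in> Rn d" "level (\<Gamma> t) < r\<^sup>2" using not by (auto simp: body_iff)
      then obtain \<epsilon> where \<epsilon>: "\<epsilon> > 0" "\<And>y. y \<in> Rn d \<Longrightarrow> norm (y - \<Gamma> t) < \<epsilon> \<Longrightarrow> y \<in> body"
        using interior_point by blast
      have "y \<in> X" if y: "y \<in> Rn (2*k)" "norm (y - \<gamma> t) < \<epsilon> / (\<bar>K\<bar> + 1)" for y
      proof -
        have "norm (?e y - \<Gamma> t) \<le> norm (y - \<gamma> t) * K"
          using K[of "y - \<gamma> t"] by (simp add: \<Gamma>_def emb_simps)
        also have "\<dots> \<le> norm (y - \<gamma> t) * (\<bar>K\<bar> + 1)" by (intro mult_left_mono) auto
        also have "\<dots> < \<epsilon>" using y(2) by (simp add: pos_less_divide_eq)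
        finally have "?e y \<in> body" using lk by (intro \<epsilon>(2) emb_Rn) auto
        then show "y \<in> X" using proj[of "?e y"] y by simp
      qed
      moreover have "\<epsilon> / (\<bar>K\<bar> + 1) > 0" using \<epsilon>(1) by simp
      ultimately show False using not_int[OF t] by blast
    qed
    fix t assume t: "t \<in> {0..1} - Z"
    then obtain \<nu> where \<nu>: "\<nu> \<in> Rn (2*k)" "\<And>y. y \<in> X \<Longrightarrow> eucl_inner (2*k) \<nu> (y - \<gamma> t) \<le> 0"
      "(\<gamma> has_vector_derivative J_std k \<nu>) (at t within {0..1})"
      using der[OF t] unfolding normal_cone_def by blast
    have "(\<Gamma> has_vector_derivative J_std N (?e \<nu>)) (at t within {0..1})"
      using bounded_linear.has_vector_derivative[OF bounded_linear_emb \<nu>(3), of "2*l" "2*k"] J_emb[OF lk]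
      by (simp add: \<Gamma>_def[abs_def])
    moreover have "eucl_inner d (?e \<nu>) (y - \<Gamma> t) \<le> 0" if "y \<in> body" for y
      using normal_emb[OF lk proj _ that, of \<nu> "\<Gamma> t"] \<nu>(2) \<gamma>Rn[of t] t by (simp add: \<Gamma>_def)
    moreover have "?e \<nu> \<in> Rn d" using lk by (intro emb_Rn) auto
    ultimately show "\<exists>\<nu>\<in>Rn d. (\<forall>y\<in>body. eucl_inner d \<nu> (y - \<Gamma> t) \<le> 0) \<and>
        (\<Gamma> has_vector_derivative J_std N \<nu>) (at t within {0..1})" by blast
  qed
  also have "action N \<Gamma> = action k \<gamma>"
    unfolding action_def
  proof (rule integral_spike[OF negl])
    fix t assume t: "t \<in> {0..1} - Z"
    then obtain \<nu> where \<nu>: "\<nu> \<in> Rn (2*k)" "(\<gamma> has_vector_derivative J_std k \<nu>) (at t within {0..1})"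
      using der[OF t] unfolding normal_cone_def by blast
    then have "(\<Gamma> has_vector_derivative ?e (J_std k \<nu>)) (at t within {0..1})"
      using bounded_linear.has_vector_derivative[OF bounded_linear_emb \<nu>(2)] by (simp add: \<Gamma>_def[abs_def])
    then have 1: "vector_derivative \<Gamma> (at t within {0..1}) = ?e (J_std k \<nu>)"
      using t by (intro vector_derivative_within_cbox[of 0 1, simplified]) auto
    have 2: "vector_derivative \<gamma> (at t within {0..1}) = J_std k \<nu>"
      using t \<nu>(2) by (intro vector_derivative_within_cbox[of 0 1, simplified]) auto
    show "omega k (\<gamma> t) (vector_derivative \<gamma> (at t within {0..1})) / 2 =
        omega N (\<Gamma> t) (vector_derivative \<Gamma> (at t within {0..1})) / 2"
      unfolding 1 2 \<Gamma>_def using omega_emb[OF lk] \<gamma>Rn t by simp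
  qed
  finally show ?thesis .
qed

lemma stays_in_body_imp_grad_nonpos:
  assumes z: "z \<in> Rn d" "level z = r\<^sup>2" and v: "v \<in> Rn d"
    and stays: "\<And>s. s \<in> {0..1} \<Longrightarrow> z + s *\<^sub>R v \<in> body"
  shows "eucl_inner d (grad z) v \<le> 0"
proof (rule ccontr)
  assume "\<not> eucl_inner d (grad z) v \<le> 0"
  then have pos: "0 < eucl_inner d (grad (z + 0 *\<^sub>R v)) v" by simp
  have "((\<lambda>s. level (z + s *\<^sub>R v)) has_real_derivative eucl_inner d (grad (z + 0 *\<^sub>R v)) v) (at 0)"
    by (rule level_has_derivative[OF line_has_vector_derivative]) (use z v in auto)
  from DERIV_pos_inc_right[OF this pos]
  obtain e where e: "e > 0" "\<forall>s>0. s < e \<longrightarrow> level (z + 0 *\<^sub>R v) < level (z + (0 + s) *\<^sub>R v)"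
    by auto
  define s where "s = min (e/2) 1"
  have "0 < s" "s < e" using e(1) by (auto simp: s_def)
  then have "level z < level (z + s *\<^sub>R v)" using e(2) by simp
  then show False using stays[of s] e(1) z by (auto simp: body_iff s_def)
qed

text \<open>Smoothness keeps zero off the boundary of the factors.  Where the first coordinate of one factor
  is maximal, the only normal direction of the product has no component in the other factor, so
  every direction of the other factor enters the product once it is tilted inwards; projecting
  gives a small multiple of that direction inside the other factor.\<close>

lemma complementary_factor_absorbing:
  assumes lk: "l + k \<le> N" "l' + k' \<le> N" and disj: "l + k \<le> l' \<or> l' + k' \<le> l" and k: "k \<ge> 1"
    and X: "compact X" "X \<subseteq> Rn (2*k)" "X \<noteq> {}"
    and proj: "\<And>z. z \<in> body \<Longrightarrow> proj (2*l) (2*k) z \<in> X"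
    and proj': "\<And>z. z \<in> body \<Longrightarrow> proj (2*l') (2*k') z \<in> Y"
    and emb: "\<And>x. x \<in> X \<Longrightarrow> emb (2*l) (2*k) x \<in> body"
    and v: "v \<in> Rn (2*k')"
  shows "\<exists>s>0. s *\<^sub>R v \<in> Y"
proof -
  obtain x where x: "x \<in> X"
    and ext: "\<And>z. z \<in> body \<Longrightarrow> proj (2*l) (2*k) z = x \<Longrightarrow> level z = r\<^sup>2 \<and> (\<exists>g>0. grad z = g *\<^sub>R unit_vec (2*l))"
    using factor_extreme_point[OF lk(1) k X proj] by metis
  let ?z = "emb (2*l) (2*k) x"
  let ?v = "emb (2*l') (2*k') v - unit_vec (2*l)"
  have z: "?z \<in> body" by (rule emb[OF x])
  have ld: "2*l < d" using lk k by simp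
  have vRn: "?v \<in> Rn d" using lk ld by (intro Rn_diff emb_Rn) auto
  have P: "proj (2*l') (2*k') (emb (2*l) (2*k) y) = 0" for y
    using disj by (auto intro!: proj_emb_disjoint)
  have P': "proj (2*l') (2*k') (unit_vec (2*l)) = 0"
    using disj k by (intro Rn_eqI[of _ "2*k'"]) (auto simp: coord_proj)
  have px: "proj (2*l) (2*k) ?z = x" using x X(2) by (intro proj_emb) auto
  obtain g where g: "g > 0" "grad ?z = g *\<^sub>R unit_vec (2*l)"
    using ext[OF z px] by blast
  have "eucl_inner d (grad ?z) ?v = - g"
    using disj k ld by (auto simp: g(2) eucl_inner_scale_left eucl_inner_unit_vec coord_emb)
  then have "eucl_inner d (grad ?z) ?v < 0" using g(1) by simp
  then obtain s\<^sub>0 :: real where s0: "s\<^sub>0 > 0" "\<And>s. 0 < s \<Longrightarrow> s < s\<^sub>0 \<Longrightarrow> ?z + s *\<^sub>R ?v \<in> body"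
    using enters_body[OF _ _ vRn, of ?z] z by (auto simp: body_iff)
  have "proj (2*l') (2*k') (?z + (s\<^sub>0/2) *\<^sub>R ?v) = (s\<^sub>0/2) *\<^sub>R v"
    using v by (simp add: proj_simps P P')
  moreover have "proj (2*l') (2*k') (?z + (s\<^sub>0/2) *\<^sub>R ?v) \<in> Y"
    using s0 by (intro proj' s0(2)) auto
  ultimately show ?thesis using s0(1) by (intro exI[of _ "s\<^sub>0/2"]) auto
qed

text \<open>The Hopf orbit of the product through a boundary point of one factor stays in that factor,
  and is the characteristic sought.  Let \<open>h\<close> be the gauge of the other component along the orbit.
  The normal of the product restricts to a normal of a sublevel set of the gauge, so the gauge lies
  above a supporting linear function with that normal; the velocity of the component is the image
  of the same normal under \<open>J\<close>, hence orthogonal to it, and the linear function is stationary to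
  first order.  So \<open>h s \<ge> h t - o(t - s)\<close> at earlier times \<open>s\<close>, which makes \<open>h\<close> non-increasing, and
  it vanishes at the start.\<close>

lemma factor_has_characteristic:
  assumes lk: "l + k \<le> N" "l' + k' \<le> N" and disj: "l + k \<le> l' \<or> l' + k' \<le> l" and k: "k \<ge> 1"
    and split: "\<And>z. z \<in> Rn d \<Longrightarrow> emb (2*l) (2*k) (proj (2*l) (2*k) z) + emb (2*l') (2*k') (proj (2*l') (2*k') z) = z"
    and X: "compact X" "convex X" "X \<subseteq> Rn (2*k)" "X \<noteq> {}"
    and proj: "\<And>z. z \<in> body \<Longrightarrow> proj (2*l) (2*k) z \<in> X"
    and emb: "\<And>x. x \<in> X \<Longrightarrow> emb (2*l) (2*k) x \<in> body"
    and Y: "gauge_body (2*k') Y"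
    and mono: "\<And>z y. \<lbrakk>z \<in> body; y \<in> Rn (2*k'); mink Y y \<le> mink Y (proj (2*l') (2*k') z)\<rbrakk>
        \<Longrightarrow> emb (2*l) (2*k) (proj (2*l) (2*k) z) + emb (2*l') (2*k') y \<in> body"
  shows "\<exists>\<gamma>. gen_closed_characteristic k X \<gamma>"
proof -
  interpret Y: gauge_body "2*k'" Y by (rule Y)
  let ?E = "emb (2*l) (2*k)" and ?P = "proj (2*l) (2*k)"
  let ?E' = "emb (2*l') (2*k')" and ?P' = "proj (2*l') (2*k')"
  have ERn [simp]: "?E x \<in> Rn d" "?E' x \<in> Rn d" for x using lk by (auto intro!: emb_Rn)
  have P'E: "?P' (?E x) = 0" for x using disj by (auto intro!: proj_emb_disjoint)
  obtain x\<^sub>0 where x0: "x\<^sub>0 \<in> X"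
    and ext: "\<And>z. z \<in> body \<Longrightarrow> proj (2*l) (2*k) z = x\<^sub>0 \<Longrightarrow> level z = r\<^sup>2 \<and> (\<exists>g>0. grad z = g *\<^sub>R unit_vec (2*l))"
    using factor_extreme_point[OF lk(1) k X(1,3,4) proj] by metis
  define z\<^sub>0 where "z\<^sub>0 = ?E x\<^sub>0"
  have z0: "z\<^sub>0 \<in> body" "z\<^sub>0 \<in> Rn d" using emb[OF x0] by (auto simp: z\<^sub>0_def)
  have lev0: "level z\<^sub>0 = r\<^sup>2" using ext[OF z0(1)] x0 X(3) by (auto simp: z\<^sub>0_def)
  define w where "w = \<psi> z\<^sub>0 - a"
  have w: "w \<in> Rn d" "eucl_inner d w w = r\<^sup>2" using z0 centre lev0 by (auto simp: w_def level_def)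
  define \<gamma> where "\<gamma> t = \<phi> (a + circle N w (2 * pi * t))" for t
  have \<gamma>Rn [simp]: "\<gamma> t \<in> Rn d" for t using w centre by (auto simp: \<gamma>_def)
  have \<gamma>lev: "level (\<gamma> t) = r\<^sup>2" for t using w centre by (simp add: level_def \<gamma>_def circle_norm)
  have \<gamma>body: "\<gamma> t \<in> body" for t by (simp add: body_iff \<gamma>lev)
  have \<gamma>0: "\<gamma> 0 = z\<^sub>0" using z0 by (simp add: \<gamma>_def w_def)
  have \<gamma>1: "\<gamma> 1 = \<gamma> 0" using circle_periodic[of N w 0 1] by (simp add: \<gamma>_def)
  define g where "g t = grad (\<gamma> t)" for t
  have gRn [simp]: "g t \<in> Rn d" for t by (simp add: g_def)
  have \<gamma>der: "(\<gamma> has_vector_derivative J_std N (pi *\<^sub>R g t)) (at t within S)" for t S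
    unfolding \<gamma>_def[abs_def] g_def by (rule hopf_orbit_derivative[OF w(1)])
  define x where "x t = ?P (\<gamma> t)" for t
  define y where "y t = ?P' (\<gamma> t)" for t
  define \<mu> where "\<mu> t = ?P (g t)" for t
  define \<nu> where "\<nu> t = ?P' (g t)" for t
  have Rns [simp]: "x t \<in> Rn (2*k)" "y t \<in> Rn (2*k')" "\<mu> t \<in> Rn (2*k)" "\<nu> t \<in> Rn (2*k')" for t
    by (auto simp: x_def y_def \<mu>_def \<nu>_def)
  have \<gamma>_split: "\<gamma> t = ?E (x t) + ?E' (y t)" for t using split[of "\<gamma> t"] by (simp add: x_def y_def)
  have xder: "(x has_vector_derivative J_std k (pi *\<^sub>R \<mu> t)) (at t within S)" for t S
  proof -
    have "(x has_vector_derivative ?P (J_std N (pi *\<^sub>R g t))) (at t within S)"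
      unfolding x_def[abs_def] by (rule bounded_linear.has_vector_derivative[OF bounded_linear_proj \<gamma>der])
    then show ?thesis by (simp add: proj_J[OF lk(1)] proj_simps \<mu>_def)
  qed
  have yder: "(y has_vector_derivative J_std k' (pi *\<^sub>R \<nu> t)) (at t within S)" for t S
  proof -
    have "(y has_vector_derivative ?P' (J_std N (pi *\<^sub>R g t))) (at t within S)"
      unfolding y_def[abs_def] by (rule bounded_linear.has_vector_derivative[OF bounded_linear_proj \<gamma>der])
    then show ?thesis by (simp add: proj_J[OF lk(2)] proj_simps \<nu>_def)
  qed
  define h where "h t = mink Y (y t)" for t
  have h_nonneg: "0 \<le> h t" for t by (simp add: h_def)
  have y0: "y 0 = 0" by (simp add: y_def \<gamma>0 z\<^sub>0_def P'E)

  have sublevel_normal: "eucl_inner (2*k') (\<nu> t) (v - y t) \<le> 0"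
    if v: "v \<in> Rn (2*k')" "mink Y v \<le> h t" for v t
  proof -
    have "eucl_inner d (grad (\<gamma> t)) (?E' (v - y t)) \<le> 0"
    proof (rule stays_in_body_imp_grad_nonpos)
      fix s :: real assume s: "s \<in> {0..1}"
      have "y t + s *\<^sub>R (v - y t) = (1 - s) *\<^sub>R y t + s *\<^sub>R v" by (simp add: algebra_simps)
      also have "mink Y \<dots> \<le> (1 - s) * h t + s * mink Y v"
        using s v Y.mink_add[of "(1 - s) *\<^sub>R y t" "s *\<^sub>R v"]
        by (simp add: Y.mink_scale h_def)
      also have "\<dots> \<le> (1 - s) * h t + s * h t"
        using s v by (intro add_left_mono mult_left_mono) auto
      also have "\<dots> = h t" by (simp add: algebra_simps)
      finally have "mink Y (y t + s *\<^sub>R (v - y t)) \<le> mink Y (?P' (\<gamma> t))"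
        by (simp add: h_def y_def)
      then have "?E (?P (\<gamma> t)) + ?E' (y t + s *\<^sub>R (v - y t)) \<in> body"
        using v by (intro mono[OF \<gamma>body]) auto
      moreover have "?E (?P (\<gamma> t)) + ?E' (y t + s *\<^sub>R (v - y t)) = \<gamma> t + s *\<^sub>R ?E' (v - y t)"
      proof -
        have "?E (?P (\<gamma> t)) + ?E' (y t + s *\<^sub>R (v - y t)) = (?E (x t) + ?E' (y t)) + s *\<^sub>R ?E' (v - y t)"
          by (simp add: x_def[symmetric] emb_simps add.assoc)
        then show ?thesis by (simp only: \<gamma>_split[of t])
      qed
      ultimately show "\<gamma> t + s *\<^sub>R ?E' (v - y t) \<in> body" by simp
    qed (simp_all add: \<gamma>lev)
    then show ?thesis
      using lk by (simp add: eucl_inner_emb_right \<nu>_def g_def)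
  qed

  have h_le: "h \<tau> \<le> h 0" if \<tau>: "\<tau> \<in> {0..1}" for \<tau>
  proof (rule nonincreasing_of_left_growth[OF _ \<tau>])
    show "continuous_on {0..1} h"
      unfolding h_def
      by (rule continuous_on_compose2[OF Y.mink_continuous]) (auto intro!: continuous_on_vector_derivative yder)
    fix t \<epsilon> :: real assume t: "0 < t" "t \<le> 1" and "0 < \<epsilon>"
    show "\<exists>\<delta>>0. \<forall>s\<in>{0..1}. t - \<delta> < s \<longrightarrow> s < t \<longrightarrow> h t - \<epsilon> * (t - s) \<le> h s"
    proof (cases "h t = 0 \<or> \<nu> t \<noteq> 0")
      case True
      (* The supporting linear function of the gauge at y t; where the gauge vanishes, zero will do. *)
      obtain A where A: "\<And>v. v \<in> Rn (2*k') \<Longrightarrow> h t + A * eucl_inner (2*k') (\<nu> t) (v - y t) \<le> mink Y v"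
      proof (cases "h t = 0")
        case True
        show ?thesis by (rule that[of 0]) (use True in auto)
      next
        case False
        then have ht: "h t > 0" using h_nonneg[of t] by simp
        have \<nu>t: "\<nu> t \<noteq> 0" using False True by blast
        define m where "m = eucl_inner (2*k') (\<nu> t) (y t)"
        have "m > 0"
        proof -
          have pos: "mink Y (\<nu> t) > 0" using \<nu>t by (intro Y.mink_pos) auto
          let ?c = "h t / mink Y (\<nu> t)"
          have "eucl_inner (2*k') (\<nu> t) (?c *\<^sub>R \<nu> t - y t) \<le> 0"
            using pos ht by (intro sublevel_normal) (auto simp: Y.mink_scale)
          then have "?c * eucl_inner (2*k') (\<nu> t) (\<nu> t) \<le> m"
            by (simp add: m_def eucl_inner_bilinear)
          moreover have "0 < ?c * eucl_inner (2*k') (\<nu> t) (\<nu> t)"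
            using pos ht \<nu>t by (intro mult_pos_pos eucl_inner_pos) auto
          ultimately show ?thesis by linarith
        qed
        show ?thesis
        proof (rule that[of "h t / m"])
          fix v assume v: "v \<in> Rn (2*k')"
          have "h t * eucl_inner (2*k') (\<nu> t) v \<le> m * mink Y v"
          proof (cases "v = 0")
            case False
            then have pos: "mink Y v > 0" using v by (intro Y.mink_pos)
            have "eucl_inner (2*k') (\<nu> t) ((h t / mink Y v) *\<^sub>R v - y t) \<le> 0"
              using pos ht v by (intro sublevel_normal) (auto simp: Y.mink_scale)
            then show ?thesis using pos by (simp add: m_def eucl_inner_bilinear field_simps)
          qed simp
          moreover have "h t + h t / m * eucl_inner (2*k') (\<nu> t) (v - y t) = h t * eucl_inner (2*k') (\<nu> t) v / m"
          proof -
            have "h t + h t / m * (I - m) = h t * I / m" for I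
              using \<open>m > 0\<close> by (simp add: field_simps)
            then show ?thesis by (simp only: eucl_inner_diff_right m_def[symmetric])
          qed
          ultimately show "h t + h t / m * eucl_inner (2*k') (\<nu> t) (v - y t) \<le> mink Y v"
            using \<open>m > 0\<close> by (simp add: pos_divide_le_eq mult.commute)
        qed
      qed
      define G where "G s = A * eucl_inner (2*k') (\<nu> t) (y s - y t)" for s
      have "((\<lambda>s. eucl_inner (2*k') (\<nu> t) (y s)) has_real_derivative eucl_inner (2*k') (\<nu> t) (J_std k' (pi *\<^sub>R \<nu> t))) (at t within {0..1})"
        unfolding eucl_inner_def
        by (intro DERIV_sum DERIV_cmult)
           (auto simp: has_real_derivative_iff_has_vector_derivative intro!: coord_has_vector_derivative yder)
      then have "((\<lambda>s. eucl_inner (2*k') (\<nu> t) (y s)) has_real_derivative 0) (at t within {0..1})"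
        by (simp add: J_scale eucl_inner_bilinear)
      then have "(G has_real_derivative 0) (at t within {0..1})"
        unfolding G_def[abs_def] eucl_inner_diff_right by (auto intro!: derivative_eq_intros)
      then obtain \<delta> where \<delta>: "\<delta> > 0" "\<And>s. s \<in> {0..1} \<Longrightarrow> norm (s - t) < \<delta> \<Longrightarrow> norm (G s - G t - 0 * (s - t)) \<le> \<epsilon> * norm (s - t)"
        using \<open>0 < \<epsilon>\<close> unfolding has_field_derivative_def has_derivative_within_alt by blast
      have "h t - \<epsilon> * (t - s) \<le> h s" if s: "s \<in> {0..1}" "t - \<delta> < s" "s < t" for s
      proof -
        have "h t + G s \<le> h s" using A[of "y s"] by (simp add: G_def h_def)
        moreover have "\<bar>G s\<bar> \<le> \<epsilon> * (t - s)" using \<delta>(2)[of s] s by (simp add: G_def)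
        ultimately show ?thesis by linarith
      qed
      then show ?thesis using \<delta>(1) by blast
    next
      case False
      (* Here \<nu> t = 0, so y is stationary at t, and the gauge is Lipschitz. *)
      obtain C where C: "C > 0" "\<And>u v. u \<in> Rn (2*k') \<Longrightarrow> v \<in> Rn (2*k') \<Longrightarrow> \<bar>mink Y u - mink Y v\<bar> \<le> C * norm (u - v)"
        using Y.mink_lipschitz by blast
      have "(y has_vector_derivative 0) (at t within {0..1})" using yder[of t "{0..1}"] False by simp
      moreover have "\<epsilon> / C > 0" using C(1) \<open>0 < \<epsilon>\<close> by simp
      ultimately obtain \<delta> where \<delta>: "\<delta> > 0" "\<And>s. s \<in> {0..1} \<Longrightarrow> norm (s - t) < \<delta> \<Longrightarrow> norm (y s - y t - (s - t) *\<^sub>R 0) \<le> \<epsilon> / C * norm (s - t)"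
        unfolding has_vector_derivative_def has_derivative_within_alt by blast
      have "h t - \<epsilon> * (t - s) \<le> h s" if s: "s \<in> {0..1}" "t - \<delta> < s" "s < t" for s
      proof -
        have "\<bar>h s - h t\<bar> \<le> C * norm (y s - y t)" unfolding h_def by (intro C(2)) auto
        also have "\<dots> \<le> C * (\<epsilon> / C * (t - s))" using \<delta>(2)[of s] s C(1) by (intro mult_left_mono) auto
        also have "\<dots> = \<epsilon> * (t - s)" using C(1) by simp
        finally show ?thesis by linarith
      qed
      then show ?thesis using \<delta>(1) by blast
    qed
  qed
  have y_zero: "y t = 0" if "t \<in> {0..1}" for t
  proof -
    have "h 0 = 0" by (simp add: h_def y0)
    then have "h t = 0" using h_le[OF that] h_nonneg[of t] by simp
    then show ?thesis using Y.mink_eq_0_iff[of "y t"] by (simp add: h_def)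
  qed
  have J_inj: "v = 0" if "v \<in> Rn (2*n)" "J_std n v = 0" for v n
    using J_J[OF that(1)] that(2) by simp
  have \<nu>_zero: "\<nu> t = 0" if t: "t \<in> {0..1}" for t
  proof -
    have der0: "(y has_vector_derivative 0) (at t within {0..1})"
      by (rule has_vector_derivative_transform[OF t _ has_vector_derivative_const[of 0]]) (use y_zero in auto)
    have "J_std k' (pi *\<^sub>R \<nu> t) = 0"
      by (rule vector_derivative_unique_within[OF at_within_unit_interval_nontrivial[OF t] yder der0])
    from J_inj[OF _ this] have "pi *\<^sub>R \<nu> t = 0" by simp
    then show ?thesis by simp
  qed
  have \<mu>_nz: "\<mu> t \<noteq> 0" if "t \<in> {0..1}" for t
  proof
    assume "\<mu> t = 0"
    moreover have "?E (\<mu> t) + ?E' (\<nu> t) = g t" using split[of "g t"] by (simp add: \<mu>_def \<nu>_def)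
    ultimately have "g t = 0" using \<nu>_zero[OF that] by simp
    then show False using grad_nonzero[OF \<gamma>Rn \<gamma>lev, of t] by (simp add: g_def)
  qed
  have \<gamma>E: "\<gamma> t = ?E (x t)" if "t \<in> {0..1}" for t using \<gamma>_split[of t] y_zero[OF that] by simp
  have xX: "x t \<in> X" for t using proj[OF \<gamma>body] by (simp add: x_def)
  have normal: "eucl_inner (2*k) (\<mu> t) (v - x t) \<le> 0" if t: "t \<in> {0..1}" and v: "v \<in> X" for t v
  proof -
    have "eucl_inner d (grad (\<gamma> t)) (?E (v - x t)) \<le> 0"
    proof (rule stays_in_body_imp_grad_nonpos)
      fix s :: real assume s: "s \<in> {0..1}"
      have "(1 - s) *\<^sub>R x t + s *\<^sub>R v \<in> X" using s v xX by (intro convexD[OF X(2)]) auto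
      then have "?E ((1 - s) *\<^sub>R x t + s *\<^sub>R v) \<in> body" by (rule emb)
      then show "\<gamma> t + s *\<^sub>R ?E (v - x t) \<in> body"
        using \<gamma>E[OF t] by (simp add: emb_simps algebra_simps)
    qed (simp_all add: \<gamma>lev)
    then show ?thesis
      using lk by (simp add: eucl_inner_emb_right \<mu>_def g_def)
  qed
  have "gen_closed_characteristic k X x"
    unfolding gen_closed_characteristic_def
  proof (intro conjI)
    have \<gamma>_cont: "continuous_on UNIV \<gamma>" by (rule continuous_on_vector_derivative[OF \<gamma>der])
    have "continuous_on UNIV (\<lambda>t. J_std k (pi *\<^sub>R \<mu> t))"
      unfolding \<mu>_def g_def
      by (intro continuous_on_J continuous_intros bounded_linear.continuous_on[OF bounded_linear_proj]
          continuous_on_compose2[OF grad_continuous \<gamma>_cont])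
         auto
    then have "continuous_on {0..1} (\<lambda>t. J_std k (pi *\<^sub>R \<mu> t))" by (rule continuous_on_subset) simp
    then obtain M where M: "M > 0" "\<And>t. t \<in> {0..1} \<Longrightarrow> norm (J_std k (pi *\<^sub>R \<mu> t)) \<le> M"
      using norm_bound_on_Icc by blast
    show "abs_continuous_on 0 1 x"
    proof (rule lipschitz_imp_abs_continuous)
      fix s t :: real assume st: "0 \<le> s" "s \<le> t" "t \<le> 1"
      have "norm (x t - x s) \<le> M * norm (t - s)"
      proof (rule differentiable_bound[of "{0..1}" x "\<lambda>t u. u *\<^sub>R J_std k (pi *\<^sub>R \<mu> t)"])
        show "(x has_derivative (\<lambda>u. u *\<^sub>R J_std k (pi *\<^sub>R \<mu> t))) (at t within {0..1})" for t
          using xder by (simp add: has_vector_derivative_def)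
        show "onorm (\<lambda>u. u *\<^sub>R J_std k (pi *\<^sub>R \<mu> t)) \<le> M" if "t \<in> {0..1}" for t
          using M(2)[OF that] by (intro onorm_le) (simp add: mult.commute[of M] mult_left_mono)
      qed (use st in auto)
      then show "norm (x t - x s) \<le> M * (t - s)" using st by simp
    qed
    show "x 0 = x 1" by (simp add: x_def \<gamma>1)
    show "\<not> x constant_on {0..1}"
    proof
      assume "x constant_on {0..1}"
      then obtain c where c: "\<And>t. t \<in> {0..1} \<Longrightarrow> x t = c" unfolding constant_on_def by blast
      have der0: "(x has_vector_derivative 0) (at 0 within {0..1})"
        by (rule has_vector_derivative_transform[OF _ _ has_vector_derivative_const[of c]]) (use c in auto)
      have "J_std k (pi *\<^sub>R \<mu> 0) = 0"
        by (rule vector_derivative_unique_within[OF at_within_unit_interval_nontrivial xder der0]) simp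
      from J_inj[OF _ this] have "pi *\<^sub>R \<mu> 0 = 0" by simp
      then show False using \<mu>_nz[of 0] by simp
    qed
    show "x ` {0..1} \<subseteq> top_of_set (Rn (2 * k)) frontier_of X"
    proof (intro image_subsetI)
      fix t :: real assume t: "t \<in> {0..1}"
      have "False" if \<epsilon>: "\<epsilon> > 0" "\<forall>v\<in>Rn (2*k). norm (v - x t) < \<epsilon> \<longrightarrow> v \<in> X" for \<epsilon>
      proof -
        define s where "s = \<epsilon> / (2 * (norm (\<mu> t) + 1))"
        have s: "s > 0" using \<epsilon>(1) by (simp add: s_def add_nonneg_pos)
        have "s * norm (\<mu> t) < \<epsilon>" using \<epsilon>(1) by (simp add: s_def field_simps add_pos_nonneg)
        then have "x t + s *\<^sub>R \<mu> t \<in> X" using s \<epsilon>(2) by auto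
        from normal[OF t this] have "s * eucl_inner (2*k) (\<mu> t) (\<mu> t) \<le> 0"
          by (simp add: eucl_inner_scale_right)
        moreover have "eucl_inner (2*k) (\<mu> t) (\<mu> t) > 0" using \<mu>_nz[OF t] by (intro eucl_inner_pos) auto
        ultimately show False using s by (simp add: mult_le_0_iff)
      qed
      then show "x t \<in> top_of_set (Rn (2 * k)) frontier_of X"
        using frontier_Rn_iff[OF compact_imp_closed[OF X(1)] X(3)] xX by blast
    qed
    show "AE t in lebesgue_on {0..1}. \<exists>\<nu>\<in>normal_cone (2 * k) X (x t). (x has_vector_derivative J_std k \<nu>) (at t within {0..1})"
    proof (rule AE_I2)
      fix t :: real assume "t \<in> space (lebesgue_on {0..1})"
      then have t: "t \<in> {0..1}" by simp
      have "pi *\<^sub>R \<mu> t \<in> normal_cone (2 * k) X (x t)"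
        using normal[OF t] by (auto simp: normal_cone_def eucl_inner_scale_left mult_le_0_iff)
      then show "\<exists>\<nu>\<in>normal_cone (2 * k) X (x t). (x has_vector_derivative J_std k \<nu>) (at t within {0..1})"
        using xder by blast
    qed
  qed
  then show ?thesis by blast
qed

end

section \<open>Second-order contact at the boundary\<close>

context symplectic_ball_image
begin

text \<open>Second-order contact: the function \<open>level\<close> is twice differentiable, so along a tangential
  coordinate direction \<open>unit_vec i\<close> it exceeds its boundary value at most quadratically, and a
  quadratically small shift against the gradient direction \<open>unit_vec j\<close> returns to the body.\<close>

lemma interior_parabola:
  assumes z: "z \<in> Rn d" "level z = r\<^sup>2" and ij: "i < d" "j < d" "i \<noteq> j"
    and g: "g > 0" "grad z = g *\<^sub>R unit_vec j"
  obtains C \<tau>\<^sub>0 where "C > 0" "\<tau>\<^sub>0 > 0"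
    "\<And>\<tau>. 0 < \<tau> \<Longrightarrow> \<tau> < \<tau>\<^sub>0 \<Longrightarrow> z + \<tau> *\<^sub>R unit_vec i - (C * \<tau>\<^sup>2) *\<^sub>R unit_vec j \<in> body"
proof -
  define F where "F \<tau> = eucl_inner d (grad (z + \<tau> *\<^sub>R unit_vec i)) (unit_vec i)" for \<tau>
  have zRn [simp]: "z + \<tau> *\<^sub>R unit_vec i \<in> Rn d" for \<tau> using z ij by auto
  have F_eq: "F \<tau> = (\<Sum>k<d. 2 * ((coord (\<psi> (z + \<tau> *\<^sub>R unit_vec i)) k - coord a k) * coord (partial i \<psi> (z + \<tau> *\<^sub>R unit_vec i)) k))" for \<tau>
    unfolding F_def eucl_inner_grad[OF zRn] differential_unit_vec[OF ij(1)]
    by (simp add: eucl_inner_def sum_distrib_left)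
  have "\<exists>m. ((\<lambda>\<tau>. coord (\<psi> (z + \<tau> *\<^sub>R unit_vec i)) k) has_real_derivative m) (at 0)"
    "\<exists>m. ((\<lambda>\<tau>. coord (partial i \<psi> (z + \<tau> *\<^sub>R unit_vec i)) k) has_real_derivative m) (at 0)" for k
    using coord_has_vector_derivative[OF partial_has_vector_derivative[OF Ck_\<psi>[of "Suc 0"] ij(1) z(1), of 0], of k]
      coord_has_vector_derivative[OF partial_has_vector_derivative[OF Ck_partial[OF Ck_\<psi>[of "Suc (Suc 0)"] ij(1)] ij(1) z(1), of 0], of k]
    by (auto simp: has_real_derivative_iff_has_vector_derivative)
  then obtain m\<^sub>1 m\<^sub>2 where
    "\<And>k. ((\<lambda>\<tau>. coord (\<psi> (z + \<tau> *\<^sub>R unit_vec i)) k) has_real_derivative m\<^sub>1 k) (at 0)"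
    "\<And>k. ((\<lambda>\<tau>. coord (partial i \<psi> (z + \<tau> *\<^sub>R unit_vec i)) k) has_real_derivative m\<^sub>2 k) (at 0)"
    by metis
  note ms = this
  have "(F has_real_derivative (\<Sum>k<d. 2 * ((coord (\<psi> (z + 0 *\<^sub>R unit_vec i)) k - coord a k) * m\<^sub>2 k +
      m\<^sub>1 k * coord (partial i \<psi> (z + 0 *\<^sub>R unit_vec i)) k))) (at 0)"
    unfolding F_eq[abs_def] by (intro DERIV_sum) (auto intro!: derivative_eq_intros ms)
  then obtain m where m: "(F has_real_derivative m) (at 0)" by blast
  have F0: "F 0 = 0" using ij by (simp add: F_def g eucl_inner_scale_left eucl_inner_unit_vec)
  obtain \<delta>\<^sub>1 where \<delta>1: "\<delta>\<^sub>1 > 0" "\<And>\<tau>. norm (\<tau> - 0) < \<delta>\<^sub>1 \<Longrightarrow> norm (F \<tau> - F 0 - m * (\<tau> - 0)) \<le> 1 * norm (\<tau> - 0)"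
    using m unfolding has_field_derivative_def has_derivative_within_alt by (metis UNIV_I zero_less_one)
  define K where "K = \<bar>m\<bar> + 1"
  have K: "K > 0" by (simp add: K_def add_nonneg_pos)
  have FK: "F \<tau> \<le> K * \<tau>" if "0 \<le> \<tau>" "\<tau> < \<delta>\<^sub>1" for \<tau>
  proof -
    have "F \<tau> \<le> m * \<tau> + \<tau>" using \<delta>1(2)[of \<tau>] that F0 by auto
    also have "m * \<tau> \<le> \<bar>m\<bar> * \<tau>" using that by (intro mult_right_mono) auto
    finally show ?thesis by (simp add: K_def algebra_simps)
  qed
  have tangential: "level (z + \<tau> *\<^sub>R unit_vec i) \<le> r\<^sup>2 + K * \<tau>\<^sup>2" if \<tau>: "0 < \<tau>" "\<tau> < \<delta>\<^sub>1" for \<tau>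
  proof -
    have "((\<lambda>s. level (z + s *\<^sub>R unit_vec i)) has_real_derivative F s) (at s)" for s
      unfolding F_def by (rule level_has_derivative[OF line_has_vector_derivative]) auto
    then obtain s where s: "0 < s" "s < \<tau>" "level (z + \<tau> *\<^sub>R unit_vec i) - level (z + 0 *\<^sub>R unit_vec i) = (\<tau> - 0) * F s"
      using MVT2[of 0 \<tau> "\<lambda>s. level (z + s *\<^sub>R unit_vec i)" F] \<tau> by auto
    have "\<tau> * F s \<le> \<tau> * (K * \<tau>)"
      using FK[of s] s \<tau> K by (intro mult_left_mono order_trans[OF FK[of s]]) auto
    then show ?thesis using s(3) z(2) by (simp add: power2_eq_square algebra_simps)
  qed
  have "\<forall>\<^sub>F y in at z within Rn d. g / 2 < eucl_inner d (grad y) (unit_vec j)"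
  proof (rule order_tendstoD(1))
    have "continuous_on (Rn d) (\<lambda>y. eucl_inner d (grad y) (unit_vec j))"
      by (intro continuous_intros grad_continuous)
    then show "((\<lambda>y. eucl_inner d (grad y) (unit_vec j)) \<longlongrightarrow> eucl_inner d (grad z) (unit_vec j)) (at z within Rn d)"
      using z(1) by (auto simp: continuous_on_def)
    show "g / 2 < eucl_inner d (grad z) (unit_vec j)"
      using ij g by (simp add: eucl_inner_scale_left eucl_inner_unit_vec)
  qed
  then obtain \<delta>\<^sub>2 where \<delta>2: "\<delta>\<^sub>2 > 0"
    "\<And>y. \<lbrakk>y \<in> Rn d; y \<noteq> z; dist y z < \<delta>\<^sub>2\<rbrakk> \<Longrightarrow> g / 2 < eucl_inner d (grad y) (unit_vec j)"
    unfolding eventually_at by auto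
  have near: "g / 2 < eucl_inner d (grad y) (unit_vec j)" if "y \<in> Rn d" "norm (y - z) < \<delta>\<^sub>2" for y
    using \<delta>2(2)[of y] that ij g by (cases "y = z") (auto simp: dist_norm eucl_inner_scale_left eucl_inner_unit_vec)
  (* Near z the derivative of level in direction unit_vec j exceeds g / 2, so moving back by C \<tau>\<^sup>2
     lowers level by at least K \<tau>\<^sup>2. *)
  define C where "C = 2 * K / g"
  have C: "C > 0" using K g by (simp add: C_def)
  define \<tau>\<^sub>0 where "\<tau>\<^sub>0 = min \<delta>\<^sub>1 (min 1 (\<delta>\<^sub>2 / (1 + C)))"
  show ?thesis
  proof (rule that[of C \<tau>\<^sub>0])
    show "C > 0" by (rule C)
    show "\<tau>\<^sub>0 > 0" using \<delta>1(1) \<delta>2(1) C by (simp add: \<tau>\<^sub>0_def)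
    fix \<tau> assume \<tau>: "0 < \<tau>" "\<tau> < \<tau>\<^sub>0"
    let ?y = "\<lambda>s. z + \<tau> *\<^sub>R unit_vec i - s *\<^sub>R unit_vec j"
    have yRn: "?y s \<in> Rn d" for s using ij zRn[of \<tau>] by (intro Rn_diff) auto
    have ny: "norm (?y s - z) < \<delta>\<^sub>2" if "0 \<le> s" "s \<le> C * \<tau>\<^sup>2" for s
    proof -
      have "norm (?y s - z) = norm (\<tau> *\<^sub>R unit_vec i - s *\<^sub>R unit_vec j)" by simp
      also have "\<dots> \<le> \<tau> + s"
        using norm_triangle_ineq4[of "\<tau> *\<^sub>R unit_vec i" "s *\<^sub>R unit_vec j"] \<tau> that by simp
      also have "\<dots> \<le> \<tau> + C * \<tau>"
      proof -
        have "\<tau>\<^sup>2 \<le> \<tau>" using \<tau> by (simp add: \<tau>\<^sub>0_def power2_eq_square mult_left_le)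
        then show ?thesis using that C by (meson add_left_mono less_imp_le mult_left_mono order_trans)
      qed
      also have "\<dots> < \<delta>\<^sub>2" using \<tau> C by (simp add: \<tau>\<^sub>0_def pos_less_divide_eq algebra_simps)
      finally show ?thesis .
    qed
    let ?T = "C * \<tau>\<^sup>2"
    have T: "?T > 0" using C \<tau> by simp
    have "((\<lambda>s. level (?y s)) has_real_derivative eucl_inner d (grad (?y s)) (- unit_vec j)) (at s)" for s
      by (rule level_has_derivative) (use yRn in \<open>auto intro!: derivative_eq_intros\<close>)
    then obtain s where s: "0 < s" "s < ?T" "level (?y ?T) - level (?y 0) = (?T - 0) * eucl_inner d (grad (?y s)) (- unit_vec j)"
      using MVT2[of 0 ?T "\<lambda>s. level (?y s)" "\<lambda>s. eucl_inner d (grad (?y s)) (- unit_vec j)"] T by auto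
    have "?T * (g / 2) \<le> ?T * eucl_inner d (grad (?y s)) (unit_vec j)"
      using near[OF yRn ny, of s] s T by (intro mult_left_mono) auto
    then have "level (?y ?T) \<le> level (?y 0) - ?T * (g / 2)"
      using s(3) by (simp add: eucl_inner_uminus_right)
    also have "?T * (g / 2) = K * \<tau>\<^sup>2" using g by (simp add: C_def)
    also have "level (?y 0) - K * \<tau>\<^sup>2 \<le> r\<^sup>2"
      using tangential[of \<tau>] \<tau> by (simp add: \<tau>\<^sub>0_def)
    finally show "z + \<tau> *\<^sub>R unit_vec i - (C * \<tau>\<^sup>2) *\<^sub>R unit_vec j \<in> body"
      using yRn by (simp add: body_iff)
  qed
qed

text \<open>A product with exponent \<open>q < 2\<close> is too sharp along each factor: at \<open>(x, 0)\<close>, where \<open>x\<close>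
  maximises the first coordinate, moving by \<open>\<tau>\<close> into the other factor costs a depth of order
  \<open>\<tau>\<^sup>q\<close> in that coordinate, whereas a boundary of class \<open>C\<^sup>2\<close> makes it cost at most a multiple
  of \<open>\<tau>\<^sup>2\<close>.\<close>

lemma no_small_exponent:
  assumes lk: "l + k \<le> N" "l' + k' \<le> N" and disj: "l + k \<le> l' \<or> l' + k' \<le> l" and k: "k \<ge> 1" "k' \<ge> 1"
    and X: "gauge_body (2*k) X" and Y: "gauge_body (2*k') Y"
    and proj: "\<And>z. z \<in> body \<Longrightarrow> proj (2*l) (2*k) z \<in> X"
    and emb: "\<And>x. x \<in> X \<Longrightarrow> emb (2*l) (2*k) x \<in> body"
    and q: "1 \<le> q" "q < 2"
    and sum: "\<And>z. z \<in> body \<Longrightarrow> mink X (proj (2*l) (2*k) z) powr q + mink Y (proj (2*l') (2*k') z) powr q \<le> 1"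
  shows False
proof -
  interpret X: gauge_body "2*k" X by (rule X)
  interpret Y: gauge_body "2*k'" Y by (rule Y)
  have X_ne: "X \<noteq> {}" using X.zero by auto
  obtain x where x: "x \<in> X" "\<And>y. y \<in> X \<Longrightarrow> coord y 0 \<le> coord x 0"
    and ext: "\<And>z. z \<in> body \<Longrightarrow> proj (2*l) (2*k) z = x \<Longrightarrow> level z = r\<^sup>2 \<and> (\<exists>g>0. grad z = g *\<^sub>R unit_vec (2*l))"
    using factor_extreme_point[OF lk(1) k(1) X.compact X.sub X_ne proj] by metis
  define u\<^sub>0 :: rseq where "u\<^sub>0 = unit_vec 0"
  have u0: "u\<^sub>0 \<in> Rn (2*k)" "u\<^sub>0 \<in> Rn (2*k')" "coord u\<^sub>0 0 = 1"
    using k Rn_unit_vec[of 0 "2*k"] Rn_unit_vec[of 0 "2*k'"] by (auto simp: u\<^sub>0_def simp del: single_one)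
  have E: "emb (2*l) (2*k) u\<^sub>0 = unit_vec (2*l)" "emb (2*l') (2*k') u\<^sub>0 = unit_vec (2*l')"
    using emb_unit_vec[of 0 "2*k" "2*l"] emb_unit_vec[of 0 "2*k'" "2*l'"] k by (simp_all only: u\<^sub>0_def add_0_right)
  have P1: "proj (2*l) (2*k) (emb (2*l') (2*k') y) = 0"
    and P2: "proj (2*l') (2*k') (emb (2*l) (2*k) y) = 0" for y
    using disj by (auto intro!: proj_emb_disjoint)
  have xRn: "x \<in> Rn (2*k)" using x X.sub by auto
  define M where "M = coord x 0"
  have M: "M > 0"
  proof -
    obtain s where s: "s > 0" "s *\<^sub>R u\<^sub>0 \<in> X" using X.absorbing[OF u0(1)] by blast
    then show ?thesis using x(2)[OF s(2)] u0(3) by (simp add: M_def)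
  qed
  have mink_lower: "coord v 0 \<le> M * mink X v" if v: "v \<in> Rn (2*k)" for v
  proof -
    obtain y where y: "y \<in> X" "v = mink X v *\<^sub>R y" using X.mink_set(1)[OF v] by auto
    have "coord v 0 = mink X v * coord y 0" by (subst y(2)) simp
    also have "\<dots> \<le> mink X v * M" using x(2)[OF y(1)] X.mink_nonneg[OF v] by (intro mult_left_mono) (auto simp: M_def)
    finally show ?thesis by (simp add: mult.commute)
  qed
  let ?z = "emb (2*l) (2*k) x"
  have zb: "?z \<in> body" by (rule emb[OF x(1)])
  obtain g where lev: "level ?z = r\<^sup>2" and g: "g > 0" "grad ?z = g *\<^sub>R unit_vec (2*l)"
    using ext[OF zb] xRn by auto
  have ij: "2*l' < d" "2*l < d" "2*l' \<noteq> 2*l" using lk disj k by auto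
  obtain C \<tau>\<^sub>0 where C: "C > 0" "\<tau>\<^sub>0 > 0"
    "\<And>\<tau>. 0 < \<tau> \<Longrightarrow> \<tau> < \<tau>\<^sub>0 \<Longrightarrow> ?z + \<tau> *\<^sub>R unit_vec (2*l') - (C * \<tau>\<^sup>2) *\<^sub>R unit_vec (2*l) \<in> body"
    using interior_parabola[OF _ lev ij g] zb by (auto simp: body_iff)
  obtain R where R: "R > 0" "\<And>y. y \<in> Rn (2*k') \<Longrightarrow> norm y \<le> R * mink Y y"
    using Y.mink_lower_bound by blast
  (* On the parabola the gauge of the first component is still at least 1 - C \<tau>\<^sup>2 / M, which leaves
     only 2 C \<tau>\<^sup>2 / M for the second term of the sum. *)
  have key: "(\<tau> / R) powr q \<le> 2 * (C / M) * \<tau>\<^sup>2" if \<tau>: "0 < \<tau>" "\<tau> < \<tau>\<^sub>0" "C * \<tau>\<^sup>2 < M" for \<tau>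
  proof -
    let ?p = "?z + \<tau> *\<^sub>R emb (2*l') (2*k') u\<^sub>0 - (C * \<tau>\<^sup>2) *\<^sub>R emb (2*l) (2*k) u\<^sub>0"
    have p: "?p \<in> body" using C(3)[OF \<tau>(1,2)] by (simp only: E)
    have pX: "proj (2*l) (2*k) ?p = x - (C * \<tau>\<^sup>2) *\<^sub>R u\<^sub>0" using xRn u0 by (simp add: proj_simps P1)
    have pY: "proj (2*l') (2*k') ?p = \<tau> *\<^sub>R u\<^sub>0" using xRn u0 by (simp add: proj_simps P2)
    define b where "b = C * \<tau>\<^sup>2 / M"
    have b: "0 < b" "b < 1" using C(1) M \<tau> by (auto simp: b_def)
    have "M - C * \<tau>\<^sup>2 \<le> M * mink X (proj (2*l) (2*k) ?p)"
      using mink_lower[of "proj (2*l) (2*k) ?p"] xRn u0 by (simp add: pX M_def)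
    then have "1 - b \<le> mink X (proj (2*l) (2*k) ?p)" using M by (simp add: b_def field_simps)
    then have "(1 - b) powr q \<le> mink X (proj (2*l) (2*k) ?p) powr q"
      using b q by (intro powr_mono2) auto
    moreover have "1 - 2 * b \<le> (1 - b) powr q"
    proof -
      have "1 - 2 * b \<le> (1 - b)\<^sup>2" by (simp add: power2_eq_square algebra_simps)
      also have "\<dots> = (1 - b) powr 2" using b by simp
      also have "\<dots> \<le> (1 - b) powr q" using b q by (intro powr_mono') auto
      finally show ?thesis .
    qed
    moreover have "\<tau> / R \<le> mink Y (proj (2*l') (2*k') ?p)"
    proof -
      have "norm (\<tau> *\<^sub>R u\<^sub>0) = \<tau>" using \<tau> by (simp add: u\<^sub>0_def del: single_one)
      then have "\<tau> \<le> R * mink Y (\<tau> *\<^sub>R u\<^sub>0)" using R(2)[of "\<tau> *\<^sub>R u\<^sub>0"] u0 by simp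
      then show ?thesis unfolding pY using R(1) by (simp add: pos_divide_le_eq mult.commute)
    qed
    then have "(\<tau> / R) powr q \<le> mink Y (proj (2*l') (2*k') ?p) powr q"
      using \<tau> R(1) q by (intro powr_mono2) auto
    ultimately have "(\<tau> / R) powr q \<le> 2 * b" using sum[OF p] by linarith
    then show ?thesis by (simp add: b_def)
  qed
  define A where "A = 2 * (C / M) * R powr q"
  have A: "A > 0" using C M R by (simp add: A_def)
  have pos: "\<forall>\<^sub>F \<tau> in at_right (0::real). 0 < \<tau>"
    by (rule eventually_at_right_less)
  have "((\<lambda>\<tau>. \<tau> powr (2 - q)) \<longlongrightarrow> 0 powr (2 - q)) (at_right 0)"
  proof (rule tendsto_powr')
    have "\<forall>\<^sub>F \<tau> in at_right (0::real). 0 \<le> \<tau>" using pos by (rule eventually_mono) simp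
    then show "(0::real) \<noteq> 0 \<or> 0 < 2 - q \<and> (\<forall>\<^sub>F \<tau> in at_right (0::real). 0 \<le> \<tau>)" using q by simp
  qed (auto intro: tendsto_ident_at)
  then have "((\<lambda>\<tau>. A * \<tau> powr (2 - q)) \<longlongrightarrow> A * 0 powr (2 - q)) (at_right 0)"
    by (intro tendsto_mult tendsto_const)
  then have ev1: "\<forall>\<^sub>F \<tau> in at_right 0. A * \<tau> powr (2 - q) < 1"
    by (rule order_tendstoD(2)) simp
  have ev2: "\<forall>\<^sub>F \<tau> in at_right 0. \<tau> < \<tau>\<^sub>0"
    using C(2) by (auto simp: eventually_at_right[of 0 1])
  have "((\<lambda>\<tau>. C * \<tau>\<^sup>2) \<longlongrightarrow> C * 0\<^sup>2) (at_right (0::real))"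
    by (intro tendsto_intros)
  then have ev3: "\<forall>\<^sub>F \<tau> in at_right 0. C * \<tau>\<^sup>2 < M"
    by (rule order_tendstoD(2)) (use M in simp)
  have ev: "\<forall>\<^sub>F \<tau> in at_right 0. A * \<tau> powr (2 - q) < 1 \<and> \<tau> < \<tau>\<^sub>0 \<and> C * \<tau>\<^sup>2 < M \<and> 0 < \<tau>"
    using ev1 ev2 ev3 pos by (intro eventually_conj)
  obtain \<tau> where \<tau>: "A * \<tau> powr (2 - q) < 1" "\<tau> < \<tau>\<^sub>0" "C * \<tau>\<^sup>2 < M" "0 < \<tau>"
    using eventually_happens'[OF trivial_limit_at_right_real ev] by blast
  have "\<tau> powr q / R powr q \<le> 2 * (C / M) * \<tau>\<^sup>2"
    using key[of \<tau>] \<tau> R(1) by (simp add: powr_divide)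
  then have "\<tau> powr q \<le> A * \<tau>\<^sup>2"
    using R(1) by (simp add: A_def pos_divide_le_eq mult_ac)
  also have "\<tau>\<^sup>2 = \<tau> powr (2 - q) * \<tau> powr q"
    using \<tau> by (simp add: powr_add[symmetric])
  finally have "1 * \<tau> powr q \<le> (A * \<tau> powr (2 - q)) * \<tau> powr q" by (simp add: mult.assoc)
  then have "1 \<le> A * \<tau> powr (2 - q)" using \<tau>(4) by (subst (asm) mult_le_cancel_right) simp
  then show False using \<tau>(1) by simp
qed

end

section \<open>The \<open>p\<close>-product in terms of gauges\<close>

lemma vprod_iff:
  assumes "X \<subseteq> Rn d" "Y \<subseteq> Rn e"
  shows "z \<in> vprod d e X Y \<longleftrightarrow> z \<in> Rn (d + e) \<and> proj 0 d z \<in> X \<and> proj d e z \<in> Y"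
proof
  assume "z \<in> vprod d e X Y"
  then obtain x y where xy: "x \<in> X" "y \<in> Y" "z = emb 0 d x + emb d e y"
    by (auto simp: vprod_def concat_vec_eq)
  then show "z \<in> Rn (d + e) \<and> proj 0 d z \<in> X \<and> proj d e z \<in> Y"
    using assms by (auto simp: proj_simps proj_emb_disjoint subsetD intro!: Rn_add emb_Rn)
next
  assume z: "z \<in> Rn (d + e) \<and> proj 0 d z \<in> X \<and> proj d e z \<in> Y"
  then have "z = emb 0 d (proj 0 d z) + emb d e (proj d e z)"
    by (intro Rn_eqI[of _ "d + e"]) (auto simp: coord_emb coord_proj intro!: Rn_add emb_Rn)
  then have eq: "concat_vec d e (proj 0 d z) (proj d e z) = z" by (simp add: concat_vec_eq)
  show "z \<in> vprod d e X Y"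
    unfolding vprod_def
    by (rule image_eqI[where x = "(proj 0 d z, proj d e z)"]) (use z eq in auto)
qed

lemma scale_sub_Rn: "X \<subseteq> Rn d \<Longrightarrow> (*\<^sub>R) s ` X \<subseteq> Rn d"
  by auto

lemma p_product_iff:
  assumes "X \<subseteq> Rn d" "Y \<subseteq> Rn e" "p \<noteq> \<infinity>"
  shows "z \<in> p_product d e p X Y \<longleftrightarrow> z \<in> Rn (d + e) \<and> (\<exists>t\<in>{0..1}.
    proj 0 d z \<in> (*\<^sub>R) ((1 - t) powr (1 / real_of_ereal p)) ` X \<and>
    proj d e z \<in> (*\<^sub>R) (t powr (1 / real_of_ereal p)) ` Y)"
  using assms vprod_iff[OF scale_sub_Rn[OF assms(1)] scale_sub_Rn[OF assms(2)]]
  by (auto simp: p_product_def)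

lemma (in gauge_body) mink_le_powr_iff:
  assumes "y \<in> Rn d" "0 < q" "0 \<le> t"
  shows "y \<in> (*\<^sub>R) (t powr (1 / q)) ` Y \<longleftrightarrow> mink Y y powr q \<le> t"
proof -
  have "y \<in> (*\<^sub>R) (t powr (1 / q)) ` Y \<longleftrightarrow> mink Y y \<le> t powr (1 / q)"
    using mink_le_iff[OF assms(1)] by simp
  also have "\<dots> \<longleftrightarrow> mink Y y powr q \<le> (t powr (1 / q)) powr q"
    using assms mink_nonneg[OF assms(1)]
    by (metis not_less powr_ge_zero powr_less_mono2 powr_mono2 less_imp_le)
  also have "(t powr (1 / q)) powr q = t" using assms by (simp add: powr_powr)
  finally show ?thesis .
qed

lemma p_product_gauge:
  assumes X: "gauge_body d X" and Y: "gauge_body e Y" and p: "1 \<le> p" "p \<noteq> \<infinity>"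
  shows "z \<in> p_product d e p X Y \<longleftrightarrow> z \<in> Rn (d + e) \<and>
    mink X (proj 0 d z) powr real_of_ereal p + mink Y (proj d e z) powr real_of_ereal p \<le> 1"
proof -
  interpret X: gauge_body d X by (rule X)
  interpret Y: gauge_body e Y by (rule Y)
  obtain q where q: "p = ereal q" using p by (cases p) auto
  have q1: "1 \<le> q" using p q by simp
  have "(\<exists>t\<in>{0..1}. mink X (proj 0 d z) powr q \<le> 1 - t \<and> mink Y (proj d e z) powr q \<le> t) \<longleftrightarrow>
      mink X (proj 0 d z) powr q + mink Y (proj d e z) powr q \<le> 1" (is "?L \<longleftrightarrow> ?R")
  proof
    assume R: ?R
    show ?L
    proof (rule bexI[of _ "mink Y (proj d e z) powr q"])
      show "mink Y (proj d e z) powr q \<in> {0..1}"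
        using R powr_ge_zero[of "mink X (proj 0 d z)" q] powr_ge_zero[of "mink Y (proj d e z)" q]
        unfolding atLeastAtMost_iff by linarith
    qed (use R in auto)
  qed auto
  moreover have "proj 0 d z \<in> (*\<^sub>R) ((1 - t) powr (1 / q)) ` X \<longleftrightarrow> mink X (proj 0 d z) powr q \<le> 1 - t"
    "proj d e z \<in> (*\<^sub>R) (t powr (1 / q)) ` Y \<longleftrightarrow> mink Y (proj d e z) powr q \<le> t" if "t \<in> {0..1}" for t
    using q1 that X.mink_le_powr_iff[of "proj 0 d z" q "1 - t"] Y.mink_le_powr_iff[of "proj d e z" q t]
    by simp_all
  ultimately show ?thesis
    using p_product_iff[OF X.sub Y.sub p(2), of z] by (auto simp: q)
qed

section \<open>Lebesgue measure on \<open>\<real>\<^sup>d\<close>\<close>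

abbreviation coord_measure :: "nat \<Rightarrow> (nat \<Rightarrow> real) measure"
  where "coord_measure d \<equiv> \<Pi>\<^sub>M i\<in>{..<d}. lborel"

text \<open>Lebesgue measure of \<open>Rn d\<close>, regarded as a Borel measure on all finitely supported sequences
  that is concentrated on \<open>Rn d\<close>.\<close>

definition leb :: "nat \<Rightarrow> rseq measure"
  where "leb d = distr (coord_measure d) borel (vec_of d)"

interpretation lborel_product: product_sigma_finite "\<lambda>_::nat. lborel :: real measure"
  by standard

lemma space_leb [simp]: "space (leb d) = UNIV" and sets_leb [measurable_cong, simp]: "sets (leb d) = sets borel"
  by (simp_all add: leb_def)

lemma coord_measurable [measurable]: "(\<lambda>x. coord x i) \<in> borel_measurable borel"
  by (intro borel_measurable_continuous_onI continuous_intros)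

lemma measurable_vec_of:
  assumes "\<And>i. i < d \<Longrightarrow> (\<lambda>x. f x i) \<in> borel_measurable M"
  shows "(\<lambda>x. vec_of d (f x)) \<in> borel_measurable M"
proof -
  have "continuous_on UNIV (vec_of d)"
    unfolding vec_of_eq_sum by (intro continuous_intros continuous_on_product_coordinates)
  then have 1: "vec_of d \<in> borel_measurable borel" by (rule borel_measurable_continuous_onI)
  have "(\<lambda>x i. if i < d then f x i else 0) \<in> measurable M (\<Pi>\<^sub>M i\<in>UNIV. borel)"
  proof (intro measurable_PiM_single')
    show "(\<lambda>x. if i < d then f x i else 0) \<in> borel_measurable M" for i
      using assms[of i] by (cases "i < d") auto
  qed simp
  also have "measurable M (\<Pi>\<^sub>M i\<in>UNIV. borel) = measurable M (borel :: (nat \<Rightarrow> real) measure)"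
    by (rule measurable_cong_sets) (simp_all add: sets_PiM_equal_borel)
  finally have "(\<lambda>x. vec_of d (\<lambda>i. if i < d then f x i else 0)) \<in> borel_measurable M"
    using measurable_compose[OF _ 1] by blast
  moreover have "vec_of d (\<lambda>i. if i < d then f x i else 0) = vec_of d (f x)" for x
    by (rule poly_mapping_eqI) (simp add: coord_vec_of)
  ultimately show ?thesis by simp
qed

lemma vec_of_measurable [measurable]: "vec_of d \<in> measurable (coord_measure d) borel"
  by (rule measurable_vec_of) simp

lemma Rn_borel [measurable]: "Rn d \<in> sets borel"
  by (simp add: borel_closed)

lemma nn_integral_leb:
  "f \<in> borel_measurable borel \<Longrightarrow> (\<integral>\<^sup>+x. f x \<partial>leb d) = (\<integral>\<^sup>+x. f (vec_of d x) \<partial>coord_measure d)"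
  unfolding leb_def by (rule nn_integral_distr) auto

lemma AE_leb_Rn: "AE x in leb d. x \<in> Rn d"
  unfolding leb_def by (subst AE_distr_iff) (auto simp: AE_I2)

lemma nn_integral_leb_cong:
  "(\<And>x. x \<in> Rn d \<Longrightarrow> f x = g x) \<Longrightarrow> (\<integral>\<^sup>+x. f x \<partial>leb d) = (\<integral>\<^sup>+x. g x \<partial>leb d)"
  using AE_leb_Rn[of d] by (intro nn_integral_cong_AE) (auto elim!: eventually_mono)

lemma Vol_eq_leb:
  assumes "K \<in> sets borel" "K \<subseteq> Rn d"
  shows "Vol d K = measure (leb d) K"
proof -
  have "(\<lambda>x. restrict (coord x) {..<d}) ` K = vec_of d -` K \<inter> space (coord_measure d)"
  proof (intro equalityI subsetI)
    fix f assume "f \<in> (\<lambda>x. restrict (coord x) {..<d}) ` K"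
    then obtain x where x: "x \<in> K" "f = restrict (coord x) {..<d}" by auto
    have "vec_of d f = x" using x assms(2) by (intro Rn_eqI[of _ d]) (auto simp: coord_vec_of)
    then show "f \<in> vec_of d -` K \<inter> space (coord_measure d)" using x by (auto simp: space_PiM)
  next
    fix f assume f: "f \<in> vec_of d -` K \<inter> space (coord_measure d)"
    then have "f = restrict (coord (vec_of d f)) {..<d}"
      by (auto simp: space_PiM PiE_iff extensional_def coord_vec_of fun_eq_iff)
    then show "f \<in> (\<lambda>x. restrict (coord x) {..<d}) ` K" using f by blast
  qed
  then show ?thesis
    using assms unfolding Vol_def leb_def by (simp add: measure_distr)
qed

lemma coord_measure_translate:
  "distr (coord_measure d) (coord_measure d) (\<lambda>f. \<lambda>i\<in>{..<d}. f i + c i) = coord_measure d" (is "?D = _")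
proof (rule lborel_product.PiM_eqI)
  fix A :: "nat \<Rightarrow> real set" assume A: "\<And>i. i \<in> {..<d} \<Longrightarrow> A i \<in> sets lborel"
  have m: "(\<lambda>f. \<lambda>i\<in>{..<d}. f i + c i) \<in> measurable (coord_measure d) (coord_measure d)"
    by (intro measurable_restrict) simp
  have pre: "(\<lambda>f. \<lambda>i\<in>{..<d}. f i + c i) -` (\<Pi>\<^sub>E i\<in>{..<d}. A i) \<inter> space (coord_measure d)
      = (\<Pi>\<^sub>E i\<in>{..<d}. (\<lambda>x. x + c i) -` A i)"
    by (auto simp: space_PiM PiE_iff)
  have "emeasure lborel ((\<lambda>x. x + c i) -` A i) = emeasure lborel (A i)" if "i < d" for i
  proof -
    have "emeasure lborel (A i) = emeasure (distr lborel borel (\<lambda>x. c i + x)) (A i)"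
      by (simp add: lborel_distr_plus)
    also have "\<dots> = emeasure lborel ((\<lambda>x. c i + x) -` A i)"
      using A that by (subst emeasure_distr) auto
    finally show ?thesis by (simp add: add.commute)
  qed
  moreover have "(\<lambda>x. x + c i) -` A i \<in> sets lborel" if "i < d" for i
    using A[of i] that measurable_sets[of "\<lambda>x. x + c i" borel borel "A i"] by simp
  ultimately show "emeasure ?D (Pi\<^sub>E {..<d} A) = (\<Prod>i\<in>{..<d}. emeasure lborel (A i))"
  proof -
    assume em: "\<And>i. i < d \<Longrightarrow> emeasure lborel ((\<lambda>x. x + c i) -` A i) = emeasure lborel (A i)"
      and ms: "\<And>i. i < d \<Longrightarrow> (\<lambda>x. x + c i) -` A i \<in> sets lborel"
    have "emeasure ?D (Pi\<^sub>E {..<d} A) = emeasure (coord_measure d) (\<Pi>\<^sub>E i\<in>{..<d}. (\<lambda>x. x + c i) -` A i)"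
      using A by (subst emeasure_distr[OF m]) (auto simp: pre intro!: sets_PiM_I_finite)
    also have "\<dots> = (\<Prod>i\<in>{..<d}. emeasure lborel ((\<lambda>x. x + c i) -` A i))"
      by (rule lborel_product.emeasure_PiM) (use ms in auto)
    also have "\<dots> = (\<Prod>i\<in>{..<d}. emeasure lborel (A i))" using em by (intro prod.cong) auto
    finally show ?thesis .
  qed
qed auto

lemma nn_integral_leb_translate:
  assumes [measurable]: "f \<in> borel_measurable borel" and c: "c \<in> Rn d"
  shows "(\<integral>\<^sup>+x. f (x + c) \<partial>leb d) = (\<integral>\<^sup>+x. f x \<partial>leb d)"
proof -
  have [measurable]: "(\<lambda>x. x + c) \<in> borel_measurable borel"
    by (intro borel_measurable_continuous_onI continuous_intros)
  have "(\<integral>\<^sup>+x. f x \<partial>leb d) = (\<integral>\<^sup>+x. f (vec_of d x) \<partial>distr (coord_measure d) (coord_measure d) (\<lambda>f. \<lambda>i\<in>{..<d}. f i + coord c i))"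
    by (simp add: nn_integral_leb coord_measure_translate)
  also have "\<dots> = (\<integral>\<^sup>+x. f (vec_of d (\<lambda>i\<in>{..<d}. x i + coord c i)) \<partial>coord_measure d)"
    by (rule nn_integral_distr) (auto intro!: measurable_restrict)
  also have "\<dots> = (\<integral>\<^sup>+x. f (vec_of d x + c) \<partial>coord_measure d)"
  proof (rule nn_integral_cong)
    fix x
    have "vec_of d (\<lambda>i\<in>{..<d}. x i + coord c i) = vec_of d x + c"
      using c by (intro Rn_eqI[of _ d]) (auto simp: coord_vec_of)
    then show "f (vec_of d (\<lambda>i\<in>{..<d}. x i + coord c i)) = f (vec_of d x + c)" by simp
  qed
  finally show ?thesis by (simp add: nn_integral_leb)
qed

definition cube :: "nat \<Rightarrow> real \<Rightarrow> real \<Rightarrow> rseq set"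
  where "cube d l u = {x. \<forall>i<d. l \<le> coord x i \<and> coord x i < u}"

lemma cube_borel [measurable]: "cube d l u \<in> sets borel"
proof -
  have "cube d l u = (\<Inter>i\<in>{..<d}. (\<lambda>x. coord x i) -` {l..<u}) \<inter> UNIV" by (auto simp: cube_def)
  also have "\<dots> \<in> sets borel"
  proof (cases "d = 0")
    case False
    then show ?thesis
      by (intro sets.Int sets.finite_INT measurable_sets_borel[OF coord_measurable]) auto
  qed simp
  finally show ?thesis .
qed

lemma emeasure_cube: "l \<le> u \<Longrightarrow> emeasure (leb d) (cube d l u) = ennreal ((u - l) ^ d)"
proof -
  assume lu: "l \<le> u"
  have "vec_of d -` cube d l u \<inter> space (coord_measure d) = (\<Pi>\<^sub>E i\<in>{..<d}. {l..<u})"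
    by (rule set_eqI) (simp add: cube_def space_PiM PiE_iff coord_vec_of Ball_def)
  then have "emeasure (leb d) (cube d l u) = emeasure (coord_measure d) (\<Pi>\<^sub>E i\<in>{..<d}. {l..<u})"
    unfolding leb_def by (subst emeasure_distr) auto
  also have "\<dots> = (\<Prod>i\<in>{..<d}. emeasure lborel {l..<u})"
    by (rule lborel_product.emeasure_PiM) auto
  also have "\<dots> = ennreal ((u - l) ^ d)" using lu by (simp add: ennreal_power)
  finally show ?thesis .
qed

lemma emeasure_leb_bounded_finite:
  assumes "\<And>x i. x \<in> S \<Longrightarrow> i < d \<Longrightarrow> \<bar>coord x i\<bar> \<le> R"
  shows "emeasure (leb d) S < \<infinity>"
proof -
  have "S \<subseteq> cube d (- \<bar>R\<bar> - 1) (\<bar>R\<bar> + 1)"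
  proof
    fix x assume "x \<in> S"
    have "- \<bar>R\<bar> - 1 \<le> coord x i \<and> coord x i < \<bar>R\<bar> + 1" if i: "i < d" for i
    proof -
      have "\<bar>coord x i\<bar> \<le> \<bar>R\<bar>" using assms[OF \<open>x \<in> S\<close> i] abs_ge_self order_trans by blast
      from abs_le_D1[OF this] abs_le_D2[OF this] show ?thesis by simp
    qed
    then show "x \<in> cube d (- \<bar>R\<bar> - 1) (\<bar>R\<bar> + 1)" by (simp add: cube_def)
  qed
  then have "emeasure (leb d) S \<le> emeasure (leb d) (cube d (- \<bar>R\<bar> - 1) (\<bar>R\<bar> + 1))"
    by (intro emeasure_mono) auto
  also have "\<dots> < \<infinity>" by (subst emeasure_cube) auto
  finally show ?thesis .
qed

lemma sigma_finite_of_cubes: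
  assumes sets: "sets \<nu> = sets (borel :: rseq measure)"
    and fin: "\<And>R. emeasure \<nu> (cube d (-R) R) < \<infinity>"
  shows "sigma_finite_measure \<nu>"
proof
  have UN: "(\<Union>n. cube d (- real n) (real n)) = UNIV"
  proof (intro equalityI subset_UNIV subsetI)
    fix x :: rseq
    obtain n where n: "(\<Sum>i<d. \<bar>coord x i\<bar>) < real n" using reals_Archimedean2 by blast
    have "\<bar>coord x i\<bar> < real n" if "i < d" for i
      using member_le_sum[of i "{..<d}" "\<lambda>i. \<bar>coord x i\<bar>"] that n by auto
    then have "x \<in> cube d (- real n) (real n)" by (force simp: cube_def abs_less_iff)
    then show "x \<in> (\<Union>n. cube d (- real n) (real n))" by blast
  qed
  show "\<exists>A. countable A \<and> A \<subseteq> sets \<nu> \<and> \<Union> A = space \<nu> \<and> (\<forall>a\<in>A. emeasure \<nu> a \<noteq> \<infinity>)"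
    using fin sets sets_eq_imp_space_eq[OF sets] UN
    by (intro exI[of _ "range (\<lambda>n. cube d (- real n) (real n))"]) (auto simp: less_top)
qed

lemma sigma_finite_leb: "sigma_finite_measure (leb d)"
proof (rule sigma_finite_of_cubes[of _ d])
  show "emeasure (leb d) (cube d (- R) R) < \<infinity>" for R
    by (rule emeasure_leb_bounded_finite[of _ _ "\<bar>R\<bar>"]) (auto simp: cube_def)
qed simp

text \<open>Uniqueness of Haar measure: integrate \<open>f(x) 1(y - x \<in> Q)\<close> over both measures, for the unit
  cube \<open>Q\<close>; either the translation invariance in \<open>y\<close> or the one in \<open>x\<close> evaluates the double
  integral.\<close>

lemma haar_unique:
  assumes sets [measurable_cong]: "sets \<nu> = sets (borel :: rseq measure)" and sf: "sigma_finite_measure \<nu>"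
    and Rn: "AE x in \<nu>. x \<in> Rn d"
    and inv: "\<And>f c. f \<in> borel_measurable borel \<Longrightarrow> c \<in> Rn d \<Longrightarrow> (\<integral>\<^sup>+x. f (x + c) \<partial>\<nu>) = (\<integral>\<^sup>+x. f x \<partial>\<nu>)"
    and f [measurable]: "f \<in> borel_measurable borel"
  shows "(\<integral>\<^sup>+x. f x \<partial>\<nu>) = (\<integral>\<^sup>+x. f x \<partial>leb d) * (\<integral>\<^sup>+x. indicator (cube d 0 1) (- x) \<partial>\<nu>)"
proof -
  interpret \<nu>: sigma_finite_measure \<nu> by (rule sf)
  interpret L: sigma_finite_measure "leb d" by (rule sigma_finite_leb)
  interpret pair_sigma_finite \<nu> "leb d" ..
  let ?Q = "indicator (cube d 0 1) :: rseq \<Rightarrow> ennreal"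
  let ?p = "\<lambda>x. vec_of d (coord x)"
  (* Differences and sums computed through coordinates are jointly measurable. *)
  let ?diff = "\<lambda>x y. vec_of d (\<lambda>i. coord y i - coord x i)"
  let ?add = "\<lambda>x y. vec_of d (\<lambda>i. coord x i + coord y i)"
  have [measurable]: "(\<lambda>z. ?diff (fst z) (snd z)) \<in> borel_measurable (\<nu> \<Otimes>\<^sub>M leb d)"
    "(\<lambda>z. ?add (fst z) (snd z)) \<in> borel_measurable (\<nu> \<Otimes>\<^sub>M leb d)"
    by (intro measurable_vec_of; measurable)+
  have [measurable]: "(\<lambda>x. x + c) \<in> borel_measurable borel" for c :: rseq
    by (intro borel_measurable_continuous_onI continuous_intros)
  have [measurable]: "(\<lambda>x::rseq. - x) \<in> borel_measurable borel"
    by (rule borel_measurable_continuous_onI[OF continuous_on_minus[OF continuous_on_id]])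
  have cubeQ: "(\<integral>\<^sup>+x. ?Q x \<partial>leb d) = 1" using emeasure_cube[of 0 1 d] by simp
  have diff: "?diff x y = y - x" "?add x y = x + y" if "x \<in> Rn d" "y \<in> Rn d" for x y
    using that by (auto intro!: Rn_eqI[of _ d] simp: coord_vec_of)
  have "(\<integral>\<^sup>+x. f x \<partial>\<nu>) = (\<integral>\<^sup>+x. (\<integral>\<^sup>+y. f x * ?Q (?diff x y) \<partial>leb d) \<partial>\<nu>)"
  proof (rule nn_integral_cong_AE, use Rn in eventually_elim)
    case (elim x)
    have "(\<integral>\<^sup>+y. ?Q (?diff x y) \<partial>leb d) = (\<integral>\<^sup>+y. ?Q (y + (- x)) \<partial>leb d)"
      using elim by (intro nn_integral_leb_cong) (simp add: diff)
    also have "\<dots> = 1" using elim nn_integral_leb_translate[of ?Q "-x" d] cubeQ by simp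
    finally have 1: "(\<integral>\<^sup>+y. ?Q (?diff x y) \<partial>leb d) = 1" .
    have m: "(\<lambda>y. ?Q (?diff x y)) \<in> borel_measurable (leb d)"
      by (rule measurable_compose[OF measurable_vec_of]) measurable
    show "f x = (\<integral>\<^sup>+y. f x * ?Q (?diff x y) \<partial>leb d)"
      using m by (subst nn_integral_cmult) (auto simp: 1)
  qed
  also have "\<dots> = (\<integral>\<^sup>+y. (\<integral>\<^sup>+x. f x * ?Q (?diff x y) \<partial>\<nu>) \<partial>leb d)"
    by (rule Fubini'[symmetric]) measurable
  also have "\<dots> = (\<integral>\<^sup>+y. (\<integral>\<^sup>+x. f (?add x y) * ?Q (- x) \<partial>\<nu>) \<partial>leb d)"
  proof (rule nn_integral_leb_cong)
    fix y assume y: "y \<in> Rn d"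
    have "(\<integral>\<^sup>+x. f x * ?Q (?diff x y) \<partial>\<nu>) = (\<integral>\<^sup>+x. f x * ?Q (y - x) \<partial>\<nu>)"
      using Rn y by (intro nn_integral_cong_AE) (auto elim!: eventually_mono simp: diff)
    also have "\<dots> = (\<integral>\<^sup>+x. f (x + y) * ?Q (y - (x + y)) \<partial>\<nu>)"
    proof (rule inv[symmetric, where f = "\<lambda>x. f x * ?Q (y - x)", OF _ y])
      have "(\<lambda>x. y - x) \<in> borel_measurable borel"
        by (intro borel_measurable_continuous_onI continuous_intros)
      then show "(\<lambda>x. f x * ?Q (y - x)) \<in> borel_measurable borel" by measurable
    qed
    also have "\<dots> = (\<integral>\<^sup>+x. f (?add x y) * ?Q (- x) \<partial>\<nu>)"
      using Rn y by (intro nn_integral_cong_AE) (auto elim!: eventually_mono simp: diff)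
    finally show "(\<integral>\<^sup>+x. f x * ?Q (?diff x y) \<partial>\<nu>) = (\<integral>\<^sup>+x. f (?add x y) * ?Q (- x) \<partial>\<nu>)" .
  qed
  also have "\<dots> = (\<integral>\<^sup>+x. (\<integral>\<^sup>+y. f (?add x y) * ?Q (- x) \<partial>leb d) \<partial>\<nu>)"
    by (rule Fubini') measurable
  also have "\<dots> = (\<integral>\<^sup>+x. (\<integral>\<^sup>+y. f y \<partial>leb d) * ?Q (- x) \<partial>\<nu>)"
  proof (rule nn_integral_cong_AE, use Rn in eventually_elim)
    case (elim x)
    have m: "(\<lambda>y. f (?add x y)) \<in> borel_measurable (leb d)"
      by (rule measurable_compose[OF measurable_vec_of]) measurable
    have "(\<integral>\<^sup>+y. f (?add x y) \<partial>leb d) = (\<integral>\<^sup>+y. f (y + x) \<partial>leb d)"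
      using elim by (intro nn_integral_leb_cong) (simp add: diff add.commute)
    also have "\<dots> = (\<integral>\<^sup>+y. f y \<partial>leb d)" using elim by (intro nn_integral_leb_translate) auto
    finally show "(\<integral>\<^sup>+y. f (?add x y) * ?Q (- x) \<partial>leb d) = (\<integral>\<^sup>+y. f y \<partial>leb d) * ?Q (- x)"
      using m by (subst nn_integral_multc) auto
  qed
  also have "\<dots> = (\<integral>\<^sup>+y. f y \<partial>leb d) * (\<integral>\<^sup>+x. ?Q (- x) \<partial>\<nu>)"
    by (rule nn_integral_cmult) measurable
  finally show ?thesis .
qed

text \<open>Fubini's theorem for the splitting of the coordinates into two blocks.\<close>

lemma leb_product:
  assumes [measurable]: "f \<in> borel_measurable borel"
  shows "(\<integral>\<^sup>+z. f z \<partial>leb (d + e)) = (\<integral>\<^sup>+x. (\<integral>\<^sup>+y. f (emb 0 d x + emb d e y) \<partial>leb e) \<partial>leb d)"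
proof -
  interpret Ld: sigma_finite_measure "coord_measure d" by (rule lborel_product.sigma_finite) simp
  interpret Le: sigma_finite_measure "coord_measure e" by (rule lborel_product.sigma_finite) simp
  interpret pair_sigma_finite "coord_measure d" "coord_measure e" ..
  let ?h = "\<lambda>(x, y). \<lambda>i\<in>{..<d+e}. if i < d then x i else (y (i - d) :: real)"
  let ?M = "coord_measure d \<Otimes>\<^sub>M coord_measure e"
  have m: "?h \<in> measurable ?M (coord_measure (d + e))"
    unfolding case_prod_unfold
  proof (rule measurable_restrict)
    fix i assume "i \<in> {..<d+e}"
    then show "(\<lambda>x. if i < d then fst x i else snd x (i - d)) \<in> measurable ?M lborel"
      by (cases "i < d") auto
  qed
  have D: "distr ?M (coord_measure (d + e)) ?h = coord_measure (d + e)"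
  proof (rule lborel_product.PiM_eqI)
    fix A :: "nat \<Rightarrow> real set" assume A: "\<And>i. i \<in> {..<d+e} \<Longrightarrow> A i \<in> sets lborel"
    have pre: "?h -` Pi\<^sub>E {..<d+e} A \<inter> space ?M = Pi\<^sub>E {..<d} A \<times> (\<Pi>\<^sub>E i\<in>{..<e}. A (d + i))"
    proof (intro equalityI subsetI)
      fix z assume z: "z \<in> ?h -` Pi\<^sub>E {..<d+e} A \<inter> space ?M"
      have "fst z i \<in> A i" if "i < d" for i
        using z that by (auto simp: PiE_iff case_prod_unfold dest!: bspec[of _ _ i])
      moreover have "snd z i \<in> A (d + i)" if "i < e" for i
        using z that by (auto simp: PiE_iff case_prod_unfold dest!: bspec[of _ _ "d + i"])
      ultimately show "z \<in> Pi\<^sub>E {..<d} A \<times> (\<Pi>\<^sub>E i\<in>{..<e}. A (d + i))"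
        using z by (auto simp: space_pair_measure space_PiM PiE_iff mem_Times_iff)
    next
      fix z assume z: "z \<in> Pi\<^sub>E {..<d} A \<times> (\<Pi>\<^sub>E i\<in>{..<e}. A (d + i))"
      then have "snd z (i - d) \<in> A i" if "d \<le> i" "i < d + e" for i
        using that by (auto simp: PiE_iff mem_Times_iff dest!: bspec[of _ _ "i - d"])
      then show "z \<in> ?h -` Pi\<^sub>E {..<d+e} A \<inter> space ?M"
        using z by (auto simp: space_pair_measure space_PiM PiE_iff mem_Times_iff case_prod_unfold)
    qed
    have "emeasure (distr ?M (coord_measure (d + e)) ?h) (Pi\<^sub>E {..<d+e} A)
        = emeasure ?M (Pi\<^sub>E {..<d} A \<times> (\<Pi>\<^sub>E i\<in>{..<e}. A (d + i)))"
      using A by (subst emeasure_distr[OF m]) (auto simp: pre intro!: sets_PiM_I_finite)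
    also have "\<dots> = emeasure (coord_measure d) (Pi\<^sub>E {..<d} A) * emeasure (coord_measure e) (\<Pi>\<^sub>E i\<in>{..<e}. A (d + i))"
      using A by (intro Le.emeasure_pair_measure_Times sets_PiM_I_finite) auto
    also have "\<dots> = (\<Prod>i<d. emeasure lborel (A i)) * (\<Prod>i<e. emeasure lborel (A (d + i)))"
      using A by (intro arg_cong2[where f = "(*)"] lborel_product.emeasure_PiM) auto
    also have "\<dots> = (\<Prod>i<d+e. emeasure lborel (A i))"
      by (induction e) (simp_all add: mult_ac)
    finally show "emeasure (distr ?M (coord_measure (d + e)) ?h) (Pi\<^sub>E {..<d+e} A) = (\<Prod>i<d+e. emeasure lborel (A i))" .
  qed auto
  have vec: "vec_of (d + e) (?h (x, y)) = emb 0 d (vec_of d x) + emb d e (vec_of e y)" for x y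
    by (rule poly_mapping_eqI) (auto simp: coord_vec_of coord_emb)
  have me: "(\<lambda>y. emb 0 d x + emb d e y) \<in> borel_measurable borel" for x
    by (intro borel_measurable_continuous_onI continuous_intros bounded_linear.continuous_on[OF bounded_linear_emb])
  have m2 [measurable]: "(\<lambda>z. emb 0 d (fst z) + emb d e (snd z)) \<in> borel_measurable (leb d \<Otimes>\<^sub>M leb e)"
  proof -
    have "(\<lambda>z. vec_of (d + e) (\<lambda>i. if i < d then coord (fst z) i else coord (snd z) (i - d))) \<in> borel_measurable (leb d \<Otimes>\<^sub>M leb e)"
      by (rule measurable_vec_of) measurable
    moreover have "vec_of (d + e) (\<lambda>i. if i < d then coord (fst z) i else coord (snd z) (i - d)) = emb 0 d (fst z) + emb d e (snd z)" for z
      by (rule poly_mapping_eqI) (auto simp: coord_vec_of coord_emb)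
    ultimately show ?thesis by simp
  qed
  interpret Lebe: sigma_finite_measure "leb e" by (rule sigma_finite_leb)
  have mf: "(\<lambda>z. f (vec_of (d + e) (?h z))) \<in> borel_measurable ?M"
    by (rule measurable_compose[OF m]) measurable
  have "(\<integral>\<^sup>+z. f z \<partial>leb (d + e)) = (\<integral>\<^sup>+z. f (vec_of (d + e) z) \<partial>distr ?M (coord_measure (d + e)) ?h)"
    by (simp only: D nn_integral_leb[OF assms])
  also have "\<dots> = (\<integral>\<^sup>+z. f (vec_of (d + e) (?h z)) \<partial>?M)"
    by (rule nn_integral_distr[OF m]) measurable
  also have "\<dots> = (\<integral>\<^sup>+x. (\<integral>\<^sup>+y. f (vec_of (d + e) (?h (x, y))) \<partial>coord_measure e) \<partial>coord_measure d)"
    by (rule Le.nn_integral_fst[OF mf, symmetric])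
  also have "\<dots> = (\<integral>\<^sup>+x. (\<integral>\<^sup>+y. f (emb 0 d (vec_of d x) + emb d e y) \<partial>leb e) \<partial>coord_measure d)"
    unfolding vec by (intro nn_integral_cong nn_integral_leb[symmetric] measurable_compose[OF me assms])
  also have "\<dots> = (\<integral>\<^sup>+x. (\<integral>\<^sup>+y. f (emb 0 d x + emb d e y) \<partial>leb e) \<partial>leb d)"
  proof (rule nn_integral_leb[symmetric])
    have "(\<lambda>z. f (emb 0 d (fst z) + emb d e (snd z))) \<in> borel_measurable (leb d \<Otimes>\<^sub>M leb e)" by measurable
    from Lebe.borel_measurable_nn_integral_fst[OF this]
    show "(\<lambda>x. \<integral>\<^sup>+y. f (emb 0 d x + emb d e y) \<partial>leb e) \<in> borel_measurable borel" by simp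
  qed
  finally show ?thesis .
qed

section \<open>Symplectic linear maps preserve volume\<close>

definition preserves_leb :: "nat \<Rightarrow> (rseq \<Rightarrow> rseq) \<Rightarrow> bool"
  where "preserves_leb d A \<longleftrightarrow> (\<forall>f\<in>borel_measurable borel. (\<integral>\<^sup>+x. f (A x) \<partial>leb d) = (\<integral>\<^sup>+x. f x \<partial>leb d))"

lemma preserves_lebD:
  "preserves_leb d A \<Longrightarrow> f \<in> borel_measurable borel \<Longrightarrow> (\<integral>\<^sup>+x. f (A x) \<partial>leb d) = (\<integral>\<^sup>+x. f x \<partial>leb d)"
  by (auto simp: preserves_leb_def)

text \<open>The inverse is carried along because its boundedness makes the image of Lebesgue measure
  under the map finite on cubes.\<close>

definition lin_iso :: "nat \<Rightarrow> (rseq \<Rightarrow> rseq) \<Rightarrow> (rseq \<Rightarrow> rseq) \<Rightarrow> bool"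
  where "lin_iso d A B \<longleftrightarrow> bounded_linear A \<and> bounded_linear B \<and>
    (\<forall>x\<in>Rn d. A x \<in> Rn d \<and> B x \<in> Rn d \<and> A (B x) = x \<and> B (A x) = x)"

lemma lin_iso_sym: "lin_iso d A B \<Longrightarrow> lin_iso d B A"
  by (auto simp: lin_iso_def)

lemma bounded_linear_borel: "bounded_linear A \<Longrightarrow> A \<in> borel_measurable borel"
  for A :: "rseq \<Rightarrow> rseq"
  by (rule borel_measurable_continuous_onI[OF bounded_linear.continuous_on[OF _ continuous_on_id]])

text \<open>The image of Lebesgue measure is translation invariant, hence a multiple of Lebesgue measure.\<close>

lemma lin_iso_scales:
  assumes "lin_iso d A B"
  obtains k where "\<And>f. f \<in> borel_measurable borel \<Longrightarrow> (\<integral>\<^sup>+x. f (A x) \<partial>leb d) = k * (\<integral>\<^sup>+x. f x \<partial>leb d)"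
proof -
  have bl: "bounded_linear A" "bounded_linear B" using assms by (auto simp: lin_iso_def)
  have AB: "A x \<in> Rn d" "B x \<in> Rn d" "A (B x) = x" "B (A x) = x" if "x \<in> Rn d" for x
    using assms that by (auto simp: lin_iso_def)
  have Ab [measurable]: "A \<in> borel_measurable borel" by (rule bounded_linear_borel[OF bl(1)])
  let ?\<nu> = "distr (leb d) borel A"
  let ?k = "\<integral>\<^sup>+x. indicator (cube d 0 1) (- x) \<partial>?\<nu>"
  have int: "(\<integral>\<^sup>+x. f x \<partial>?\<nu>) = (\<integral>\<^sup>+x. f (A x) \<partial>leb d)" if "f \<in> borel_measurable borel" for f
    using that by (intro nn_integral_distr) auto
  have "(\<integral>\<^sup>+x. f x \<partial>?\<nu>) = (\<integral>\<^sup>+x. f x \<partial>leb d) * ?k" if f: "f \<in> borel_measurable borel" for f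
  proof (rule haar_unique[OF _ _ _ _ f])
    show "sigma_finite_measure ?\<nu>"
    proof (rule sigma_finite_of_cubes[of _ d])
      fix R
      obtain K where K: "\<And>x. norm (B x) \<le> norm x * K" using bounded_linear.bounded[OF bl(2)] by blast
      have "emeasure ?\<nu> (cube d (-R) R) = emeasure (leb d) (A -` cube d (-R) R)"
        by (subst emeasure_distr) auto
      also have "\<dots> = emeasure (leb d) (A -` cube d (-R) R \<inter> Rn d)"
      proof (rule emeasure_eq_AE)
        show "AE x in leb d. x \<in> A -` cube d (-R) R \<longleftrightarrow> x \<in> A -` cube d (-R) R \<inter> Rn d"
          using AE_leb_Rn[of d] by eventually_elim auto
      qed (use measurable_sets_borel[OF Ab cube_borel] in auto)
      also have "\<dots> < \<infinity>"
      proof (rule emeasure_leb_bounded_finite)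
        fix x i assume x: "x \<in> A -` cube d (-R) R \<inter> Rn d" and i: "i < d"
        have "norm (A x) = (\<Sum>i<d. \<bar>coord (A x) i\<bar>)" using x AB by (intro norm_eq_sum_coord) auto
        also have "\<dots> \<le> (\<Sum>i<d. \<bar>R\<bar>)" using x by (intro sum_mono) (auto simp: cube_def abs_if)
        finally have nA: "norm (A x) \<le> d * \<bar>R\<bar>" by simp
        have "\<bar>coord x i\<bar> \<le> norm x" by (rule abs_coord_le_norm)
        also have "norm x = norm (B (A x))" using AB x by simp
        also have "norm (B (A x)) \<le> norm (A x) * K" by (rule K)
        also have "\<dots> \<le> norm (A x) * \<bar>K\<bar>" by (intro mult_left_mono) auto
        also have "\<dots> \<le> d * \<bar>R\<bar> * \<bar>K\<bar>" using nA by (intro mult_right_mono) auto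
        finally show "\<bar>coord x i\<bar> \<le> d * \<bar>R\<bar> * \<bar>K\<bar>" .
      qed
      finally show "emeasure ?\<nu> (cube d (-R) R) < \<infinity>" .
    qed simp
    show "AE x in ?\<nu>. x \<in> Rn d"
      using AE_leb_Rn[of d] by (subst AE_distr_iff) (auto elim!: eventually_mono intro: AB)
    fix g c assume g [measurable]: "(g :: rseq \<Rightarrow> ennreal) \<in> borel_measurable borel" and c: "c \<in> Rn d"
    have [measurable]: "(\<lambda>x. x + c) \<in> borel_measurable borel"
      by (intro borel_measurable_continuous_onI continuous_intros)
    have "(\<integral>\<^sup>+x. g (x + c) \<partial>?\<nu>) = (\<integral>\<^sup>+x. g (A x + c) \<partial>leb d)" by (rule int) measurable
    also have "\<dots> = (\<integral>\<^sup>+x. g (A (x + B c)) \<partial>leb d)"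
      using AB c by (simp add: linear_add[OF bounded_linear.linear[OF bl(1)]])
    also have "\<dots> = (\<integral>\<^sup>+x. g (A x) \<partial>leb d)"
      using AB c by (intro nn_integral_leb_translate[where f = "\<lambda>x. g (A x)"]) auto
    also have "\<dots> = (\<integral>\<^sup>+x. g x \<partial>?\<nu>)" by (rule int[symmetric]) measurable
    finally show "(\<integral>\<^sup>+x. g (x + c) \<partial>?\<nu>) = (\<integral>\<^sup>+x. g x \<partial>?\<nu>)" .
  qed simp
  then show ?thesis using that[of ?k] by (simp add: int mult.commute)
qed

lemma emeasure_scale:
  assumes c: "c > 0" and K: "K \<in> sets borel" "K \<subseteq> Rn d"
  shows "emeasure (leb d) ((*\<^sub>R) c ` K) = ennreal (c ^ d) * emeasure (leb d) K"
proof -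
  let ?A = "\<lambda>x::rseq. (1 / c) *\<^sub>R x"
  have "lin_iso d ?A ((*\<^sub>R) c)"
    using c by (auto simp: lin_iso_def intro!: bounded_linear_scaleR_right)
  then obtain k where k: "\<And>f. f \<in> borel_measurable borel \<Longrightarrow> (\<integral>\<^sup>+x. f (?A x) \<partial>leb d) = k * (\<integral>\<^sup>+x. f x \<partial>leb d)"
    using lin_iso_scales by blast
  have "(\<integral>\<^sup>+x. indicator (cube d 0 1) (?A x) \<partial>leb d) = k * (\<integral>\<^sup>+x. indicator (cube d 0 1) x \<partial>leb d)"
    by (rule k) measurable
  also have "\<dots> = k" using emeasure_cube[of 0 1 d] by simp
  also have "(\<lambda>x. indicator (cube d 0 1) (?A x) :: ennreal) = indicator (cube d 0 c)"
    using c by (auto simp: cube_def indicator_def fun_eq_iff field_simps)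
  finally have "k = ennreal (c ^ d)" using emeasure_cube[of 0 c d] c by simp
  moreover have img: "indicator K (?A x) = (indicator ((*\<^sub>R) c ` K) x :: ennreal)" for x
    using c by (auto simp: indicator_def image_iff intro!: bexI[of _ "?A x"])
  moreover have "(*\<^sub>R) c ` K \<in> sets borel"
  proof -
    have "(*\<^sub>R) c ` K = ?A -` K \<inter> space borel" using c by (auto simp: image_iff intro!: bexI[of _ "?A _"])
    also have "\<dots> \<in> sets borel"
      by (rule measurable_sets[OF _ K(1)]) (intro borel_measurable_continuous_onI continuous_intros)
    finally show ?thesis .
  qed
  ultimately show ?thesis
    using k[of "indicator K"] K by (simp add: img)
qed

text \<open>A transvection \<open>T\<close> satisfies \<open>T \<circ> T = D \<circ> T \<circ> D\<^sup>-\<^sup>1\<close> for a linear automorphism \<open>D\<close> that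
  doubles \<open>u\<close>; hence the factor by which it scales volumes equals its own square.\<close>

lemma transvection_preserves_leb:
  assumes u: "u \<in> Rn d" and l: "bounded_linear (l :: rseq \<Rightarrow> real)" "l u = 0"
  shows "preserves_leb d (\<lambda>x. x + l x *\<^sub>R u)"
proof (cases "u = 0")
  case False
  let ?T = "\<lambda>x. x + l x *\<^sub>R u" and ?T' = "\<lambda>x. x - l x *\<^sub>R u"
  define m where "m x = (1 / eucl_inner d u u) * eucl_inner d u x" for x
  have m: "bounded_linear m" "m u = 1"
  proof -
    show "bounded_linear m"
      unfolding m_def[abs_def] eucl_inner_def[of d u]
      by (intro bounded_linear_const_mult bounded_linear_sum bounded_linear_coord)
    show "m u = 1" using eucl_inner_pos[OF u False] by (simp add: m_def)
  qed
  have m2: "bounded_linear (\<lambda>x. m x / 2)" by (rule bounded_linear_compose[OF bounded_linear_divide m(1)])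
  let ?D = "\<lambda>x. x + m x *\<^sub>R u" and ?D' = "\<lambda>x. x - (m x / 2) *\<^sub>R u"
  note bl = bounded_linear_add bounded_linear_sub bounded_linear_ident
    bounded_linear_compose[OF bounded_linear_scaleR_left] bounded_linear_divide
  note lin = linear_add[OF bounded_linear.linear] linear_diff[OF bounded_linear.linear] linear_scale[OF bounded_linear.linear]
  have T: "lin_iso d ?T ?T'"
    using u l by (auto simp: lin_iso_def lin[OF l(1)] intro!: bl)
  have D: "lin_iso d ?D ?D'"
    using u m m2 by (auto simp: lin_iso_def lin[OF m(1)] algebra_simps intro!: bl simp flip: scaleR_add_left)
  obtain t where t: "\<And>f. f \<in> borel_measurable borel \<Longrightarrow> (\<integral>\<^sup>+x. f (?T x) \<partial>leb d) = t * (\<integral>\<^sup>+x. f x \<partial>leb d)"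
    using lin_iso_scales[OF T] by blast
  obtain t' where t': "\<And>f. f \<in> borel_measurable borel \<Longrightarrow> (\<integral>\<^sup>+x. f (?T' x) \<partial>leb d) = t' * (\<integral>\<^sup>+x. f x \<partial>leb d)"
    using lin_iso_scales[OF lin_iso_sym[OF T]] by blast
  obtain \<delta> where \<delta>: "\<And>f. f \<in> borel_measurable borel \<Longrightarrow> (\<integral>\<^sup>+x. f (?D x) \<partial>leb d) = \<delta> * (\<integral>\<^sup>+x. f x \<partial>leb d)"
    using lin_iso_scales[OF D] by blast
  obtain \<delta>' where \<delta>': "\<And>f. f \<in> borel_measurable borel \<Longrightarrow> (\<integral>\<^sup>+x. f (?D' x) \<partial>leb d) = \<delta>' * (\<integral>\<^sup>+x. f x \<partial>leb d)"
    using lin_iso_scales[OF lin_iso_sym[OF D]] by blast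
  have [measurable]: "?T \<in> borel_measurable borel" "?T' \<in> borel_measurable borel"
    "?D \<in> borel_measurable borel" "?D' \<in> borel_measurable borel"
    using T D by (auto simp: lin_iso_def intro: bounded_linear_borel)
  let ?q = "indicator (cube d 0 1) :: rseq \<Rightarrow> ennreal"
  have q: "(\<integral>\<^sup>+x. ?q x \<partial>leb d) = 1" using emeasure_cube[of 0 1 d] by simp
  have "(\<integral>\<^sup>+x. ?q (?T' (?T x)) \<partial>leb d) = t * (t' * 1)"
    using t[of "\<lambda>x. ?q (?T' x)"] t'[of ?q] q by simp
  moreover have "?T' (?T x) = x" for x using l by (simp add: lin[OF l(1)])
  ultimately have tt': "t * t' = 1" using q by simp
  have "(\<integral>\<^sup>+x. ?q (?D (?D' x)) \<partial>leb d) = \<delta>' * (\<delta> * 1)"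
    using \<delta>'[of "\<lambda>x. ?q (?D x)"] \<delta>[of ?q] q by simp
  moreover have "?D (?D' x) = x" for x using m by (simp add: lin[OF m(1)] algebra_simps flip: scaleR_add_left)
  ultimately have dd': "\<delta>' * \<delta> = 1" using q by simp
  have "(\<integral>\<^sup>+x. ?q (?T (?T x)) \<partial>leb d) = t * (t * 1)"
    using t[of "\<lambda>x. ?q (?T x)"] t[of ?q] q by simp
  moreover have "(\<integral>\<^sup>+x. ?q (?D (?T (?D' x))) \<partial>leb d) = \<delta>' * (t * (\<delta> * 1))"
    using \<delta>'[of "\<lambda>x. ?q (?D (?T x))"] t[of "\<lambda>x. ?q (?D x)"] \<delta>[of ?q] q by simp
  moreover have "?D (?T (?D' x)) = ?T (?T x)" for x
    using l m by (simp add: lin[OF m(1)] lin[OF l(1)] algebra_simps flip: scaleR_add_left)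
  ultimately have "t * t = \<delta>' * (t * \<delta>)" by simp
  also have "\<dots> = t" using dd' by (metis mult.assoc mult.commute mult_1)
  finally have "t * t * t' = t * t'" by simp
  then have "t = 1" using tt' by (simp add: mult.assoc)
  then show ?thesis using t by (simp add: preserves_leb_def)
qed (simp add: preserves_leb_def)

text \<open>Symplectic linear maps are composed of transvections: transvections act transitively on
  non-zero vectors and on vectors of fixed symplectic product with a given vector, so one can
  restore the standard basis pair by pair.  At stage \<open>k\<close> the first \<open>2 * k\<close> basis
  vectors are fixed.  Of the maps composed of transvections \<open>sp_elim\<close> keeps only a volume preserving
  left inverse, which is what transfers volume preservation.\<close>

definition sp_move :: "nat \<Rightarrow> nat \<Rightarrow> (rseq \<Rightarrow> rseq) \<Rightarrow> bool"
  where "sp_move N k T \<longleftrightarrow> bounded_linear T \<and> (\<forall>x\<in>Rn (2*N). T x \<in> Rn (2*N)) \<and>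
    (\<forall>x\<in>Rn (2*N). \<forall>y\<in>Rn (2*N). omega N (T x) (T y) = omega N x y) \<and>
    (\<forall>i<2*k. T (unit_vec i) = unit_vec i)"

definition sp_elim :: "nat \<Rightarrow> nat \<Rightarrow> (rseq \<Rightarrow> rseq) \<Rightarrow> bool"
  where "sp_elim N k T \<longleftrightarrow> sp_move N k T \<and>
    (\<exists>T'. T' \<in> borel_measurable borel \<and> preserves_leb (2*N) T' \<and> (\<forall>x\<in>Rn (2*N). T' (T x) = x))"

lemma sp_move_comp: "sp_move N k S \<Longrightarrow> sp_move N k T \<Longrightarrow> sp_move N k (\<lambda>x. S (T x))"
  using bounded_linear_compose[of S T] by (auto simp: sp_move_def o_def)

lemma sp_elim_comp:
  assumes "sp_elim N k S" "sp_elim N k T"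
  shows "sp_elim N k (\<lambda>x. S (T x))"
proof -
  obtain S' where S': "S' \<in> borel_measurable borel" "preserves_leb (2*N) S'" "\<And>x. x \<in> Rn (2*N) \<Longrightarrow> S' (S x) = x"
    using assms(1) by (auto simp: sp_elim_def)
  obtain T' where T': "T' \<in> borel_measurable borel" "preserves_leb (2*N) T'" "\<And>x. x \<in> Rn (2*N) \<Longrightarrow> T' (T x) = x"
    using assms(2) by (auto simp: sp_elim_def)
  have mv: "sp_move N k S" "sp_move N k T" using assms by (auto simp: sp_elim_def)
  have "preserves_leb (2*N) (\<lambda>x. T' (S' x))"
    unfolding preserves_leb_def
  proof
    fix f :: "rseq \<Rightarrow> ennreal" assume f: "f \<in> borel_measurable borel"
    have "(\<lambda>x. f (T' x)) \<in> borel_measurable borel" using f T'(1) by measurable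
    from preserves_lebD[OF S'(2) this] preserves_lebD[OF T'(2) f]
    show "(\<integral>\<^sup>+x. f (T' (S' x)) \<partial>leb (2*N)) = (\<integral>\<^sup>+x. f x \<partial>leb (2*N))" by simp
  qed
  moreover have "(\<lambda>x. T' (S' x)) \<in> borel_measurable borel" using S'(1) T'(1) by measurable
  moreover have "T' (S' (S (T x))) = x" if "x \<in> Rn (2*N)" for x
    using that mv S'(3) T'(3) by (simp add: sp_move_def)
  ultimately show ?thesis
    unfolding sp_elim_def using sp_move_comp[OF mv] by (intro conjI exI[of _ "\<lambda>x. T' (S' x)"]) auto
qed

text \<open>The symplectic complement of the first \<open>k\<close> coordinate planes.\<close>

definition tail_space :: "nat \<Rightarrow> nat \<Rightarrow> rseq set"
  where "tail_space N k = {x \<in> Rn (2*N). \<forall>i<2*k. coord x i = 0}"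

lemma tail_space_closed:
  "x \<in> tail_space N k \<Longrightarrow> y \<in> tail_space N k \<Longrightarrow> x + y \<in> tail_space N k"
  "x \<in> tail_space N k \<Longrightarrow> y \<in> tail_space N k \<Longrightarrow> x - y \<in> tail_space N k"
  by (auto simp: tail_space_def)

lemma omega_unit_vec:
  assumes "i < N"
  shows "omega N x (unit_vec (2*i)) = - coord x (2*i+1)" "omega N x (unit_vec (2*i+1)) = coord x (2*i)"
    "omega N (unit_vec (2*i)) x = coord x (2*i+1)" "omega N (unit_vec (2*i+1)) x = - coord x (2*i)"
proof -
  have J: "J_std N (unit_vec (2*i)) = unit_vec (2*i+1)"
    using assms by (intro Rn_eqI[of _ "2*N"]) (auto simp: J_std_def coord_vec_of, presburger+)
  have J': "J_std N (unit_vec (2*i+1)) = - unit_vec (2*i)"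
    using assms J_J[of "unit_vec (2*i)" N] by (simp add: J)
  show 1: "omega N x (unit_vec (2*i+1)) = coord x (2*i)"
    using omega_J_right[of N x "unit_vec (2*i)"] assms by (simp add: J eucl_inner_unit_vec)
  show 2: "omega N x (unit_vec (2*i)) = - coord x (2*i+1)"
    using omega_J_right[of N x "unit_vec (2*i+1)"] assms
    by (simp only: J' omega_uminus_right) (simp add: eucl_inner_unit_vec)
  show "omega N (unit_vec (2*i)) x = coord x (2*i+1)" "omega N (unit_vec (2*i+1)) x = - coord x (2*i)"
    using 1 2 omega_skew[of N "unit_vec (2*i)" x] omega_skew[of N "unit_vec (2*i+1)" x] by simp_all
qed

lemma omega_tail_unit_vec:
  assumes "k \<le> N" "u \<in> tail_space N k" "i < 2*k"
  shows "omega N u (unit_vec i) = 0"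
proof -
  define j where "j = i div 2"
  have "j < k" using assms(3) by (auto simp: j_def)
  then have j: "j < N" "2*j < 2*k" "2*j+1 < 2*k" using assms(1) by linarith+
  have "i = 2*j \<or> i = 2*j+1" by (auto simp: j_def)
  then show ?thesis using j assms(2) omega_unit_vec(1,2)[OF j(1), of u] by (auto simp: tail_space_def)
qed

lemma bounded_linear_omega: "bounded_linear (\<lambda>x. c * omega N u x)"
  by (intro bounded_linear_const_mult bounded_bilinear.bounded_linear_right[OF bilinear_omega])

lemma transvection_sp_elim:
  assumes "k \<le> N" "u \<in> tail_space N k"
  shows "sp_elim N k (\<lambda>x. x + (c * omega N u x) *\<^sub>R u)"
proof -
  have u: "u \<in> Rn (2*N)" using assms by (simp add: tail_space_def)
  have bl: "bounded_linear (\<lambda>x. x + (c * omega N u x) *\<^sub>R u)" for c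
    by (intro bounded_linear_add bounded_linear_ident bounded_linear_compose[OF bounded_linear_scaleR_left] bounded_linear_omega)
  have "omega N (x + (c * omega N u x) *\<^sub>R u) (y + (c * omega N u y) *\<^sub>R u) = omega N x y" for x y
    using omega_skew[of N x u] by (simp add: omega_bilinear)
  then have "sp_move N k (\<lambda>x. x + (c * omega N u x) *\<^sub>R u)"
    using u bl omega_tail_unit_vec[OF assms] by (auto simp: sp_move_def)
  moreover have "preserves_leb (2*N) (\<lambda>x. x + (- c * omega N u x) *\<^sub>R u)"
    by (rule transvection_preserves_leb[OF u bounded_linear_omega]) simp
  moreover have "(\<lambda>x. x + (- c * omega N u x) *\<^sub>R u) \<in> borel_measurable borel"
    by (rule bounded_linear_borel[OF bl])
  ultimately show ?thesis
    unfolding sp_elim_def by (intro conjI exI[of _ "\<lambda>x. x + (- c * omega N u x) *\<^sub>R u"])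
      (auto simp: omega_bilinear)
qed

lemma tail_space_nondegenerate:
  assumes "k \<le> N" "u \<in> tail_space N k" "u \<noteq> 0"
  obtains v where "v \<in> tail_space N k" "omega N u v \<noteq> 0"
proof -
  have u: "u \<in> Rn (2*N)" using assms by (simp add: tail_space_def)
  have "J_std N u \<in> tail_space N k"
    unfolding tail_space_def
  proof (intro CollectI conjI allI impI)
    fix i assume "i < 2*k"
    then have "i + 1 < 2*k" if "even i" using that by presburger
    then show "coord (J_std N u) i = 0"
      using assms \<open>i < 2*k\<close> by (auto simp: J_std_def coord_vec_of tail_space_def)
  qed simp
  moreover have "omega N u (J_std N u) \<noteq> 0"
    using eucl_inner_pos[OF u assms(3)] by (simp add: omega_J_right)
  ultimately show ?thesis using that by blast
qed

text \<open>The transvection along \<open>e' - e\<close> can be normalised to move \<open>e\<close> to \<open>e'\<close>; it fixes everything that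
  is symplectically orthogonal to its direction.\<close>

lemma sp_elim_transitive_step:
  assumes k: "k \<le> N" and e: "e \<in> tail_space N k" "e' \<in> tail_space N k" and \<omega>: "omega N e e' \<noteq> 0"
  obtains T where "sp_elim N k T" "T e = e'" "\<And>x. omega N (e' - e) x = 0 \<Longrightarrow> T x = x"
proof -
  let ?u = "e' - e"
  let ?c = "1 / omega N ?u e"
  have "omega N ?u e \<noteq> 0" using \<omega> omega_skew[of N e e'] by (simp add: omega_bilinear)
  then show ?thesis
    using that[OF transvection_sp_elim[OF k tail_space_closed(2)[OF e(2,1)], of ?c]] by simp
qed

text \<open>If \<open>e\<close> and \<open>e'\<close> are symplectically orthogonal, one moves through a vector that is orthogonal to
  neither.\<close>

lemma sp_elim_transitive:
  assumes k: "k \<le> N" and e: "e \<in> tail_space N k" "e \<noteq> 0" and e': "e' \<in> tail_space N k" "e' \<noteq> 0"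
  obtains T where "sp_elim N k T" "T e = e'"
proof (cases "omega N e e' = 0")
  case False
  then show ?thesis using sp_elim_transitive_step[OF k e(1) e'(1)] that by blast
next
  case True
  obtain g where g: "g \<in> tail_space N k" "omega N e g \<noteq> 0" "omega N g e' \<noteq> 0"
  proof -
    obtain v where v: "v \<in> tail_space N k" "omega N e v \<noteq> 0" using tail_space_nondegenerate[OF k e] by blast
    obtain v' where v': "v' \<in> tail_space N k" "omega N v' e' \<noteq> 0"
      using tail_space_nondegenerate[OF k e'] omega_skew[of N e'] by (metis neg_equal_0_iff_equal)
    show ?thesis
    proof (cases "omega N v e' = 0")
      case False
      then show ?thesis using v that by blast
    next
      case ve: True
      show ?thesis
      proof (cases "omega N e v' = 0")
        case False
        then show ?thesis using v' that by blast
      next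
        case True
        then show ?thesis
          using that[of "v + v'"] v v' ve tail_space_closed by (simp add: omega_bilinear)
      qed
    qed
  qed
  obtain T1 where T1: "sp_elim N k T1" "T1 e = g" using sp_elim_transitive_step[OF k e(1) g(1,2)] by blast
  obtain T2 where T2: "sp_elim N k T2" "T2 g = e'" using sp_elim_transitive_step[OF k g(1) e'(1) g(3)] by blast
  show ?thesis by (rule that[OF sp_elim_comp[OF T2(1) T1(1)]]) (simp add: T1 T2)
qed

text \<open>In the degenerate case the detour through \<open>f + e\<close> works: \<open>f\<close>, \<open>f + e\<close> and \<open>f'\<close> have the same
  product with \<open>e\<close>, so both transvections have a direction orthogonal to \<open>e\<close> and fix \<open>e\<close>.\<close>

lemma sp_elim_transitive_fixing:
  assumes k: "k \<le> N" and mem: "e \<in> tail_space N k" "f \<in> tail_space N k" "f' \<in> tail_space N k"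
    and \<omega>: "omega N e f = 1" "omega N e f' = 1"
  obtains T where "sp_elim N k T" "T f = f'" "T e = e"
proof (cases "omega N f f' = 0")
  case False
  obtain T where T: "sp_elim N k T" "T f = f'" "\<And>x. omega N (f' - f) x = 0 \<Longrightarrow> T x = x"
    using sp_elim_transitive_step[OF k mem(2,3) False] by blast
  have "omega N (f' - f) e = 0" using \<omega> omega_skew[of N f e] omega_skew[of N f' e] by (simp add: omega_bilinear)
  then show ?thesis using that T by blast
next
  case True
  have s: "omega N f e = -1" "omega N f' e = -1" using \<omega> omega_skew[of N f e] omega_skew[of N f' e] by auto
  let ?g = "f + e"
  have g: "?g \<in> tail_space N k" using mem tail_space_closed by blast
  have 1: "omega N f ?g \<noteq> 0" using s by (simp add: omega_bilinear)
  have 2: "omega N ?g f' \<noteq> 0" using True \<omega> by (simp add: omega_bilinear)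
  obtain T1 where T1: "sp_elim N k T1" "T1 f = ?g" "\<And>x. omega N (?g - f) x = 0 \<Longrightarrow> T1 x = x"
    using sp_elim_transitive_step[OF k mem(2) g 1] by blast
  obtain T2 where T2: "sp_elim N k T2" "T2 ?g = f'" "\<And>x. omega N (f' - ?g) x = 0 \<Longrightarrow> T2 x = x"
    using sp_elim_transitive_step[OF k g mem(3) 2] by blast
  have "T1 e = e" by (rule T1(3)) simp
  moreover have "T2 e = e" by (rule T2(3)) (use s in \<open>simp add: omega_bilinear\<close>)
  ultimately show ?thesis
    using that[OF sp_elim_comp[OF T2(1) T1(1)]] T1(2) T2(2) by simp
qed

lemma sp_move_tail_space:
  assumes k: "k \<le> N" and S: "sp_move N k S" and x: "x \<in> tail_space N k"
  shows "S x \<in> tail_space N k"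
  unfolding tail_space_def
proof (intro CollectI conjI allI impI)
  have xRn: "x \<in> Rn (2*N)" using x by (simp add: tail_space_def)
  then show "S x \<in> Rn (2*N)" using S by (simp add: sp_move_def)
  fix i assume i: "i < 2*k"
  define j where "j = i div 2"
  have "j < k" using i by (auto simp: j_def)
  then have j: "j < N" "2*j < 2*k" "2*j+1 < 2*k" using k by linarith+
  have ij: "i = 2*j \<or> i = 2*j+1" by (auto simp: j_def)
  have "omega N (S x) (unit_vec l) = 0" if l: "l < 2*k" for l
  proof -
    have "unit_vec l \<in> Rn (2*N)" using l k by (intro Rn_unit_vec) simp
    then have "omega N (S x) (S (unit_vec l)) = omega N x (unit_vec l)"
      using S xRn by (simp add: sp_move_def)
    then show ?thesis using S l omega_tail_unit_vec[OF k x l] by (simp add: sp_move_def)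
  qed
  from this[OF j(2)] this[OF j(3)] show "coord (S x) i = 0"
    using omega_unit_vec(1,2)[OF j(1), of "S x"] ij by auto
qed

text \<open>Composing \<open>A\<close> with transvections that bring the images of the next basis pair back to that pair
  gives a map that fixes one pair more.  The transvections have volume preserving left inverses, so
  the claim for the composition implies it for \<open>A\<close>; once all pairs are fixed the map is the
  identity.\<close>

lemma sp_move_preserves_leb:
  assumes "k \<le> N" "sp_move N k A"
  shows "preserves_leb (2*N) A"
  using assms
proof (induction "N - k" arbitrary: k A)
  case 0
  then have k: "k = N" by simp
  have lin: "linear A" using 0 by (simp add: sp_move_def bounded_linear.linear)
  have "A x = x" if x: "x \<in> Rn (2*N)" for x
  proof -
    have "A x = A (\<Sum>i<2*N. coord x i *\<^sub>R unit_vec i)" using Rn_expansion[OF x] by simp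
    also have "\<dots> = (\<Sum>i<2*N. coord x i *\<^sub>R A (unit_vec i))"
      by (simp add: linear_sum[OF lin] linear_scale[OF lin])
    also have "\<dots> = (\<Sum>i<2*N. coord x i *\<^sub>R unit_vec i)"
      using 0(3) k by (intro sum.cong) (auto simp: sp_move_def)
    finally show ?thesis using Rn_expansion[OF x] by simp
  qed
  then show ?case unfolding preserves_leb_def by (intro ballI nn_integral_leb_cong) simp
next
  case (Suc n)
  then have kN: "k < N" by simp
  have A: "bounded_linear A" "\<And>x. x \<in> Rn (2*N) \<Longrightarrow> A x \<in> Rn (2*N)"
    "\<And>x y. x \<in> Rn (2*N) \<Longrightarrow> y \<in> Rn (2*N) \<Longrightarrow> omega N (A x) (A y) = omega N x y"
    "\<And>i. i < 2*k \<Longrightarrow> A (unit_vec i) = unit_vec i"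
    using Suc.prems by (auto simp: sp_move_def)
  let ?p = "unit_vec (2*k)" and ?q = "unit_vec (2*k+1)"
  have e0Rn: "?p \<in> Rn (2*N)" "?q \<in> Rn (2*N)" using kN by auto
  note tail = sp_move_tail_space[OF less_imp_le[OF kN] Suc.prems(2)]
  have t0: "?p \<in> tail_space N k" "?q \<in> tail_space N k" using e0Rn by (auto simp: tail_space_def)
  have w0: "omega N ?p ?q = 1" using omega_unit_vec(2)[OF kN, of ?p] by simp
  let ?e = "A ?p" and ?f = "A ?q"
  have w: "omega N ?e ?f = 1" using A(3)[OF e0Rn] w0 by simp
  then have "?e \<noteq> 0" by auto
  moreover have "?p \<noteq> 0" using w0 by auto
  ultimately obtain T1 where T1: "sp_elim N k T1" "T1 ?e = ?p"
    using sp_elim_transitive[OF less_imp_le[OF kN] tail[OF t0(1)] _ t0(1)] by blast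
  have T1m: "sp_move N k T1" using T1 by (simp add: sp_elim_def)
  have T1A: "sp_move N k (\<lambda>x. T1 (A x))" by (rule sp_move_comp[OF T1m Suc.prems(2)])
  have w1: "omega N ?p (T1 ?f) = 1"
    using T1A w0 e0Rn T1(2) unfolding sp_move_def by metis
  have T1f: "T1 ?f \<in> tail_space N k"
    by (rule sp_move_tail_space[OF less_imp_le[OF kN] T1m tail[OF t0(2)]])
  obtain T2 where T2: "sp_elim N k T2" "T2 (T1 ?f) = ?q" "T2 ?p = ?p"
    using sp_elim_transitive_fixing[OF less_imp_le[OF kN] t0(1) T1f t0(2) w1 w0] by blast
  define T where "T x = T2 (T1 x)" for x
  have T: "sp_elim N k T" unfolding T_def[abs_def] by (rule sp_elim_comp[OF T2(1) T1(1)])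
  have TA: "sp_move N k (\<lambda>x. T (A x))"
    by (rule sp_move_comp[OF _ Suc.prems(2)]) (use T in \<open>simp add: sp_elim_def\<close>)
  have "T (A (unit_vec i)) = unit_vec i" if "i < 2 * Suc k" for i
  proof -
    consider "i < 2*k" | "i = 2*k" | "i = 2*k+1" using \<open>i < 2 * Suc k\<close> by fastforce
    then show ?thesis
    proof cases
      case 1
      then show ?thesis using TA by (simp add: sp_move_def)
    next
      case 2
      then show ?thesis using T1(2) T2(3) by (simp add: T_def)
    next
      case 3
      then show ?thesis using T2(2) by (simp add: T_def)
    qed
  qed
  then have "sp_move N (Suc k) (\<lambda>x. T (A x))" using TA by (auto simp: sp_move_def)
  then have TAp: "preserves_leb (2*N) (\<lambda>x. T (A x))"
    using Suc.hyps(1)[of "Suc k"] Suc.hyps(2) kN by simp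
  obtain T' where T': "T' \<in> borel_measurable borel" "preserves_leb (2*N) T'" "\<And>x. x \<in> Rn (2*N) \<Longrightarrow> T' (T x) = x"
    using T by (auto simp: sp_elim_def)
  show ?case
    unfolding preserves_leb_def
  proof
    fix f :: "rseq \<Rightarrow> ennreal" assume f: "f \<in> borel_measurable borel"
    have fT': "(\<lambda>x. f (T' x)) \<in> borel_measurable borel" using f T'(1) by measurable
    have "(\<integral>\<^sup>+x. f (A x) \<partial>leb (2*N)) = (\<integral>\<^sup>+x. f (T' (T (A x))) \<partial>leb (2*N))"
      using A(2) T'(3) by (intro nn_integral_leb_cong) simp
    also have "\<dots> = (\<integral>\<^sup>+x. f (T' x) \<partial>leb (2*N))" by (rule preserves_lebD[OF TAp fT'])
    also have "\<dots> = (\<integral>\<^sup>+x. f x \<partial>leb (2*N))" by (rule preserves_lebD[OF T'(2) f])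
    finally show "(\<integral>\<^sup>+x. f (A x) \<partial>leb (2*N)) = (\<integral>\<^sup>+x. f x \<partial>leb (2*N))" .
  qed
qed

lemma symplectic_linear_preserves_leb:
  assumes "bounded_linear A" "\<And>x. x \<in> Rn (2*N) \<Longrightarrow> A x \<in> Rn (2*N)"
    "\<And>x y. x \<in> Rn (2*N) \<Longrightarrow> y \<in> Rn (2*N) \<Longrightarrow> omega N (A x) (A y) = omega N x y"
  shows "preserves_leb (2*N) A"
  by (rule sp_move_preserves_leb[of 0]) (use assms in \<open>auto simp: sp_move_def\<close>)

section \<open>The volume of a symplectic image of a ball\<close>

lemma eucl_inner_le_norm: "x \<in> Rn d \<Longrightarrow> sqrt (eucl_inner d x x) \<le> norm x"
proof -
  assume x: "x \<in> Rn d"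
  have "eucl_inner d x x \<le> (\<Sum>i<d. norm x * \<bar>coord x i\<bar>)"
    unfolding eucl_inner_def
  proof (rule sum_mono)
    fix i
    have "coord x i * coord x i = \<bar>coord x i\<bar> * \<bar>coord x i\<bar>" by simp
    also have "\<dots> \<le> norm x * \<bar>coord x i\<bar>" by (intro mult_right_mono abs_coord_le_norm) auto
    finally show "coord x i * coord x i \<le> norm x * \<bar>coord x i\<bar>" .
  qed
  also have "\<dots> = norm x * norm x" by (simp add: sum_distrib_left[symmetric] norm_eq_sum_coord[OF x])
  finally have "sqrt (eucl_inner d x x) \<le> sqrt (norm x * norm x)" by (rule real_sqrt_le_mono)
  then show ?thesis by simp
qed

lemma eucl_norm_triangle:
  "sqrt (eucl_inner d (x + y) (x + y)) \<le> sqrt (eucl_inner d x x) + sqrt (eucl_inner d y y)"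
  using L2_set_triangle_ineq[of "coord x" "coord y" "{..<d}"]
  by (simp add: L2_set_def eucl_inner_def power2_eq_square)

lemma norm_le_coord_bound:
  assumes "x \<in> Rn d" "\<And>i. i < d \<Longrightarrow> \<bar>coord x i\<bar> \<le> c"
  shows "norm x \<le> real d * c"
  using sum_bounded_above[of "{..<d}" "\<lambda>i. \<bar>coord x i\<bar>" c] assms by (simp add: norm_eq_sum_coord)

lemma abs_coord_le_eucl_norm: "i < d \<Longrightarrow> \<bar>coord x i\<bar> \<le> sqrt (eucl_inner d x x)"
proof -
  assume i: "i < d"
  have "(coord x i)\<^sup>2 \<le> eucl_inner d x x"
    unfolding eucl_inner_def power2_eq_square using i by (intro member_le_sum) auto
  then show ?thesis by (metis real_sqrt_abs real_sqrt_le_mono)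
qed

lemma eucl_ball_Rn: "eucl_ball d a r \<subseteq> Rn d"
  by (auto simp: eucl_ball_def)

lemma closed_eucl_ball: "closed (eucl_ball d a r)"
proof -
  have "eucl_ball d a r = Rn d \<inter> {x. sqrt (eucl_inner d (x - a) (x - a)) \<le> r}" by (auto simp: eucl_ball_def)
  moreover have "closed {x. sqrt (eucl_inner d (x - a) (x - a)) \<le> r}"
    by (intro closed_Collect_le continuous_intros)
  ultimately show ?thesis by (simp add: closed_Int)
qed

lemma eucl_ball_borel [measurable]: "eucl_ball d a r \<in> sets borel"
  using closed_eucl_ball by (rule borel_closed)

lemma bounded_eucl_ball:
  assumes "a \<in> Rn d" "x \<in> eucl_ball d a r"
  shows "\<bar>coord x i\<bar> \<le> norm a + \<bar>r\<bar>"
proof (cases "i < d")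
  case True
  have "\<bar>coord (x - a) i\<bar> \<le> r"
    using abs_coord_le_eucl_norm[OF True, of "x - a"] assms(2) by (auto simp: eucl_ball_def)
  then have "\<bar>coord x i\<bar> \<le> \<bar>coord a i\<bar> + r" by simp
  then show ?thesis using abs_coord_le_norm[of a i] by simp
next
  case False
  then show ?thesis using assms by (auto simp: eucl_ball_def Rn_def)
qed

lemma emeasure_eucl_ball_finite: "a \<in> Rn d \<Longrightarrow> emeasure (leb d) (eucl_ball d a r) < \<infinity>"
  using bounded_eucl_ball by (intro emeasure_leb_bounded_finite[of _ _ "norm a + \<bar>r\<bar>"])

lemma emeasure_eucl_ball_scale:
  assumes a: "a \<in> Rn d" and r: "0 < r"
  shows "emeasure (leb d) (eucl_ball d a r) = ennreal (r ^ d) * emeasure (leb d) (eucl_ball d 0 1)"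
proof -
  have "emeasure (leb d) (eucl_ball d a r) = (\<integral>\<^sup>+x. indicator (eucl_ball d a r) x \<partial>leb d)" by simp
  also have "\<dots> = (\<integral>\<^sup>+x. indicator (eucl_ball d a r) (x + a) \<partial>leb d)"
    by (rule nn_integral_leb_translate[symmetric]) (use a in auto)
  also have "\<dots> = (\<integral>\<^sup>+x. indicator ((*\<^sub>R) r ` eucl_ball d 0 1) x \<partial>leb d)"
  proof (rule nn_integral_leb_cong)
    fix x assume x: "x \<in> Rn d"
    have "x + a \<in> eucl_ball d a r \<longleftrightarrow> (1/r) *\<^sub>R x \<in> eucl_ball d 0 1"
    proof -
      have "sqrt (eucl_inner d ((1/r) *\<^sub>R x) ((1/r) *\<^sub>R x)) = sqrt (eucl_inner d x x) / r"
        using r by (simp add: eucl_inner_bilinear real_sqrt_divide real_sqrt_mult)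
      then have "sqrt (eucl_inner d ((1/r) *\<^sub>R x) ((1/r) *\<^sub>R x)) \<le> 1 \<longleftrightarrow> sqrt (eucl_inner d x x) \<le> r"
        using r by (simp only: pos_divide_le_eq mult_1)
      moreover have "x + a \<in> Rn d" "(1/r) *\<^sub>R x \<in> Rn d" using x a by auto
      ultimately show ?thesis
        by (simp only: eucl_ball_def mem_Collect_eq add_diff_cancel diff_zero simp_thms)
    qed
    moreover have "(1/r) *\<^sub>R x \<in> eucl_ball d 0 1 \<longleftrightarrow> x \<in> (*\<^sub>R) r ` eucl_ball d 0 1"
      using r by (auto intro!: image_eqI[of x _ "(1/r) *\<^sub>R x"])
    ultimately show "indicator (eucl_ball d a r) (x + a) = (indicator ((*\<^sub>R) r ` eucl_ball d 0 1) x :: ennreal)"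
      by (simp add: indicator_def)
  qed
  also have "\<dots> = emeasure (leb d) ((*\<^sub>R) r ` eucl_ball d 0 1)"
  proof (rule nn_integral_indicator)
    have "closed ((*\<^sub>R) r ` eucl_ball d 0 1)" by (intro closed_scaling closed_eucl_ball)
    then show "(*\<^sub>R) r ` eucl_ball d 0 1 \<in> sets (leb d)" by (simp add: borel_closed)
  qed
  also have "\<dots> = ennreal (r ^ d) * emeasure (leb d) (eucl_ball d 0 1)"
    by (rule emeasure_scale[OF r eucl_ball_borel eucl_ball_Rn])
  finally show ?thesis .
qed

context symplectic_ball_image
begin

text \<open>On a small cube the map \<open>\<phi>\<close> is close to its symplectic, hence volume preserving,
  differential, so it enlarges the volume of the cube by a factor close to one.\<close>

lemma small_cube_image:
  assumes K: "compact K" "K \<subseteq> Rn d" and \<eta>: "0 < \<eta>"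
  obtains h\<^sub>0 where "h\<^sub>0 > 0"
    "\<And>x h. \<lbrakk>x \<in> K; 0 < h; h < h\<^sub>0\<rbrakk> \<Longrightarrow>
      emeasure (leb d) {z \<in> Rn d. x - \<psi> z \<in> cube d 0 h} \<le> ennreal (((1 + 2 * \<eta>) * h) ^ d)"
proof -
  obtain R where R: "\<And>x. x \<in> K \<Longrightarrow> norm x \<le> R"
    using compact_imp_bounded[OF K(1)] by (auto simp: bounded_iff)
  define K' where "K' = {x \<in> Rn d. \<forall>i. \<bar>coord x i\<bar> \<le> R + 1}"
  have K': "compact K'" unfolding K'_def by (rule compact_cube)
  have K'_sub: "K' \<subseteq> Rn d" by (auto simp: K'_def)
  have "compact (\<phi> ` K)" "\<phi> ` K \<subseteq> Rn d"
    using K continuous_on_subset[OF Ck_continuous[OF Ck_\<phi>[of 0]] K(2)]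
    by (auto intro: compact_continuous_image)
  then obtain M where M: "M > 0" "\<And>x v. x \<in> K \<Longrightarrow> norm (D\<psi> (\<phi> x) v) \<le> M * norm v"
    using differential_bound_on_compact[OF Ck_\<psi>[of "Suc 0"]] by (metis imageI)
  (* With this oscillation of the derivatives the error of the linear approximation on a cube of
     side h stays below \<eta> h after applying D\<psi>, whose norm is at most M. *)
  define \<epsilon> where "\<epsilon> = \<eta> / (M * (real d + 1))"
  have \<epsilon>: "\<epsilon> > 0" using \<eta> M(1) by (simp add: \<epsilon>_def)
  have "\<exists>\<delta>>0. \<forall>x\<in>K'. \<forall>y\<in>K'. dist y x < \<delta> \<longrightarrow> dist (partial i \<phi> y) (partial i \<phi> x) < \<epsilon>" if "i < d" for i
  proof -
    have "continuous_on K' (partial i \<phi>)"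
      using continuous_on_subset[OF Ck_continuous[OF Ck_partial[OF Ck_\<phi>[of "Suc 0"] that]] K'_sub] .
    then have "uniformly_continuous_on K' (partial i \<phi>)" by (rule compact_uniformly_continuous[OF _ K'])
    then show ?thesis using \<epsilon> unfolding uniformly_continuous_on_def by blast
  qed
  then obtain \<delta> where \<delta>: "\<And>i. i < d \<Longrightarrow> \<delta> i > 0"
    "\<And>i x y. \<lbrakk>i < d; x \<in> K'; y \<in> K'; dist y x < \<delta> i\<rbrakk> \<Longrightarrow> dist (partial i \<phi> y) (partial i \<phi> x) < \<epsilon>" by metis
  define \<delta>\<^sub>0 where "\<delta>\<^sub>0 = Min (insert 1 (\<delta> ` {..<d}))"
  have \<delta>0: "\<delta>\<^sub>0 > 0" "\<delta>\<^sub>0 \<le> 1" "\<And>i. i < d \<Longrightarrow> \<delta>\<^sub>0 \<le> \<delta> i" using \<delta>(1) by (auto simp: \<delta>\<^sub>0_def)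
  define h\<^sub>0 where "h\<^sub>0 = \<delta>\<^sub>0 / (real d + 1)"
  show ?thesis
  proof (rule that[of h\<^sub>0])
    show "h\<^sub>0 > 0" using \<delta>0 by (simp add: h\<^sub>0_def)
    fix x h assume x: "x \<in> K" and h: "0 < h" "h < h\<^sub>0"
    have xRn: "x \<in> Rn d" using x K by auto
    have dh: "real d * h < \<delta>\<^sub>0"
    proof -
      have "real d * h \<le> (real d + 1) * h" using h by (simp add: algebra_simps)
      also have "\<dots> < \<delta>\<^sub>0" using h by (simp add: h\<^sub>0_def pos_less_divide_eq mult.commute)
      finally show ?thesis .
    qed
    (* The reflected cube, enlarged by \<eta> h on each side. *)
    let ?Q = "cube d (- (h + \<eta> * h)) (\<eta> * h)"
    have incl: "D\<psi> (\<phi> x) (z - \<phi> x) \<in> ?Q" if z: "z \<in> Rn d" "x - \<psi> z \<in> cube d 0 h" for z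
    proof -
      define v where "v = \<psi> z - x"
      have v: "v \<in> Rn d" "\<And>i. i < d \<Longrightarrow> - h < coord v i \<and> coord v i \<le> 0"
        using z xRn by (auto simp: v_def cube_def)
      have "\<bar>coord v i\<bar> \<le> h" if "i < d" for i using v(2)[OF that] by auto
      then have nv: "norm v \<le> real d * h" using v(1) by (intro norm_le_coord_bound)
      have ball: "y \<in> K'" if "y \<in> Rn d" "norm (y - x) \<le> norm v" for y
      proof -
        have "norm y \<le> norm x + norm (y - x)" using norm_triangle_ineq[of x "y - x"] by simp
        also have "\<dots> \<le> R + 1" using R[OF x] that nv dh \<delta>0 by linarith
        finally show ?thesis
          unfolding K'_def using that(1) abs_coord_le_norm order_trans by blast
      qed
      have xK': "x \<in> K'" using ball[OF xRn] by simp
      have "norm (\<phi> (x + v) - \<phi> x - D\<phi> x v) \<le> \<epsilon> * norm v"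
      proof (rule linear_approximation_bound[OF Ck_\<phi>[of "Suc 0"] xRn v(1)])
        fix i y assume i: "i < d" and y: "y \<in> Rn d" "norm (y - x) \<le> norm v"
        have "dist y x < \<delta> i" using y nv dh \<delta>0(3)[OF i] by (simp add: dist_norm)
        then show "norm (partial i \<phi> y - partial i \<phi> x) \<le> \<epsilon>"
          using \<delta>(2)[OF i xK' ball[OF y]] by (simp add: dist_norm)
      qed
      moreover have "\<phi> (x + v) = z" using z by (simp add: v_def)
      ultimately have app: "norm (z - \<phi> x - D\<phi> x v) \<le> \<epsilon> * (real d * h)"
        using nv \<epsilon> by (meson less_imp_le mult_left_mono order_trans)
      define w where "w = D\<psi> (\<phi> x) (z - \<phi> x) - v"
      have "w = D\<psi> (\<phi> x) (z - \<phi> x - D\<phi> x v)"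
        using xRn v by (simp add: w_def differential_diff)
      then have "norm w \<le> M * norm (z - \<phi> x - D\<phi> x v)" using M(2)[OF x] by simp
      also have "\<dots> \<le> M * (\<epsilon> * (real d * h))" using app M(1) by (intro mult_left_mono) auto
      also have "\<dots> < M * (\<epsilon> * ((real d + 1) * h))" using \<epsilon> h M(1) by simp
      also have "\<dots> = \<eta> * h" using M(1) by (simp add: \<epsilon>_def)
      finally have nw: "norm w < \<eta> * h" .
      have "- (h + \<eta> * h) \<le> coord (v + w) i \<and> coord (v + w) i < \<eta> * h" if "i < d" for i
        using v(2)[OF that] abs_coord_le_norm[of w i] nw by auto
      moreover have "v + w = D\<psi> (\<phi> x) (z - \<phi> x)" by (simp add: w_def)
      ultimately show ?thesis by (simp add: cube_def)
    qed
    have bl: "bounded_linear (D\<psi> (\<phi> x))" by (rule bounded_linear_differential)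
    have [measurable]: "D\<psi> (\<phi> x) \<in> borel_measurable borel" by (rule bounded_linear_borel[OF bl])
    have pres: "preserves_leb d (D\<psi> (\<phi> x))"
      by (rule symplectic_linear_preserves_leb[OF bl]) (use xRn in auto)
    have mD [measurable]: "(\<lambda>z. D\<psi> (\<phi> x) (z - \<phi> x)) \<in> borel_measurable borel"
      by (intro borel_measurable_continuous_onI bounded_linear.continuous_on[OF bl] continuous_intros)
    have "emeasure (leb d) {z \<in> Rn d. x - \<psi> z \<in> cube d 0 h}
        \<le> emeasure (leb d) {z. D\<psi> (\<phi> x) (z - \<phi> x) \<in> ?Q}"
      using incl by (intro emeasure_mono) auto
    also have "\<dots> = (\<integral>\<^sup>+z. indicator ?Q (D\<psi> (\<phi> x) (z - \<phi> x)) \<partial>leb d)"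
    proof -
      have "{z. D\<psi> (\<phi> x) (z - \<phi> x) \<in> ?Q} \<in> sets (leb d)"
        using measurable_sets_borel[OF mD cube_borel] by (simp add: vimage_def)
      from nn_integral_indicator[OF this]
      have "emeasure (leb d) {z. D\<psi> (\<phi> x) (z - \<phi> x) \<in> ?Q} = (\<integral>\<^sup>+z. indicator {z. D\<psi> (\<phi> x) (z - \<phi> x) \<in> ?Q} z \<partial>leb d)"
        by (rule sym)
      also have "\<dots> = (\<integral>\<^sup>+z. indicator ?Q (D\<psi> (\<phi> x) (z - \<phi> x)) \<partial>leb d)"
        by (intro nn_integral_cong) (simp add: indicator_def)
      finally show ?thesis .
    qed
    also have "\<dots> = (\<integral>\<^sup>+z. indicator ?Q (D\<psi> (\<phi> x) z) \<partial>leb d)"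
      using nn_integral_leb_translate[of "\<lambda>z. indicator ?Q (D\<psi> (\<phi> x) z)" "- \<phi> x" d] xRn by simp
    also have "\<dots> = (\<integral>\<^sup>+z. indicator ?Q z \<partial>leb d)" by (rule preserves_lebD[OF pres]) measurable
    also have "\<dots> = ennreal (((1 + 2 * \<eta>) * h) ^ d)"
    proof -
      have "0 \<le> \<eta> * h" using h \<eta> by simp
      then have "- (h + \<eta> * h) \<le> \<eta> * h" using h by linarith
      moreover have "\<eta> * h - (- (h + \<eta> * h)) = (1 + 2 * \<eta>) * h" by (simp add: algebra_simps)
      ultimately show ?thesis using emeasure_cube[of "- (h + \<eta> * h)" "\<eta> * h" d] by simp
    qed
    finally show "emeasure (leb d) {z \<in> Rn d. x - \<psi> z \<in> cube d 0 h} \<le> ennreal (((1 + 2 * \<eta>) * h) ^ d)" .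
  qed
qed

lemma body_closed: "closed body"
proof -
  have "body = {z \<in> Rn d. level z \<in> {..r\<^sup>2}}" by (auto simp: body_iff)
  also have "\<dots> = Rn d \<inter> level -` {..r\<^sup>2}" by auto
  also have "closed \<dots>" by (rule continuous_closed_preimage[OF level_continuous]) auto
  finally show ?thesis .
qed

lemma body_borel [measurable]: "body \<in> sets borel"
  using body_closed by (rule borel_closed)

lemma body_Rn: "body \<subseteq> Rn d"
  by (auto simp: body_iff)

text \<open>Averaging over all positions of a small cube, Fubini's theorem compares the volume of the
  body with the volume of a slightly larger ball, up to the distortion on small cubes.\<close>

lemma emeasure_body_le_approx:
  assumes \<eta>: "0 < \<eta>"
  shows "emeasure (leb d) body \<le> ennreal ((1 + 2 * \<eta>) ^ d * (r * (1 + \<eta>)) ^ d) * emeasure (leb d) (eucl_ball d 0 1)"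
proof -
  define b where "b = eucl_ball d a (r * (1 + \<eta>))"
  have b_sub: "b \<subseteq> Rn d" unfolding b_def by (rule eucl_ball_Rn)
  have "compact b"
  proof (rule compact_Rn[OF _ b_sub])
    show "closed b" by (simp add: b_def closed_eucl_ball)
    show "bounded b"
      unfolding bounded_iff
    proof (intro exI ballI)
      fix x assume x: "x \<in> b"
      show "norm x \<le> real d * (norm a + \<bar>r * (1 + \<eta>)\<bar>)"
        using x b_sub bounded_eucl_ball[OF centre x[unfolded b_def]] by (intro norm_le_coord_bound) auto
    qed
  qed
  then obtain h\<^sub>0 where h0: "h\<^sub>0 > 0" "\<And>x h. \<lbrakk>x \<in> b; 0 < h; h < h\<^sub>0\<rbrakk> \<Longrightarrow>
      emeasure (leb d) {z \<in> Rn d. x - \<psi> z \<in> cube d 0 h} \<le> ennreal (((1 + 2 * \<eta>) * h) ^ d)"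
    using small_cube_image[OF _ b_sub \<eta>] by blast
  (* The second bound keeps every cube that starts at a point of the ball inside b. *)
  define h where "h = min (h\<^sub>0 / 2) (r * \<eta> / (real d + 1))"
  have h: "0 < h" "h < h\<^sub>0" using h0(1) radius \<eta> by (auto simp: h_def)
  have dh: "real d * h \<le> r * \<eta>"
  proof -
    have "real d * h \<le> (real d + 1) * (r * \<eta> / (real d + 1))"
      using h radius \<eta> by (intro mult_mono) (auto simp: h_def)
    also have "\<dots> = r * \<eta>" by (simp add: add_nonneg_pos)
    finally show ?thesis .
  qed
  (* A Borel function on the whole space that agrees with \<psi> on Rn d. *)
  define \<Psi> where "\<Psi> z = vec_of d (\<lambda>i. if z \<in> Rn d then coord (\<psi> z) i else 0)" for z
  have \<Psi>: "\<Psi> z = \<psi> z" if "z \<in> Rn d" for z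
    using that by (intro Rn_eqI[of _ d]) (auto simp: \<Psi>_def coord_vec_of)
  have c\<Psi> [measurable]: "(\<lambda>z. coord (\<Psi> z) i) \<in> borel_measurable borel" for i
  proof -
    have "(\<lambda>z. if z \<in> Rn d then coord (\<psi> z) i else 0) \<in> borel_measurable borel" for i
      by (intro borel_measurable_continuous_on_if continuous_on_const coord_continuous Ck_continuous[OF Ck_\<psi>[of 0]]) auto
    then have "\<Psi> \<in> borel_measurable borel"
      unfolding \<Psi>_def by (intro measurable_vec_of)
    then show ?thesis by measurable
  qed
  let ?q = "indicator (cube d 0 h) :: rseq \<Rightarrow> ennreal"
  let ?F = "\<lambda>x z. indicator b x * ?q (vec_of d (\<lambda>i. coord x i - coord (\<Psi> z) i))"
  have b_meas [measurable]: "b \<in> sets borel" by (simp add: b_def)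
  interpret L: sigma_finite_measure "leb d" by (rule sigma_finite_leb)
  interpret pair_sigma_finite "leb d" "leb d" ..
  have [measurable]: "(\<lambda>p. vec_of d (\<lambda>i. coord (fst p) i - coord (\<Psi> (snd p)) i)) \<in> borel_measurable (leb d \<Otimes>\<^sub>M leb d)"
    by (rule measurable_vec_of) measurable
  have diff: "vec_of d (\<lambda>i. coord x i - coord (\<Psi> z) i) = x - \<psi> z" if "z \<in> Rn d" "x \<in> Rn d" for z x
    using that by (intro Rn_eqI[of _ d]) (auto simp: coord_vec_of \<Psi>)
  have "ennreal (h ^ d) * emeasure (leb d) body = (\<integral>\<^sup>+z. ennreal (h ^ d) * indicator body z \<partial>leb d)"
    by (simp add: nn_integral_cmult)
  also have "\<dots> \<le> (\<integral>\<^sup>+z. (\<integral>\<^sup>+x. ?F x z \<partial>leb d) \<partial>leb d)"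
  proof (rule nn_integral_mono_AE, use AE_leb_Rn[of d] in eventually_elim)
    case (elim z)
    show "ennreal (h ^ d) * indicator body z \<le> (\<integral>\<^sup>+x. ?F x z \<partial>leb d)"
    proof (cases "z \<in> body")
      case True
      have zRn: "z \<in> Rn d" "sqrt (eucl_inner d (\<psi> z - a) (\<psi> z - a)) \<le> r"
        using True radius by (auto simp: body_iff level_def intro: real_le_lsqrt)
      have "ennreal (h ^ d) = (\<integral>\<^sup>+x. ?q x \<partial>leb d)" using emeasure_cube[of 0 h d] h by simp
      also have "\<dots> = (\<integral>\<^sup>+x. ?q (x + (- \<psi> z)) \<partial>leb d)"
        by (rule nn_integral_leb_translate[symmetric]) (use zRn in auto)
      also have "\<dots> = (\<integral>\<^sup>+x. ?F x z \<partial>leb d)"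
      proof (rule nn_integral_leb_cong)
        fix x assume x: "x \<in> Rn d"
        have "x \<in> b" if c: "x - \<psi> z \<in> cube d 0 h"
        proof -
          have "norm (x - \<psi> z) \<le> real d * h"
            using x zRn c by (intro norm_le_coord_bound) (auto simp: cube_def abs_if less_imp_le)
          then have "sqrt (eucl_inner d (x - \<psi> z) (x - \<psi> z)) \<le> r * \<eta>"
            using eucl_inner_le_norm[of "x - \<psi> z" d] x zRn dh by auto
          then have "sqrt (eucl_inner d (x - a) (x - a)) \<le> r * \<eta> + r"
            using eucl_norm_triangle[of d "x - \<psi> z" "\<psi> z - a"] zRn(2) by simp
          then show ?thesis using x by (simp add: b_def eucl_ball_def algebra_simps)
        qed
        then show "?q (x + (- \<psi> z)) = ?F x z"
          using x zRn by (auto simp: diff indicator_def)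
      qed
      finally show ?thesis using True by simp
    qed simp
  qed
  also have "\<dots> = (\<integral>\<^sup>+x. (\<integral>\<^sup>+z. ?F x z \<partial>leb d) \<partial>leb d)"
    by (rule Fubini') measurable
  also have "\<dots> \<le> (\<integral>\<^sup>+x. ennreal (((1 + 2 * \<eta>) * h) ^ d) * indicator b x \<partial>leb d)"
  proof (rule nn_integral_mono)
    fix x
    show "(\<integral>\<^sup>+z. ?F x z \<partial>leb d) \<le> ennreal (((1 + 2 * \<eta>) * h) ^ d) * indicator b x"
    proof (cases "x \<in> b")
      case True
      have xRn: "x \<in> Rn d" using True b_sub by auto
      have mz: "(\<lambda>z. vec_of d (\<lambda>i. coord x i - coord (\<Psi> z) i)) \<in> borel_measurable borel"
        by (rule measurable_vec_of) measurable
      have "(\<integral>\<^sup>+z. ?F x z \<partial>leb d) = (\<integral>\<^sup>+z. indicator {z \<in> Rn d. x - \<psi> z \<in> cube d 0 h} z \<partial>leb d)"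
        using True xRn by (intro nn_integral_leb_cong) (auto simp: diff indicator_def)
      also have "\<dots> = emeasure (leb d) {z \<in> Rn d. x - \<psi> z \<in> cube d 0 h}"
      proof (rule nn_integral_indicator)
        have "{z \<in> Rn d. x - \<psi> z \<in> cube d 0 h} = (\<lambda>z. vec_of d (\<lambda>i. coord x i - coord (\<Psi> z) i)) -` cube d 0 h \<inter> Rn d"
          using xRn by (auto simp: diff)
        then show "{z \<in> Rn d. x - \<psi> z \<in> cube d 0 h} \<in> sets (leb d)"
          using measurable_sets_borel[OF mz cube_borel] Rn_borel by simp
      qed
      also have "\<dots> \<le> ennreal (((1 + 2 * \<eta>) * h) ^ d)" using True h by (intro h0(2)) auto
      finally show ?thesis using True by simp
    qed simp
  qed
  also have "\<dots> = ennreal (((1 + 2 * \<eta>) * h) ^ d) * emeasure (leb d) b"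
    by (simp add: nn_integral_cmult)
  also have "\<dots> = ennreal (h ^ d) * (ennreal ((1 + 2 * \<eta>) ^ d * (r * (1 + \<eta>)) ^ d) * emeasure (leb d) (eucl_ball d 0 1))"
    unfolding b_def using emeasure_eucl_ball_scale[OF centre, of "r * (1 + \<eta>)"] radius \<eta> h
    by (simp add: power_mult_distrib ennreal_mult mult_ac)
  finally show ?thesis
    using h by (subst (asm) ennreal_mult_le_mult_iff) auto
qed

lemma measure_body_le: "measure (leb d) body \<le> r ^ d * measure (leb d) (eucl_ball d 0 1)"
proof -
  let ?v = "measure (leb d) (eucl_ball d 0 1)"
  have fin: "emeasure (leb d) (eucl_ball d 0 1) = ennreal ?v"
    using emeasure_eucl_ball_finite[of 0 d 1] by (intro emeasure_eq_ennreal_measure) auto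
  have le: "measure (leb d) body \<le> (1 + 2 * \<eta>) ^ d * (r * (1 + \<eta>)) ^ d * ?v" if "0 < \<eta>" for \<eta>
  proof -
    have "emeasure (leb d) body \<le> ennreal ((1 + 2 * \<eta>) ^ d * (r * (1 + \<eta>)) ^ d * ?v)"
      using emeasure_body_le_approx[OF that] that radius by (simp add: fin ennreal_mult[symmetric])
    then show ?thesis
      unfolding measure_def using that radius by (intro enn2real_leI) auto
  qed
  have "((\<lambda>\<eta>. (1 + 2 * \<eta>) ^ d * (r * (1 + \<eta>)) ^ d * ?v) \<longlongrightarrow> (1 + 2 * 0) ^ d * (r * (1 + 0)) ^ d * ?v) (at_right 0)"
    by (intro tendsto_intros)
  moreover have "\<forall>\<^sub>F \<eta> in at_right 0. measure (leb d) body \<le> (1 + 2 * \<eta>) ^ d * (r * (1 + \<eta>)) ^ d * ?v"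
    using eventually_at_right_less[of "0::real"] by eventually_elim (rule le)
  ultimately have "measure (leb d) body \<le> (1 + 2 * 0) ^ d * (r * (1 + 0)) ^ d * ?v"
    by (intro tendsto_lowerbound[of _ _ "at_right (0::real)"]) auto
  then show ?thesis by simp
qed

lemma emeasure_body_finite: "emeasure (leb d) body < \<infinity>"
proof -
  have "emeasure (leb d) body \<le> ennreal ((1 + 2 * 1) ^ d * (r * (1 + 1)) ^ d) * emeasure (leb d) (eucl_ball d 0 1)"
    by (rule emeasure_body_le_approx) simp
  also have "\<dots> < \<infinity>" using emeasure_eucl_ball_finite[of 0 d 1] by (simp add: ennreal_mult_less_top)
  finally show ?thesis .
qed

end

section \<open>Volumes of products\<close>

text \<open>The integral of \<open>exp (- h)\<close> is an average of the volumes of the sublevel sets of \<open>h\<close> with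
  weight \<open>exp (- s)\<close>.  For homogeneous \<open>h\<close> this turns volumes into integrals that are
  multiplicative under products.\<close>

lemma nn_integral_exp_homogeneous:
  fixes h :: "rseq \<Rightarrow> real" and V :: ennreal
  assumes [measurable]: "h \<in> borel_measurable borel" and nonneg: "\<And>x. x \<in> Rn d \<Longrightarrow> 0 \<le> h x"
    and level: "\<And>s. 0 < s \<Longrightarrow> emeasure (leb d) {x \<in> Rn d. h x \<le> s} = ennreal (s ^ n) * V"
  shows "(\<integral>\<^sup>+x. ennreal (exp (- h x)) \<partial>leb d) = ennreal (fact n) * V"
proof -
  interpret L: sigma_finite_measure "leb d" by (rule sigma_finite_leb)
  interpret pair_sigma_finite "leb d" "lborel :: real measure" ..
  have exp_int: "ennreal (exp (- a)) = (\<integral>\<^sup>+s. ennreal (exp (- s)) * indicator {a..} s \<partial>lborel)" for a :: real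
  proof -
    have "(\<integral>\<^sup>+s. ennreal (exp (- s)) * indicator {a..} s \<partial>lborel) = ennreal (0 - (- exp (- a)))"
    proof (rule nn_integral_FTC_atLeast[where F = "\<lambda>s. - exp (- s)"])
      show "((\<lambda>s. - exp (- s)) has_real_derivative exp (- s)) (at s)" for s :: real
        by (auto intro!: derivative_eq_intros)
      have "((\<lambda>s::real. - exp (- s)) \<longlongrightarrow> - 0) at_top"
        by (intro tendsto_minus filterlim_compose[OF exp_at_bot filterlim_uminus_at_bot_at_top])
      then show "((\<lambda>s::real. - exp (- s)) \<longlongrightarrow> 0) at_top" by simp
    qed auto
    then show ?thesis by simp
  qed
  have m: "(\<lambda>(x, s). ennreal (exp (- s)) * indicator {h x..} s) \<in> borel_measurable (leb d \<Otimes>\<^sub>M lborel)"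
  proof -
    have "{p \<in> space (leb d \<Otimes>\<^sub>M lborel). h (fst p) \<le> snd p} \<in> sets (leb d \<Otimes>\<^sub>M lborel)"
      by (rule borel_measurable_le) (auto intro!: measurable_compose[OF measurable_fst])
    then have "(\<lambda>p. ennreal (exp (- snd p)) * indicator {p \<in> space (leb d \<Otimes>\<^sub>M lborel). h (fst p) \<le> snd p} p)
        \<in> borel_measurable (leb d \<Otimes>\<^sub>M lborel)"
      by (intro borel_measurable_times_ennreal borel_measurable_indicator) auto
    also have "(\<lambda>p. ennreal (exp (- snd p)) * indicator {p \<in> space (leb d \<Otimes>\<^sub>M lborel). h (fst p) \<le> snd p} p)
        = (\<lambda>(x, s). ennreal (exp (- s)) * indicator {h x..} s)"
      by (auto simp: indicator_def fun_eq_iff space_pair_measure)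
    finally show ?thesis .
  qed
  have "(\<integral>\<^sup>+x. ennreal (exp (- h x)) \<partial>leb d) = (\<integral>\<^sup>+x. (\<integral>\<^sup>+s. ennreal (exp (- s)) * indicator {h x..} s \<partial>lborel) \<partial>leb d)"
    by (rule nn_integral_cong) (rule exp_int)
  also have "\<dots> = (\<integral>\<^sup>+s. (\<integral>\<^sup>+x. ennreal (exp (- s)) * indicator {h x..} s \<partial>leb d) \<partial>lborel)"
    by (rule Fubini'[OF m, symmetric])
  also have "\<dots> = (\<integral>\<^sup>+s. ennreal (s ^ n * exp (- s)) * indicator {0..} s * V \<partial>lborel)"
  proof (rule nn_integral_cong_AE, use AE_lborel_singleton[of "0::real"] in eventually_elim)
    case (elim s)
    have "(\<integral>\<^sup>+x. ennreal (exp (- s)) * indicator {h x..} s \<partial>leb d)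
        = (\<integral>\<^sup>+x. ennreal (exp (- s)) * indicator {x \<in> Rn d. h x \<le> s} x \<partial>leb d)"
      by (intro nn_integral_leb_cong) (auto simp: indicator_def)
    also have "\<dots> = ennreal (exp (- s)) * emeasure (leb d) {x \<in> Rn d. h x \<le> s}"
      by (subst nn_integral_cmult_indicator) auto
    also have "\<dots> = ennreal (s ^ n * exp (- s)) * indicator {0..} s * V"
    proof (cases "0 < s")
      case True
      then show ?thesis by (simp add: level ennreal_mult mult_ac)
    next
      case False
      then have "{x \<in> Rn d. h x \<le> s} = {}" using nonneg elim by fastforce
      then show ?thesis by (simp only: emeasure_empty) (use False elim in simp)
    qed
    finally show ?case .
  qed
  also have "\<dots> = (\<integral>\<^sup>+s. ennreal (s ^ n * exp (- s)) * indicator {0..} s \<partial>lborel) * V"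
    by (rule nn_integral_multc) measurable
  also have "\<dots> = ennreal (fact n) * V"
    by (simp add: nn_intergal_power_times_exp_Ici)
  finally show ?thesis .
qed

lemma nn_integral_gaussian: "(\<integral>\<^sup>+x. ennreal (exp (- x\<^sup>2)) \<partial>lborel) = ennreal (sqrt pi)"
proof -
  have "has_bochner_integral lborel (\<lambda>x::real. exp (- x\<^sup>2)) (2 *\<^sub>R (sqrt pi / 2))"
    by (rule has_bochner_integral_even_function[OF gaussian_moment_0]) simp
  then have "has_bochner_integral lborel (\<lambda>x::real. exp (- x\<^sup>2)) (sqrt pi)" by simp
  then show ?thesis
    using has_bochner_integral_integral_eq nn_integral_eq_integral[of lborel "\<lambda>x::real. exp (- x\<^sup>2)"]
    by (metis (no_types, lifting) AE_I2 exp_ge_zero has_bochner_integral_iff)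
qed

text \<open>The Gaussian integral over \<open>\<real>\<^sup>2\<^sup>n\<close> is a product of \<open>2 n\<close> integrals with value \<open>sqrt pi\<close>.\<close>

lemma emeasure_unit_ball: "ennreal (fact n) * emeasure (leb (2*n)) (eucl_ball (2*n) 0 1) = ennreal (pi ^ n)"
proof -
  let ?d = "2*n"
  have "ennreal (fact n) * emeasure (leb ?d) (eucl_ball ?d 0 1) = (\<integral>\<^sup>+x. ennreal (exp (- eucl_inner ?d x x)) \<partial>leb ?d)"
  proof (rule nn_integral_exp_homogeneous[symmetric])
    show "(\<lambda>x. eucl_inner ?d x x) \<in> borel_measurable borel"
      by (intro borel_measurable_continuous_onI continuous_intros)
    fix s :: real assume s: "0 < s"
    have "{x \<in> Rn ?d. eucl_inner ?d x x \<le> s} = eucl_ball ?d 0 (sqrt s)"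
      by (auto simp: eucl_ball_def)
    then show "emeasure (leb ?d) {x \<in> Rn ?d. eucl_inner ?d x x \<le> s} = ennreal (s ^ n) * emeasure (leb ?d) (eucl_ball ?d 0 1)"
      using emeasure_eucl_ball_scale[of 0 ?d "sqrt s"] s by (simp add: power_mult)
  qed simp
  also have "\<dots> = (\<integral>\<^sup>+x. ennreal (exp (- eucl_inner ?d (vec_of ?d x) (vec_of ?d x))) \<partial>coord_measure ?d)"
    by (rule nn_integral_leb) (intro borel_measurable_continuous_onI continuous_intros measurable_compose[OF _ measurable_ennreal])
  also have "\<dots> = (\<integral>\<^sup>+x. (\<Prod>i\<in>{..<?d}. ennreal (exp (- (x i)\<^sup>2))) \<partial>coord_measure ?d)"
    by (intro nn_integral_cong)
       (simp add: eucl_inner_def coord_vec_of prod_ennreal exp_sum[symmetric] power2_eq_square sum_negf)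
  also have "\<dots> = (\<Prod>i\<in>{..<?d}. (\<integral>\<^sup>+x. ennreal (exp (- x\<^sup>2)) \<partial>lborel))"
    by (rule lborel_product.product_nn_integral_prod) auto
  also have "\<dots> = ennreal (pi ^ n)"
    by (simp add: nn_integral_gaussian ennreal_power power_mult)
  finally show ?thesis .
qed

context gauge_body
begin

lemma mink_measurable: "(\<lambda>x. if x \<in> Rn d then mink Y x else 0) \<in> borel_measurable borel"
  by (intro borel_measurable_continuous_on_if mink_continuous continuous_on_const) auto

lemma borel: "Y \<in> sets borel"
  using closed by (rule borel_closed)

lemma sublevel: "0 \<le> s \<Longrightarrow> {x \<in> Rn d. mink Y x \<le> s} = (*\<^sub>R) s ` Y"
proof -
  assume s: "0 \<le> s"
  have "(*\<^sub>R) s ` Y \<subseteq> Rn d" using sub by auto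
  then show ?thesis using mink_le_iff[OF _ s] by blast
qed

lemma emeasure_finite: "emeasure (leb d) Y < \<infinity>"
proof -
  obtain R where "R > 0" "\<And>y. y \<in> Y \<Longrightarrow> norm y \<le> R" using bounded by blast
  then show ?thesis
    using abs_coord_le_norm order_trans by (intro emeasure_leb_bounded_finite[of _ _ R]) blast
qed

lemma measure_pos: "0 < measure (leb d) Y"
proof -
  obtain C where C: "C > 0" "\<And>y. y \<in> Rn d \<Longrightarrow> mink Y y \<le> C * norm y" using mink_upper_bound by blast
  define h where "h = 1 / (C * (real d + 1))"
  have h: "h > 0" using C(1) by (simp add: h_def)
  have "cube d 0 h \<inter> Rn d \<subseteq> Y"
  proof
    fix x assume x: "x \<in> cube d 0 h \<inter> Rn d"
    then have "norm x \<le> real d * h" by (intro norm_le_coord_bound) (auto simp: cube_def)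
    then have "C * norm x \<le> C * ((real d + 1) * h)"
      using C(1) h by (intro mult_left_mono) (auto simp: algebra_simps)
    also have "\<dots> = 1" using C(1) by (simp add: h_def)
    finally have "mink Y x \<le> 1" using C(2)[of x] x by simp
    then show "x \<in> Y" using mink_le_iff[of x 1] x by simp
  qed
  then have "emeasure (leb d) (cube d 0 h \<inter> Rn d) \<le> emeasure (leb d) Y"
    using borel by (intro emeasure_mono) auto
  moreover have "emeasure (leb d) (cube d 0 h \<inter> Rn d) = emeasure (leb d) (cube d 0 h)"
    by (rule emeasure_eq_AE) (use AE_leb_Rn[of d] in \<open>auto elim!: eventually_mono\<close>)
  ultimately have "ennreal (h ^ d) \<le> emeasure (leb d) Y" using emeasure_cube[of 0 h d] h by simp
  moreover have "0 < ennreal (h ^ d)" using h by simp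
  ultimately have "0 < emeasure (leb d) Y" by (rule less_le_trans[rotated])
  then show ?thesis using emeasure_finite by (simp add: measure_def enn2real_positive_iff)
qed

lemma emeasure_eq: "emeasure (leb d) Y = ennreal (measure (leb d) Y)"
  using emeasure_finite by (intro emeasure_eq_ennreal_measure) auto

lemma scale_borel: "(*\<^sub>R) s ` Y \<in> sets borel"
  using closed_scaling[OF closed] by (rule borel_closed)

lemma emeasure_scaled: "0 < s \<Longrightarrow> emeasure (leb d) ((*\<^sub>R) s ` Y) = ennreal (s ^ d * measure (leb d) Y)"
  using emeasure_scale[OF _ borel sub, of s] by (simp add: emeasure_eq ennreal_mult)

lemma measure_shell:
  assumes st: "0 < s" "s < t" and d: "d > 0"
  shows "0 < emeasure (leb d) {x \<in> Rn d. s < mink Y x \<and> mink Y x \<le> t}"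
    "{x \<in> Rn d. s < mink Y x \<and> mink Y x \<le> t} \<in> sets borel"
proof -
  have eq: "{x \<in> Rn d. s < mink Y x \<and> mink Y x \<le> t} = ((*\<^sub>R) t ` Y) - ((*\<^sub>R) s ` Y)"
  proof -
    have "(*\<^sub>R) t ` Y - (*\<^sub>R) s ` Y = {x \<in> Rn d. mink Y x \<le> t} - {x \<in> Rn d. mink Y x \<le> s}"
      using st by (simp add: sublevel)
    then show ?thesis by auto
  qed
  show "{x \<in> Rn d. s < mink Y x \<and> mink Y x \<le> t} \<in> sets borel"
    unfolding eq by (intro sets.Diff scale_borel)
  have sub': "(*\<^sub>R) s ` Y \<subseteq> (*\<^sub>R) t ` Y" using scale_mono st by (meson less_imp_le subsetI)
  have "emeasure (leb d) ((*\<^sub>R) t ` Y - (*\<^sub>R) s ` Y) = ennreal (t ^ d * measure (leb d) Y) - ennreal (s ^ d * measure (leb d) Y)"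
    using st by (subst emeasure_Diff[OF _ _ _ sub']) (auto simp: emeasure_scaled scale_borel)
  also have "\<dots> = ennreal (t ^ d * measure (leb d) Y - s ^ d * measure (leb d) Y)"
    using st by (intro ennreal_minus) auto
  finally have *: "emeasure (leb d) {x \<in> Rn d. s < mink Y x \<and> mink Y x \<le> t} = ennreal (t ^ d * measure (leb d) Y - s ^ d * measure (leb d) Y)"
    by (simp only: eq)
  have "s ^ d < t ^ d" using st d by (intro power_strict_mono) auto
  then have "s ^ d * measure (leb d) Y < t ^ d * measure (leb d) Y"
    using measure_pos by (intro mult_strict_right_mono)
  then show "0 < emeasure (leb d) {x \<in> Rn d. s < mink Y x \<and> mink Y x \<le> t}" by (simp add: *)
qed

lemma gauge_integral:
  assumes d: "d = 2*n"
  shows "(\<integral>\<^sup>+x. ennreal (exp (- (if x \<in> Rn d then mink Y x else 0)\<^sup>2)) \<partial>leb d) = ennreal (fact n) * emeasure (leb d) Y"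
proof (rule nn_integral_exp_homogeneous)
  show "(\<lambda>x. (if x \<in> Rn d then mink Y x else 0)\<^sup>2) \<in> borel_measurable borel"
    using mink_measurable by (rule borel_measurable_power)
  fix s :: real assume s: "0 < s"
  have "{x \<in> Rn d. (if x \<in> Rn d then mink Y x else 0)\<^sup>2 \<le> s} = {x \<in> Rn d. mink Y x \<le> sqrt s}"
    using s by (auto simp: real_le_rsqrt) (metis mink_nonneg power2_le_iff_abs_le abs_of_nonneg real_sqrt_pow2 less_imp_le power_mono)
  also have "\<dots> = (*\<^sub>R) (sqrt s) ` Y" using s by (intro sublevel) auto
  finally have eq: "{x \<in> Rn d. (if x \<in> Rn d then mink Y x else 0)\<^sup>2 \<le> s} = (*\<^sub>R) (sqrt s) ` Y" .
  have "sqrt s ^ d = s ^ n" using s by (simp add: d power_mult)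
  then show "emeasure (leb d) {x \<in> Rn d. (if x \<in> Rn d then mink Y x else 0)\<^sup>2 \<le> s} = ennreal (s ^ n) * emeasure (leb d) Y"
    unfolding eq using s emeasure_scaled[of "sqrt s"] by (simp add: emeasure_eq ennreal_mult)
qed simp

end

text \<open>The \<open>2\<close>-product has squared gauge \<open>mink X\<^sup>2 + mink Y\<^sup>2\<close>, so its Gaussian gauge integral
  factors.\<close>

lemma volume_two_product:
  assumes X: "gauge_body (2*n) X" and Y: "gauge_body (2*m) Y"
  defines "P \<equiv> {z \<in> Rn (2*n + 2*m). (mink X (proj 0 (2*n) z))\<^sup>2 + (mink Y (proj (2*n) (2*m) z))\<^sup>2 \<le> 1}"
  shows "ennreal (fact (n + m)) * emeasure (leb (2*n + 2*m)) P
      = (ennreal (fact n) * emeasure (leb (2*n)) X) * (ennreal (fact m) * emeasure (leb (2*m)) Y)"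
    "P \<in> sets borel"
proof -
  interpret X: gauge_body "2*n" X by (rule X)
  interpret Y: gauge_body "2*m" Y by (rule Y)
  let ?D = "2*n + 2*m"
  (* The gauges are continuous on the coordinate subspaces; the value 0 elsewhere makes them Borel. *)
  let ?gX = "\<lambda>x. if x \<in> Rn (2*n) then mink X x else 0"
  let ?gY = "\<lambda>y. if y \<in> Rn (2*m) then mink Y y else 0"
  define h where "h z = (?gX (proj 0 (2*n) z))\<^sup>2 + (?gY (proj (2*n) (2*m) z))\<^sup>2" for z
  have h: "h z = (mink X (proj 0 (2*n) z))\<^sup>2 + (mink Y (proj (2*n) (2*m) z))\<^sup>2" for z
    by (simp add: h_def)
  note [measurable] = X.mink_measurable Y.mink_measurable
  have [measurable]: "proj o' k \<in> borel_measurable borel" for o' k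
    by (rule bounded_linear_borel[OF bounded_linear_proj])
  have hm [measurable]: "h \<in> borel_measurable borel"
    unfolding h_def[abs_def]
    by (intro borel_measurable_add borel_measurable_power measurable_compose[OF _ X.mink_measurable]
        measurable_compose[OF _ Y.mink_measurable]) measurable
  have P: "P = {z \<in> Rn ?D. h z \<le> 1}" by (simp add: P_def h)
  show P_borel: "P \<in> sets borel"
  proof -
    have "P = (h -` {..1} \<inter> space borel) \<inter> Rn ?D" by (auto simp: P)
    also have "\<dots> \<in> sets borel" by (intro sets.Int measurable_sets[OF hm] Rn_borel) simp
    finally show ?thesis .
  qed
  have "ennreal (fact (n + m)) * emeasure (leb ?D) P = (\<integral>\<^sup>+z. ennreal (exp (- h z)) \<partial>leb ?D)"
  proof (rule nn_integral_exp_homogeneous[symmetric, OF hm])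
    show "0 \<le> h z" for z by (simp add: h)
    fix s :: real assume s: "0 < s"
    have scale: "h (c *\<^sub>R z) = c\<^sup>2 * h z" if "0 < c" for c z
      using that by (simp add: h proj_simps X.mink_scale Y.mink_scale power_mult_distrib distrib_left)
    have "{z \<in> Rn ?D. h z \<le> s} = (*\<^sub>R) (sqrt s) ` P"
    proof (intro equalityI subsetI)
      fix z assume z: "z \<in> {z \<in> Rn ?D. h z \<le> s}"
      have "h ((1 / sqrt s) *\<^sub>R z) = h z / s" using s by (subst scale) (auto simp: power_divide)
      then have "(1 / sqrt s) *\<^sub>R z \<in> P" using z s by (simp add: P)
      then show "z \<in> (*\<^sub>R) (sqrt s) ` P" using s by (intro image_eqI[of _ _ "(1 / sqrt s) *\<^sub>R z"]) auto
    next
      fix z assume "z \<in> (*\<^sub>R) (sqrt s) ` P"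
      then obtain x where x: "x \<in> Rn ?D" "h x \<le> 1" "z = sqrt s *\<^sub>R x" by (auto simp: P)
      then show "z \<in> {z \<in> Rn ?D. h z \<le> s}" using s mult_left_mono[of "h x" 1 s] by (simp add: scale)
    qed
    then show "emeasure (leb ?D) {z \<in> Rn ?D. h z \<le> s} = ennreal (s ^ (n + m)) * emeasure (leb ?D) P"
      using emeasure_scale[of "sqrt s" P ?D] s P_borel
      by (simp add: P power_add power_mult)
  qed
  also have "\<dots> = (\<integral>\<^sup>+x. (\<integral>\<^sup>+y. ennreal (exp (- h (emb 0 (2*n) x + emb (2*n) (2*m) y))) \<partial>leb (2*m)) \<partial>leb (2*n))"
    by (rule leb_product) measurable
  also have "\<dots> = (\<integral>\<^sup>+x. (\<integral>\<^sup>+y. ennreal (exp (- (?gX x)\<^sup>2)) * ennreal (exp (- (?gY y)\<^sup>2)) \<partial>leb (2*m)) \<partial>leb (2*n))"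
  proof (intro nn_integral_leb_cong)
    fix x y assume xy: "x \<in> Rn (2*n)" "y \<in> Rn (2*m)"
    then have "h (emb 0 (2*n) x + emb (2*n) (2*m) y) = (?gX x)\<^sup>2 + (?gY y)\<^sup>2"
      by (simp add: h proj_simps proj_emb_disjoint)
    then show "ennreal (exp (- h (emb 0 (2*n) x + emb (2*n) (2*m) y))) = ennreal (exp (- (?gX x)\<^sup>2)) * ennreal (exp (- (?gY y)\<^sup>2))"
      by (simp only: ennreal_mult[symmetric] exp_ge_zero exp_add[symmetric] minus_add_distrib)
  qed
  also have "\<dots> = (\<integral>\<^sup>+x. ennreal (exp (- (?gX x)\<^sup>2)) \<partial>leb (2*n)) * (\<integral>\<^sup>+y. ennreal (exp (- (?gY y)\<^sup>2)) \<partial>leb (2*m))"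
    by (subst nn_integral_cmult, measurable, subst nn_integral_multc, measurable)
  also have "\<dots> = (ennreal (fact n) * emeasure (leb (2*n)) X) * (ennreal (fact m) * emeasure (leb (2*m)) Y)"
    by (simp only: X.gauge_integral[OF refl] Y.gauge_integral[OF refl])
  finally show "ennreal (fact (n + m)) * emeasure (leb ?D) P
      = (ennreal (fact n) * emeasure (leb (2*n)) X) * (ennreal (fact m) * emeasure (leb (2*m)) Y)" .
qed

text \<open>The points whose two gauges both lie between \<open>2\<^sup>-\<^sup>1\<^sup>/\<^sup>2\<close> and \<open>2\<^sup>-\<^sup>1\<^sup>/\<^sup>q\<close> belong to the
  \<open>q\<close>-product but not to the \<open>2\<close>-product, and they form a product of two shells of positive
  volume.\<close>

lemma strict_volume_gap:
  assumes X: "gauge_body (2*n) X" and Y: "gauge_body (2*m) Y" and nm: "n \<ge> 1" "m \<ge> 1" and q: "2 < q"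
    and B: "B \<in> sets borel" "B \<subseteq> Rn (2*n + 2*m)" "emeasure (leb (2*n + 2*m)) B < \<infinity>"
    and B_iff: "\<And>z. z \<in> Rn (2*n + 2*m) \<Longrightarrow> z \<in> B \<longleftrightarrow> mink X (proj 0 (2*n) z) powr q + mink Y (proj (2*n) (2*m) z) powr q \<le> 1"
    and P: "P \<in> sets borel" "P \<subseteq> B"
    and P_le: "\<And>z. z \<in> P \<Longrightarrow> (mink X (proj 0 (2*n) z))\<^sup>2 + (mink Y (proj (2*n) (2*m) z))\<^sup>2 \<le> 1"
  shows "emeasure (leb (2*n + 2*m)) P < emeasure (leb (2*n + 2*m)) B"
proof -
  interpret X: gauge_body "2*n" X by (rule X)
  interpret Y: gauge_body "2*m" Y by (rule Y)
  let ?D = "2*n + 2*m"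
  define s t where "s = (1/2::real) powr (1/2)" and "t = (1/2::real) powr (1/q)"
  have st: "0 < s" "s < t" "s\<^sup>2 = 1/2" "t powr q = 1/2"
  proof -
    show "0 < s" by (simp add: s_def)
    show "s < t" unfolding s_def t_def using q by (intro powr_less_mono') auto
    show "s\<^sup>2 = 1/2" by (simp add: s_def powr_half_sqrt)
    show "t powr q = 1/2" using q by (simp add: t_def powr_powr)
  qed
  let ?SX = "{x \<in> Rn (2*n). s < mink X x \<and> mink X x \<le> t}"
  let ?SY = "{y \<in> Rn (2*m). s < mink Y y \<and> mink Y y \<le> t}"
  define E where "E = {z \<in> Rn ?D. proj 0 (2*n) z \<in> ?SX \<and> proj (2*n) (2*m) z \<in> ?SY}"
  note SX = X.measure_shell[OF st(1,2)] and SY = Y.measure_shell[OF st(1,2)]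
  have pm: "proj o' k \<in> borel_measurable borel" for o' k
    by (rule bounded_linear_borel[OF bounded_linear_proj])
  have E_borel: "E \<in> sets borel"
  proof -
    have "E = Rn ?D \<inter> (proj 0 (2*n) -` ?SX \<inter> proj (2*n) (2*m) -` ?SY)" by (auto simp: E_def)
    also have "\<dots> \<in> sets borel"
      using SX(2) SY(2) nm by (intro sets.Int Rn_borel measurable_sets_borel[OF pm]) auto
    finally show ?thesis .
  qed
  have "emeasure (leb ?D) E = (\<integral>\<^sup>+z. indicator E z \<partial>leb ?D)" using E_borel by simp
  also have "\<dots> = (\<integral>\<^sup>+x. (\<integral>\<^sup>+y. indicator E (emb 0 (2*n) x + emb (2*n) (2*m) y) \<partial>leb (2*m)) \<partial>leb (2*n))"
    by (rule leb_product) (use E_borel in simp)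
  also have "\<dots> = (\<integral>\<^sup>+x. (\<integral>\<^sup>+y. indicator ?SX x * indicator ?SY y \<partial>leb (2*m)) \<partial>leb (2*n))"
  proof (intro nn_integral_leb_cong)
    fix x y assume "x \<in> Rn (2*n)" "y \<in> Rn (2*m)"
    moreover have "emb 0 (2*n) x + emb (2*n) (2*m) y \<in> Rn ?D" by (intro Rn_add emb_Rn) auto
    ultimately show "indicator E (emb 0 (2*n) x + emb (2*n) (2*m) y) = (indicator ?SX x * indicator ?SY y :: ennreal)"
      by (auto simp: E_def indicator_def proj_simps proj_emb_disjoint)
  qed
  also have "\<dots> = (\<integral>\<^sup>+x. indicator ?SX x * emeasure (leb (2*m)) ?SY \<partial>leb (2*n))"
    using SY(2) nm by (intro nn_integral_cong, subst nn_integral_cmult) auto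
  also have "\<dots> = emeasure (leb (2*n)) ?SX * emeasure (leb (2*m)) ?SY"
    using SX(2) nm by (subst nn_integral_multc) auto
  finally have "emeasure (leb ?D) E = emeasure (leb (2*n)) ?SX * emeasure (leb (2*m)) ?SY" .
  moreover have "0 < emeasure (leb (2*n)) ?SX" "0 < emeasure (leb (2*m)) ?SY"
    using SX(1) SY(1) nm by auto
  ultimately have E_pos: "0 < emeasure (leb ?D) E" by (simp add: ennreal_zero_less_mult_iff)
  have "E \<subseteq> B"
  proof
    fix z assume z: "z \<in> E"
    then have "mink X (proj 0 (2*n) z) powr q \<le> t powr q" "mink Y (proj (2*n) (2*m) z) powr q \<le> t powr q"
      using q by (auto simp: E_def intro!: powr_mono2)
    then have "mink X (proj 0 (2*n) z) powr q + mink Y (proj (2*n) (2*m) z) powr q \<le> 1" using st(4) by linarith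
    then show "z \<in> B" using z B_iff[of z] by (simp add: E_def)
  qed
  have "E \<inter> P = {}"
  proof (rule ccontr)
    assume "E \<inter> P \<noteq> {}"
    then obtain z where z: "z \<in> E" "z \<in> P" by blast
    have "s\<^sup>2 < (mink X (proj 0 (2*n) z))\<^sup>2" "s\<^sup>2 < (mink Y (proj (2*n) (2*m) z))\<^sup>2"
      using z(1) st(1) by (auto simp: E_def intro!: power_strict_mono)
    then show False using P_le[OF z(2)] st(3) by linarith
  qed
  have Pfin: "emeasure (leb ?D) P < \<infinity>"
    using emeasure_mono[OF P(2), of "leb ?D"] B by (auto intro: le_less_trans)
  have "emeasure (leb ?D) P < emeasure (leb ?D) P + emeasure (leb ?D) E"
    using Pfin E_pos by (simp add: ennreal_add_left_cancel_less[of _ 0, simplified] less_top)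
  also have "\<dots> = emeasure (leb ?D) (P \<union> E)"
    using P(1) E_borel \<open>E \<inter> P = {}\<close> by (intro plus_emeasure) auto
  also have "\<dots> \<le> emeasure (leb ?D) B"
    using P(2) \<open>E \<subseteq> B\<close> B(1) by (intro emeasure_mono) auto
  finally show ?thesis .
qed

section \<open>The systolic ratio of the factors\<close>

context symplectic_ball_image
begin

lemma fact_volume_body_le: "fact N * measure (leb d) body \<le> (pi * r\<^sup>2) ^ N"
proof -
  have "ennreal (fact N * measure (leb d) (eucl_ball d 0 1)) = ennreal (pi ^ N)"
    using emeasure_unit_ball[of N] emeasure_eucl_ball_finite[of 0 d 1]
    by (simp add: ennreal_mult emeasure_eq_ennreal_measure)
  then have ball: "fact N * measure (leb d) (eucl_ball d 0 1) = pi ^ N"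
    by (subst (asm) ennreal_inj) auto
  have "fact N * measure (leb d) body \<le> fact N * (r ^ d * measure (leb d) (eucl_ball d 0 1))"
    by (intro mult_left_mono measure_body_le) simp
  also have "\<dots> = (pi * r\<^sup>2) ^ N"
    using ball by (simp add: power_mult_distrib power_mult[symmetric] mult.left_commute mult.commute)
  finally show ?thesis .
qed

lemma emeasure_body_eq: "emeasure (leb d) body = ennreal (measure (leb d) body)"
  using emeasure_body_finite by (intro emeasure_eq_ennreal_measure) auto

text \<open>The infimum of the empty set carries no information, so the bound on actions bounds the capacity
  only together with the existence of a characteristic.\<close>

lemma c_EHZ_factor_ge:
  assumes lk: "l + k \<le> N" and X: "X \<subseteq> Rn (2*k)" "closed X"
    and proj: "\<And>z. z \<in> body \<Longrightarrow> proj (2*l) (2*k) z \<in> X"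
    and emb: "\<And>x. x \<in> X \<Longrightarrow> emb (2*l) (2*k) x \<in> body"
    and ex: "\<exists>\<gamma>. gen_closed_characteristic k X \<gamma>"
  shows "pi * r\<^sup>2 \<le> c_EHZ k X"
  unfolding c_EHZ_def
proof (rule cInf_greatest)
  show "action k ` {\<gamma>. gen_closed_characteristic k X \<gamma>} \<noteq> {}" using ex by auto
  fix c assume "c \<in> action k ` {\<gamma>. gen_closed_characteristic k X \<gamma>}"
  then show "pi * r\<^sup>2 \<le> c"
    using factor_characteristic_action_ge[OF lk X proj emb] by auto
qed

end

lemma sys_le_1_imp:
  assumes "k \<ge> 1" "0 \<le> c_EHZ k X" "0 < Vol (2*k) X" "sys k X \<le> 1"
  shows "c_EHZ k X ^ k \<le> fact k * Vol (2*k) X"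
proof -
  have pos: "0 < fact k * Vol (2*k) X" using assms by simp
  then have root: "0 < root k (fact k * Vol (2*k) X)" using assms by simp
  then have "c_EHZ k X \<le> root k (fact k * Vol (2*k) X)"
    using assms(4) by (simp add: sys_def pos_divide_le_eq)
  then have "c_EHZ k X ^ k \<le> root k (fact k * Vol (2*k) X) ^ k" using assms by (intro power_mono)
  then show ?thesis using pos assms(1) by simp
qed

lemma sys_eq_1I:
  assumes "k \<ge> 1" "0 < c_EHZ k X" "fact k * Vol (2*k) X = c_EHZ k X ^ k"
  shows "sys k X = 1"
  using assms by (simp add: sys_def real_root_power_cancel)

lemma scaled_subset:
  assumes "convex X" "0 \<in> X" "0 \<le> s" "s \<le> (1::real)"
  shows "(*\<^sub>R) s ` X \<subseteq> X"
proof
  fix y assume "y \<in> (*\<^sub>R) s ` X"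
  then obtain x where x: "x \<in> X" "y = s *\<^sub>R x" by auto
  have "s *\<^sub>R x + (1 - s) *\<^sub>R 0 \<in> X" using assms x by (intro convexD) auto
  then show "y \<in> X" using x by simp
qed

lemma p_product_proj:
  assumes X: "X \<subseteq> Rn d" "convex X" "0 \<in> X" and Y: "Y \<subseteq> Rn e" "convex Y" "0 \<in> Y"
    and p: "1 \<le> p" and z: "z \<in> p_product d e p X Y"
  shows "proj 0 d z \<in> X" "proj d e z \<in> Y"
proof -
  have "proj 0 d z \<in> X \<and> proj d e z \<in> Y"
  proof (cases "p = \<infinity>")
    case True
    then show ?thesis using z vprod_iff[OF X(1) Y(1)] by (simp add: p_product_def)
  next
    case False
    then obtain q where q: "p = ereal q" "1 \<le> q" using p by (cases p) auto
    have "\<exists>t\<in>{0..1}. proj 0 d z \<in> (*\<^sub>R) ((1 - t) powr (1 / q)) ` X \<and> proj d e z \<in> (*\<^sub>R) (t powr (1 / q)) ` Y"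
      using z p_product_iff[OF X(1) Y(1) False, of z] q by simp
    then obtain t where t: "t \<in> {0..1}" "proj 0 d z \<in> (*\<^sub>R) ((1 - t) powr (1 / q)) ` X" "proj d e z \<in> (*\<^sub>R) (t powr (1 / q)) ` Y"
      by blast
    have "(1 - t) powr (1 / q) \<le> 1" "t powr (1 / q) \<le> 1"
      using t(1) q by (auto intro!: powr_le1)
    then show ?thesis
      using t scaled_subset[OF X(2,3), of "(1 - t) powr (1 / q)"] scaled_subset[OF Y(2,3), of "t powr (1 / q)"] by auto
  qed
  then show "proj 0 d z \<in> X" "proj d e z \<in> Y" by auto
qed

lemma p_product_emb:
  assumes X: "X \<subseteq> Rn d" "0 \<in> X" and Y: "Y \<subseteq> Rn e" "0 \<in> Y"
  shows "x \<in> X \<Longrightarrow> emb 0 d x \<in> p_product d e p X Y"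
    and "y \<in> Y \<Longrightarrow> emb d e y \<in> p_product d e p X Y"
proof -
  have PX: "proj 0 d (emb 0 d x) = x" "proj d e (emb 0 d x) = 0" "emb 0 d x \<in> Rn (d + e)" if "x \<in> X" for x
    using that X by (auto simp: proj_emb_disjoint subsetD intro!: emb_Rn)
  have PY: "proj d e (emb d e y) = y" "proj 0 d (emb d e y) = 0" "emb d e y \<in> Rn (d + e)" if "y \<in> Y" for y
    using that Y by (auto simp: proj_emb_disjoint subsetD intro!: emb_Rn)
  show "emb 0 d x \<in> p_product d e p X Y" if x: "x \<in> X"
  proof (cases "p = \<infinity>")
    case True
    then show ?thesis using vprod_iff[OF X(1) Y(1)] PX[OF x] x Y by (simp add: p_product_def)
  next
    case False
    have "\<exists>t\<in>{0..1}. proj 0 d (emb 0 d x) \<in> (*\<^sub>R) ((1 - t) powr (1 / real_of_ereal p)) ` X \<and>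
        proj d e (emb 0 d x) \<in> (*\<^sub>R) (t powr (1 / real_of_ereal p)) ` Y"
      using x Y by (intro bexI[of _ 0]) (auto simp: PX image_iff)
    then show ?thesis using p_product_iff[OF X(1) Y(1) False] PX(3)[OF x] by blast
  qed
  show "emb d e y \<in> p_product d e p X Y" if y: "y \<in> Y"
  proof (cases "p = \<infinity>")
    case True
    then show ?thesis using vprod_iff[OF X(1) Y(1)] PY[OF y] y X by (simp add: p_product_def)
  next
    case False
    have "\<exists>t\<in>{0..1}. proj 0 d (emb d e y) \<in> (*\<^sub>R) ((1 - t) powr (1 / real_of_ereal p)) ` X \<and>
        proj d e (emb d e y) \<in> (*\<^sub>R) (t powr (1 / real_of_ereal p)) ` Y"
      using y X by (intro bexI[of _ 1]) (auto simp: PY image_iff)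
    then show ?thesis using p_product_iff[OF X(1) Y(1) False] PY(3)[OF y] by blast
  qed
qed

text \<open>A Cartesian product has corners: over points where the first coordinates of both factors are
  maximal the gradient would be parallel to two different basis vectors.\<close>

lemma (in symplectic_ball_image) no_infinite_exponent:
  assumes N: "N = n + m" and nm: "n \<ge> 1" "m \<ge> 1"
    and X: "compact X" "X \<subseteq> Rn (2*n)" "X \<noteq> {}" and Y: "compact Y" "Y \<subseteq> Rn (2*m)" "Y \<noteq> {}"
    and body: "body = vprod (2*n) (2*m) X Y"
  shows False
proof -
  have pX: "proj (2*0) (2*n) v \<in> X" and pY: "proj (2*n) (2*m) v \<in> Y" if "v \<in> body" for v
    using that vprod_iff[OF X(2) Y(2)] by (auto simp: body)
  obtain x where x: "x \<in> X"
    and ext_x: "\<And>z. z \<in> body \<Longrightarrow> proj (2*0) (2*n) z = x \<Longrightarrow> level z = r\<^sup>2 \<and> (\<exists>g>0. grad z = g *\<^sub>R unit_vec (2*0))"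
    using factor_extreme_point[of 0 n X] N nm X pX by (metis le_add1 add_0)
  obtain y where y: "y \<in> Y"
    and ext_y: "\<And>z. z \<in> body \<Longrightarrow> proj (2*n) (2*m) z = y \<Longrightarrow> level z = r\<^sup>2 \<and> (\<exists>g>0. grad z = g *\<^sub>R unit_vec (2*n))"
    using factor_extreme_point[of n m Y] N nm Y pY by (metis order_refl)
  let ?z = "emb 0 (2*n) x + emb (2*n) (2*m) y"
  have xy: "x \<in> Rn (2*n)" "y \<in> Rn (2*m)" using x y X Y by auto
  have P: "proj 0 (2*n) ?z = x" "proj (2*n) (2*m) ?z = y"
    using xy by (auto simp: proj_simps proj_emb_disjoint)
  have z: "?z \<in> body"
    unfolding body using x y P vprod_iff[OF X(2) Y(2)] by (auto intro!: Rn_add emb_Rn)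
  obtain g where g: "g > 0" "grad ?z = g *\<^sub>R unit_vec (2*0)" using ext_x[OF z] P by auto
  obtain g' where g': "grad ?z = g' *\<^sub>R unit_vec (2*n)" using ext_y[OF z] P by auto
  have "coord (grad ?z) 0 = g" using coord_unit_vec[of 0 0] by (simp add: g(2))
  moreover have "coord (grad ?z) 0 = 0" using nm by (simp add: g')
  ultimately show False using g(1) by simp
qed

text \<open>Both parts at once: under the conjecture the chain of inequalities
  \<open>(\<pi> r\<^sup>2)\<^sup>n\<^sup>+\<^sup>m \<le> c(X)\<^sup>n c(Y)\<^sup>m \<le> n! Vol X \<cdot> m! Vol Y =
   (n+m)! Vol (X \<times>\<^sub>2 Y) \<le> (n+m)! Vol B \<le> (\<pi> r\<^sup>2)\<^sup>n\<^sup>+\<^sup>m\<close>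
  consists of equalities; here \<open>p \<ge> 2\<close>, and the smaller exponents are excluded by smoothness.  Equal
  volumes of the \<open>2\<close>-product and \<open>B\<close> force \<open>p = 2\<close>, and equality in the second step, where both
  factors are bounded separately, forces systolic ratio one.\<close>

lemma symplectic_ball_p_product_rigid:
  assumes nm: "n \<ge> 1" "m \<ge> 1" and ball: "symplectic_ball (n + m) B"
    and X: "convex_body (2*n) X" "0 \<in> X" and Y: "convex_body (2*m) Y" "0 \<in> Y"
    and p: "1 \<le> p" and B: "B = p_product (2*n) (2*m) p X Y"
    and V: weak_Viterbo
  shows "p = 2 \<and> sys n X = 1 \<and> sys m Y = 1"
proof -
  obtain \<phi> a r where chart: "symplectomorphism (n + m) \<phi>" "a \<in> Rn (2*(n+m))" "r > 0" "B = \<phi> ` eucl_ball (2*(n+m)) a r"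
    using ball by (auto simp: symplectic_ball_def)
  interpret S: symplectic_ball_image "n + m" \<phi> a r
    by unfold_locales (use chart in auto)
  have body: "S.body = B" by (simp add: S.body_def chart(4))
  have dims: "2*(n+m) = 2*n + 2*m" by simp
  have X': "X \<subseteq> Rn (2*n)" "compact X" "convex X" and Y': "Y \<subseteq> Rn (2*m)" "compact Y" "convex Y"
    using X Y by (auto simp: convex_body_def)
  have pX: "proj (2*0) (2*n) z \<in> X" and pY: "proj (2*n) (2*m) z \<in> Y" if "z \<in> S.body" for z
    using that p_product_proj[OF X'(1,3) X(2) Y'(1,3) Y(2) p, of z] by (auto simp: body B)
  have eX: "emb (2*0) (2*n) x \<in> S.body" if "x \<in> X" for x
    using that p_product_emb(1)[OF X'(1) X(2) Y'(1) Y(2)] by (simp add: body B)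
  have eY: "emb (2*n) (2*m) y \<in> S.body" if "y \<in> Y" for y
    using that p_product_emb(2)[OF X'(1) X(2) Y'(1) Y(2)] by (simp add: body B)
  have GX: "gauge_body (2*n) X"
  proof
    show "\<exists>s>0. s *\<^sub>R v \<in> X" if "v \<in> Rn (2*n)" for v
      by (rule S.complementary_factor_absorbing[of n m 0 n Y X v]) (use that nm Y' Y X' pX pY eY in auto)
  qed (use X X' in auto)
  have GY: "gauge_body (2*m) Y"
  proof
    show "\<exists>s>0. s *\<^sub>R v \<in> Y" if "v \<in> Rn (2*m)" for v
      by (rule S.complementary_factor_absorbing[of 0 n n m X Y v]) (use that nm Y' X X' pX pY eX in auto)
  qed (use Y Y' in auto)
  interpret GX: gauge_body "2*n" X by (rule GX)
  interpret GY: gauge_body "2*m" Y by (rule GY)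
  have "p \<noteq> \<infinity>"
  proof
    assume "p = \<infinity>"
    then have "S.body = vprod (2*n) (2*m) X Y" by (simp add: body B p_product_def)
    then show False
      using S.no_infinite_exponent[OF refl nm X'(2,1) _ Y'(2,1)] X(2) Y(2) by auto
  qed
  then obtain q where q: "p = ereal q" "1 \<le> q" using p by (cases p) auto
  have B_iff: "z \<in> B \<longleftrightarrow> z \<in> Rn (2*n + 2*m) \<and> mink X (proj 0 (2*n) z) powr q + mink Y (proj (2*n) (2*m) z) powr q \<le> 1" for z
    using p_product_gauge[OF GX GY p \<open>p \<noteq> \<infinity>\<close>, of z] by (simp add: B q)
  have q2: "2 \<le> q"
  proof (rule ccontr)
    assume "\<not> 2 \<le> q"
    then show False
      using S.no_small_exponent[of 0 n n m X Y q] nm GX GY pX eX q B_iff body by simp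
  qed
  have splitXY: "emb (2*0) (2*n) (proj (2*0) (2*n) z) + emb (2*n) (2*m) (proj (2*n) (2*m) z) = z" if "z \<in> Rn (2*(n+m))" for z
    using that by (intro Rn_eqI[of _ "2*(n+m)"]) (auto simp: coord_emb coord_proj intro!: Rn_add emb_Rn)
  have exX: "\<exists>\<gamma>. gen_closed_characteristic n X \<gamma>"
  proof (rule S.factor_has_characteristic[of 0 n n m X Y])
    fix z y assume z: "z \<in> S.body" and y: "y \<in> Rn (2*m)" "mink Y y \<le> mink Y (proj (2*n) (2*m) z)"
    let ?v = "emb 0 (2*n) (proj 0 (2*n) z) + emb (2*n) (2*m) y"
    have P: "proj 0 (2*n) ?v = proj 0 (2*n) z" "proj (2*n) (2*m) ?v = y"
      using y by (auto simp: proj_simps proj_emb_disjoint)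
    have "mink Y y powr q \<le> mink Y (proj (2*n) (2*m) z) powr q"
      using y q by (intro powr_mono2) auto
    then show "emb (2*0) (2*n) (proj (2*0) (2*n) z) + emb (2*n) (2*m) y \<in> S.body"
      using z B_iff[of z] B_iff[of ?v] P by (auto simp: body intro!: Rn_add emb_Rn)
  qed (use nm X X' GY pX eX splitXY in auto)
  have exY: "\<exists>\<gamma>. gen_closed_characteristic m Y \<gamma>"
  proof (rule S.factor_has_characteristic[of n m 0 n Y X])
    fix z x assume z: "z \<in> S.body" and x: "x \<in> Rn (2*n)" "mink X x \<le> mink X (proj (2*0) (2*n) z)"
    let ?v = "emb 0 (2*n) x + emb (2*n) (2*m) (proj (2*n) (2*m) z)"
    have P: "proj 0 (2*n) ?v = x" "proj (2*n) (2*m) ?v = proj (2*n) (2*m) z"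
      using x by (auto simp: proj_simps proj_emb_disjoint)
    have "mink X x powr q \<le> mink X (proj 0 (2*n) z) powr q"
      using x q by (intro powr_mono2) auto
    then have "?v \<in> S.body"
      using z B_iff[of z] B_iff[of ?v] P by (auto simp: body intro!: Rn_add emb_Rn)
    then show "emb (2*n) (2*m) (proj (2*n) (2*m) z) + emb (2*0) (2*n) x \<in> S.body"
      by (simp add: add.commute[of "emb (2*n) (2*m) (proj (2*n) (2*m) z)"])
  qed (use nm Y Y' GX pY eY splitXY in \<open>auto simp: add.commute\<close>)
  let ?A = "pi * r\<^sup>2"
  have A: "?A > 0" using S.radius by simp
  have cX: "?A \<le> c_EHZ n X"
    using S.c_EHZ_factor_ge[of 0 n X] X' GX.closed pX eX exX by simp
  have cY: "?A \<le> c_EHZ m Y"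
    using S.c_EHZ_factor_ge[of n m Y] Y' GY.closed pY eY exY by simp
  have VX: "Vol (2*n) X = measure (leb (2*n)) X" and VY: "Vol (2*m) Y = measure (leb (2*m)) Y"
    using Vol_eq_leb[OF GX.borel GX.sub] Vol_eq_leb[OF GY.borel GY.sub] by auto
  have "c_EHZ n X ^ n \<le> fact n * Vol (2*n) X"
    using V X(1) nm A cX GX.measure_pos VX by (intro sys_le_1_imp) (auto simp: weak_Viterbo_def)
  moreover have "?A ^ n \<le> c_EHZ n X ^ n" using A cX by (intro power_mono) auto
  ultimately have vX: "?A ^ n \<le> c_EHZ n X ^ n" "c_EHZ n X ^ n \<le> fact n * measure (leb (2*n)) X"
    by (simp_all add: VX)
  have "c_EHZ m Y ^ m \<le> fact m * Vol (2*m) Y"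
    using V Y(1) nm A cY GY.measure_pos VY by (intro sys_le_1_imp) (auto simp: weak_Viterbo_def)
  moreover have "?A ^ m \<le> c_EHZ m Y ^ m" using A cY by (intro power_mono) auto
  ultimately have vY: "?A ^ m \<le> c_EHZ m Y ^ m" "c_EHZ m Y ^ m \<le> fact m * measure (leb (2*m)) Y"
    by (simp_all add: VY)
  (* The 2-product of X and Y. *)
  define P where "P = {z \<in> Rn (2*n + 2*m). (mink X (proj 0 (2*n) z))\<^sup>2 + (mink Y (proj (2*n) (2*m) z))\<^sup>2 \<le> 1}"
  note volP = volume_two_product[OF GX GY, folded P_def]
  have P_sub: "P \<subseteq> B"
  proof
    fix z assume z: "z \<in> P"
    let ?x = "mink X (proj 0 (2*n) z)" and ?y = "mink Y (proj (2*n) (2*m) z)"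
    have nn: "0 \<le> ?x" "0 \<le> ?y" by auto
    have s: "?x\<^sup>2 + ?y\<^sup>2 \<le> 1" using z by (simp add: P_def)
    have pw: "t powr q \<le> t\<^sup>2" if "0 \<le> t" "t\<^sup>2 \<le> 1" for t :: real
    proof (cases "t = 0")
      case False
      then have "t powr q \<le> t powr 2" using that q2 by (intro powr_mono') (auto simp: abs_square_le_1)
      then show ?thesis using False that by simp
    qed simp
    have "?x powr q \<le> ?x\<^sup>2" using s nn zero_le_power2[of ?y] by (intro pw) linarith+
    moreover have "?y powr q \<le> ?y\<^sup>2" using s nn zero_le_power2[of ?x] by (intro pw) linarith+
    ultimately show "z \<in> B" using z s B_iff[of z] by (auto simp: P_def)
  qed
  have Bfin: "emeasure (leb (2*n + 2*m)) B < \<infinity>" "B \<in> sets borel" "B \<subseteq> Rn (2*n + 2*m)"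
    using S.emeasure_body_finite S.body_borel S.body_Rn by (simp_all add: body dims)
  have PB: "emeasure (leb (2*n + 2*m)) P \<le> emeasure (leb (2*n + 2*m)) B"
    using P_sub Bfin by (intro emeasure_mono) auto
  then have Pfin: "emeasure (leb (2*n + 2*m)) P = ennreal (measure (leb (2*n + 2*m)) P)"
    using Bfin(1) by (intro emeasure_eq_ennreal_measure) (auto simp: top_unique)
  have Beq: "emeasure (leb (2*n + 2*m)) B = ennreal (measure (leb (2*n + 2*m)) B)"
    using S.emeasure_body_eq by (simp add: body dims)
  have "ennreal (fact (n + m) * measure (leb (2*n + 2*m)) P)
      = ennreal ((fact n * measure (leb (2*n)) X) * (fact m * measure (leb (2*m)) Y))"
    using volP(1) by (simp add: Pfin GX.emeasure_eq GY.emeasure_eq ennreal_mult)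
  then have volP': "fact (n + m) * measure (leb (2*n + 2*m)) P
      = (fact n * measure (leb (2*n)) X) * (fact m * measure (leb (2*m)) Y)"
    by (subst (asm) ennreal_inj) auto
  have volB: "fact (n + m) * measure (leb (2*n + 2*m)) B \<le> ?A ^ n * ?A ^ m"
    using S.fact_volume_body_le by (simp add: body dims power_add)
  have low: "?A ^ n * ?A ^ m \<le> (fact n * measure (leb (2*n)) X) * (fact m * measure (leb (2*m)) Y)"
    using vX vY A by (intro mult_mono) auto
  have mPB: "measure (leb (2*n + 2*m)) P \<le> measure (leb (2*n + 2*m)) B"
    using PB by (simp add: Pfin Beq)
  have "fact (n + m) * measure (leb (2*n + 2*m)) P \<le> fact (n + m) * measure (leb (2*n + 2*m)) B"
    using mPB by (intro mult_left_mono) auto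
  then have eq: "(fact n * measure (leb (2*n)) X) * (fact m * measure (leb (2*m)) Y) = ?A ^ n * ?A ^ m"
    and eqPB: "fact (n + m) * measure (leb (2*n + 2*m)) P = fact (n + m) * measure (leb (2*n + 2*m)) B"
    using volP' volB low by linarith+
  have "q = 2"
  proof (rule ccontr)
    assume "q \<noteq> 2"
    then have "2 < q" using q2 by simp
    have "emeasure (leb (2*n + 2*m)) P < emeasure (leb (2*n + 2*m)) B"
      by (rule strict_volume_gap[OF GX GY nm \<open>2 < q\<close> Bfin(2,3,1) _ volP(2) P_sub])
         (use B_iff in \<open>auto simp: P_def\<close>)
    then show False using eqPB by (simp add: Pfin Beq)
  qed
  (* Lower bounds of two factors are attained if their product is attained by the product. *)
  have squeeze: "b = a'" if "a' \<le> b" "c' \<le> e'" "0 < a'" "0 < c'" "b * e' = a' * c'" for a' b c' e' :: real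
  proof (rule ccontr)
    assume "b \<noteq> a'"
    then have "a' * c' < b * c'" using that by simp
    also have "\<dots> \<le> b * e'" using that by (intro mult_left_mono) auto
    finally show False using that by simp
  qed
  have "fact n * measure (leb (2*n)) X = ?A ^ n"
    by (rule squeeze[of _ _ "?A ^ m" "fact m * measure (leb (2*m)) Y"]) (use vX vY A eq in auto)
  then have 1: "fact n * Vol (2*n) X = c_EHZ n X ^ n" using vX VX by simp
  have "fact m * measure (leb (2*m)) Y = ?A ^ m"
    by (rule squeeze[of _ _ "?A ^ n" "fact n * measure (leb (2*n)) X"]) (use vX vY A eq in \<open>auto simp: mult.commute\<close>)
  then have 2: "fact m * Vol (2*m) Y = c_EHZ m Y ^ m" using vY VY by simp
  have "sys n X = 1" using nm A cX 1 by (intro sys_eq_1I) auto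
  moreover have "sys m Y = 1" using nm A cY 2 by (intro sys_eq_1I) auto
  ultimately show ?thesis using q \<open>q = 2\<close> by simp
qed

theorem corollary1p12:
  fixes n m :: nat and B :: "rseq set"
  assumes "n \<ge> 1" and "m \<ge> 1"
    and "symplectic_ball (n + m) B"
  shows "((\<exists>X Y. \<exists>p::ereal.
              convex_body (2*n) X \<and> convex_body (2*m) Y \<and> 0 \<in> X \<and> 0 \<in> Y \<and>
              1 \<le> p \<and> p \<noteq> 2 \<and> B = p_product (2*n) (2*m) p X Y)
            \<longrightarrow> \<not> weak_Viterbo) \<and>
         ((\<exists>X Y.
              convex_body (2*n) X \<and> convex_body (2*m) Y \<and> 0 \<in> X \<and> 0 \<in> Y \<and>
              B = p_product (2*n) (2*m) 2 X Y \<and> (sys n X \<noteq> 1 \<or> sys m Y \<noteq> 1))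
            \<longrightarrow> \<not> weak_Viterbo)"
proof (intro conjI impI notI)
  assume "\<exists>X Y. \<exists>p::ereal. convex_body (2*n) X \<and> convex_body (2*m) Y \<and> 0 \<in> X \<and> 0 \<in> Y \<and>
      1 \<le> p \<and> p \<noteq> 2 \<and> B = p_product (2*n) (2*m) p X Y" and V: weak_Viterbo
  then obtain X Y p where *: "convex_body (2*n) X" "0 \<in> X" "convex_body (2*m) Y" "0 \<in> Y"
    "1 \<le> (p::ereal)" "B = p_product (2*n) (2*m) p X Y" and "p \<noteq> 2" by blast
  then show False using symplectic_ball_p_product_rigid[OF assms * V] by simp
next
  assume "\<exists>X Y. convex_body (2*n) X \<and> convex_body (2*m) Y \<and> 0 \<in> X \<and> 0 \<in> Y \<and>
      B = p_product (2*n) (2*m) 2 X Y \<and> (sys n X \<noteq> 1 \<or> sys m Y \<noteq> 1)" and V: weak_Viterbo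
  then obtain X Y where *: "convex_body (2*n) X" "0 \<in> X" "convex_body (2*m) Y" "0 \<in> Y"
    "B = p_product (2*n) (2*m) 2 X Y" and **: "sys n X \<noteq> 1 \<or> sys m Y \<noteq> 1" by blast
  have "(1::ereal) \<le> 2" by simp
  then show False using symplectic_ball_p_product_rigid[OF assms *(1-4) _ *(5) V] ** by simp
qed

end
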